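(* Let $\phi:\mathbb{R}^2\to\mathbb{R}$ be a nonnegative, twice continuously differentiable, strictly convex function whose Hessian $H(\phi)$ satisfies one of the following conditions: (i) $H(\phi)(y_0)=0$ for some $y_0\in\mathbb{R}^2$; or (ii) there exists a sequence $\{y_n\}\subset\mathbb{R}^2$ with $|y_n|\to\infty$ such that $H(\phi)(y_n)\to0$ as $n\to\infty$. Let $\sigma$ be the projection measure on $\Sigma_\phi=\{(y,|y|^2+\phi(y)):y\in\mathbb{R}^2\}$. Then any extremizing sequence for the inequality $\|f\sigma\ast f\sigma\|_{L^2(\mathbb{R}^3)}\leq\mathcal R_\phi^2\|f\|_{L^2(\mathbb{R}^2)}^2$ has a subsequence which either concentrates at some point $y_0\in\mathbb{R}^2$ satisfying $H(\phi)(y_0)=0$, or concentrates at infinity.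
   Context: The projection measure $\sigma$ is defined by $\int_{\mathbb{R}^{3}} g\,d\sigma=\int_{\mathbb{R}^2} g(y,|y|^2+\phi(y))\,dy$; $f\sigma$ is the measure with $\int g\,d(f\sigma)=\int_{\mathbb{R}^2} g(y,|y|^2+\phi(y))f(y)\,dy$; convolutions are identified with their Lebesgue densities on $\mathbb{R}^3$. The optimal constant is $\mathcal R_\phi:=\sup_{0\neq f\in L^2(\mathbb{R}^2)}\|f\sigma\ast f\sigma\|_{L^2(\mathbb{R}^3)}^{1/2}/\|f\|_{L^2(\mathbb{R}^2)}$. An extremizing sequence is a sequence $\{f_n\}\subset L^2(\mathbb{R}^2)$ with $\|f_n\|_{L^2}\leq1$ and $\|f_n\sigma\ast f_n\sigma\|_{L^2(\mathbb{R}^3)}\to\mathcal R_\phi^2$. A sequence $\{f_n\}\subset L^2(\mathbb{R}^2)$ concentrates at a point $y_0$ if for every $\varepsilon,\rho>0$ there is $N$ such that $\int_{\{|y-y_0|\geq\rho\}}|f_n|^2\,dy<\varepsilon\|f_n\|_{L^2}^2$ for all $n\geq N$. It concentrates at infinity if for every $\varepsilon,\rho>0$ there is $N$ such that $\int_{\{|y|\leq\rho\}}|f_n|^2\,dy<\varepsilon\|f_n\|_{L^2}^2$ for all $n\geq N$. *)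

theory Defs
  imports "HOL-Analysis.Analysis"
begin

text \<open>The space \<open>\<real>\<^sup>3\<close> is rendered as the Euclidean space \<open>real ^ 2 \<times> real\<close>, in which the
  surface is the graph of a function on \<open>real ^ 2\<close>.\<close>

type_synonym plane = "real ^ 2"
type_synonym space3 = "(real ^ 2) \<times> real"


subsection \<open>Differentiability and convexity\<close>

definition partial_derivative :: "2 \<Rightarrow> (plane \<Rightarrow> real) \<Rightarrow> plane \<Rightarrow> real" where
  "partial_derivative i g y = frechet_derivative g (at y) (axis i 1)"

definition hessian :: "(plane \<Rightarrow> real) \<Rightarrow> plane \<Rightarrow> real ^ 2 ^ 2" where
  "hessian g y = (\<chi> i j. partial_derivative i (partial_derivative j g) y)"

definition twice_continuously_differentiable :: "(plane \<Rightarrow> real) \<Rightarrow> bool" where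
  "twice_continuously_differentiable g \<longleftrightarrow>
     (\<forall>y. g differentiable (at y)) \<and>
     (\<forall>i y. partial_derivative i g differentiable (at y)) \<and>
     (\<forall>i j. continuous_on UNIV (partial_derivative i (partial_derivative j g)))"

definition strictly_convex :: "('a::real_vector \<Rightarrow> real) \<Rightarrow> bool" where
  "strictly_convex g \<longleftrightarrow>
     (\<forall>x y t. x \<noteq> y \<longrightarrow> 0 < t \<longrightarrow> t < 1 \<longrightarrow>
        g ((1 - t) *\<^sub>R x + t *\<^sub>R y) < (1 - t) * g x + t * g y)"


subsection \<open>Square-integrable functions\<close>

definition ennreal_sqrt :: "ennreal \<Rightarrow> ennreal" where
  "ennreal_sqrt x = (if x = \<infinity> then \<infinity> else ennreal (sqrt (enn2real x)))"

definition L2_norm :: "('a::euclidean_space \<Rightarrow> complex) \<Rightarrow> ennreal" where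
  "L2_norm f = ennreal_sqrt (\<integral>\<^sup>+ x. ennreal ((cmod (f x))\<^sup>2) \<partial>lborel)"

text \<open>Elements of \<open>L\<^sup>2\<close> are represented by Borel functions; every class modulo equality almost
  everywhere has a Borel representative.\<close>

definition L2 :: "('a::euclidean_space \<Rightarrow> complex) set" where
  "L2 = {f. f \<in> borel_measurable borel \<and> L2_norm f < \<infinity>}"


subsection \<open>Projection measure and convolution\<close>

definition projection_measure :: "(plane \<Rightarrow> real) \<Rightarrow> space3 measure" where
  "projection_measure \<phi> = distr lborel borel (\<lambda>y. (y, (norm y)\<^sup>2 + \<phi> y))"

text \<open>For complex-valued \<open>f\<close> on the plane, the complex measure \<open>f\<sigma>\<close> has density \<open>f \<circ> fst\<close>
  with respect to \<open>\<sigma>\<close>.  The measures \<open>f\<sigma>\<close> and \<open>f\<sigma> * f\<sigma>\<close> need not have finite total variation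
  when \<open>f\<close> is merely in \<open>L\<^sup>2\<close>, but for nonnegative \<open>\<phi>\<close> they are finite on bounded sets; so the
  Lebesgue density \<open>h\<close> of \<open>f\<sigma> * f\<sigma>\<close> is tested against bounded Borel functions of bounded
  support, and is determined up to null sets.\<close>

definition is_convolution_density ::
    "space3 measure \<Rightarrow> (plane \<Rightarrow> complex) \<Rightarrow> (space3 \<Rightarrow> complex) \<Rightarrow> bool" where
  "is_convolution_density \<sigma> f h \<longleftrightarrow>
     h \<in> borel_measurable borel \<and>
     (\<forall>r. set_integrable lborel (cball 0 r) h) \<and>
     (\<forall>g :: space3 \<Rightarrow> complex.
        g \<in> borel_measurable borel \<longrightarrow> bounded (range g) \<longrightarrow> bounded {x. g x \<noteq> 0} \<longrightarrow>
        (\<integral>x. g x * h x \<partial>lborel) =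
        (\<integral>p. g (fst p + snd p) * f (fst (fst p)) * f (fst (snd p)) \<partial>(\<sigma> \<Otimes>\<^sub>M \<sigma>)))"

definition convolution_density ::
    "space3 measure \<Rightarrow> (plane \<Rightarrow> complex) \<Rightarrow> space3 \<Rightarrow> complex" where
  "convolution_density \<sigma> f = (SOME h. is_convolution_density \<sigma> f h)"

definition optimal_constant :: "(plane \<Rightarrow> real) \<Rightarrow> ennreal" where
  "optimal_constant \<phi> =
     (SUP f \<in> {f \<in> L2. L2_norm f \<noteq> 0}.
        ennreal_sqrt (L2_norm (convolution_density (projection_measure \<phi>) f)) / L2_norm f)"

definition extremizing_sequence :: "(plane \<Rightarrow> real) \<Rightarrow> (nat \<Rightarrow> plane \<Rightarrow> complex) \<Rightarrow> bool" where
  "extremizing_sequence \<phi> f \<longleftrightarrow>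
     (\<forall>n. f n \<in> L2 \<and> L2_norm (f n) \<le> 1) \<and>
     (\<lambda>n. L2_norm (convolution_density (projection_measure \<phi>) (f n)))
       \<longlonglongrightarrow> (optimal_constant \<phi>)\<^sup>2"


subsection \<open>Concentration\<close>

definition concentrates_at :: "(nat \<Rightarrow> plane \<Rightarrow> complex) \<Rightarrow> plane \<Rightarrow> bool" where
  "concentrates_at f y0 \<longleftrightarrow>
     (\<forall>\<epsilon>>0. \<forall>\<rho>>0. \<exists>N. \<forall>n\<ge>N.
        (\<integral>\<^sup>+ y \<in> {y. norm (y - y0) \<ge> \<rho>}. ennreal ((cmod (f n y))\<^sup>2) \<partial>lborel)
          < ennreal \<epsilon> * (L2_norm (f n))\<^sup>2)"

definition concentrates_at_infinity :: "(nat \<Rightarrow> plane \<Rightarrow> complex) \<Rightarrow> bool" where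
  "concentrates_at_infinity f \<longleftrightarrow>
     (\<forall>\<epsilon>>0. \<forall>\<rho>>0. \<exists>N. \<forall>n\<ge>N.
        (\<integral>\<^sup>+ y \<in> {y. norm y \<le> \<rho>}. ennreal ((cmod (f n y))\<^sup>2) \<partial>lborel)
          < ennreal \<epsilon> * (L2_norm (f n))\<^sup>2)"

end

theory Submission
  imports Defs
begin

text \<open>
  Write \<open>\<psi> y = \<bar>y\<bar>\<^sup>2 + \<phi> y\<close> and \<open>T (y, z) = (y + z, \<psi> y + \<psi> z)\<close>.  By duality, the
  convolution density \<open>h\<close> of \<open>f\<sigma>\<close> with itself satisfies \<open>\<integral>\<bar>h\<bar>\<^sup>2 \<le> \<integral>\<integral> W \<bar>f(y)\<bar>\<^sup>2 \<bar>f(z)\<bar>\<^sup>2\<close>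
  for every positive weight \<open>W\<close> such that the image of Lebesgue measure divided by \<open>W\<close> under \<open>T\<close>
  is dominated by Lebesgue measure.  On the fibre of midpoint \<open>c\<close> the second component of \<open>T\<close>
  grows along every ray \<open>c \<plusminus> u\<close> at least as fast as for the paraboloid, so the constant weight
  \<open>\<pi>/2\<close> qualifies.  The weight can be lowered away from the diagonal, by strict convexity, and
  near a point where the Hessian does not vanish; between a bounded set and a neighbourhood of
  infinity it can be made small, at the price of raising it slightly elsewhere, because there the
  pairs only occupy a small angle of directions.  Testing with \<open>f = exp (- b P)\<close>, where \<open>P\<close> is
  the difference of \<open>\<psi>\<close> and its tangent at a point of almost vanishing Hessian, shows that
  the optimal constant to the fourth power is at least \<open>\<pi>/2\<close>.  Hence the masses \<open>\<bar>f\<^sub>n\<bar>\<^sup>2\<close> of an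
  extremizing sequence cannot charge the pairs on which some weight is lower than \<open>\<pi>/2\<close>, and a
  subsequence concentrates at a flat point or at infinity.
\<close>

subsection \<open>Integration in the plane\<close>

text \<open>The obstacle is splitting of mass into pieces, one of which may escape to infinity.
  Product masses on pairs detect it: pieces that stay apart charge the pairs straddling them, and
  where a weight lies \<delta> below \<pi>/2 on a set of pairs, almost extremal functions can only
  have vanishing product mass on it. Near infinity the compactness that makes strict convexity
  quantitative is lost, so pairs of a bounded and a far point need the separate angular argument.

  The value \<pi>/2 is that of the paraboloid: on a fibre its height is a constant plus 2|u|^2,
  which maps planar Lebesgue measure to \<pi>/2 times Lebesgue measure on a half-line. Lines through
  the midpoint are indexed by their slope m, with angular measure dm/(1+m^2) of total mass \<pi>;
  faster growth of the height on part of the slopes lowers the total.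

  The exponentials are natural because \<open>P\<close> differs from \<psi> by an affine function,
  so f(y)f(z) is a function of T(y,z) and Cauchy-Schwarz is nearly an equality.\<close>

definition vec2 :: "real \<Rightarrow> real \<Rightarrow> plane" where
  "vec2 x y = x *\<^sub>R axis 1 1 + y *\<^sub>R axis 2 1"

lemma vec2_nth [simp]: "vec2 x y $ 1 = x" "vec2 x y $ 2 = y"
  by (simp_all add: vec2_def axis_def)

lemma scaleR_vec2 [simp]: "r *\<^sub>R vec2 x y = vec2 (r * x) (r * y)"
  by (simp add: vec_eq_iff forall_2)

lemma norm_plane: "(norm (u :: plane))\<^sup>2 = (u $ 1)\<^sup>2 + (u $ 2)\<^sup>2"
  unfolding power2_norm_eq_inner by (simp add: inner_vec_def sum_2 power2_eq_square)

lemma inner_plane: "(u :: plane) \<bullet> v = u $ 1 * v $ 1 + u $ 2 * v $ 2"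
  by (simp add: inner_vec_def sum_2)

lemma norm_plane_le: "norm (u :: plane) \<le> \<bar>u $ 1\<bar> + \<bar>u $ 2\<bar>"
  using norm_le_l1_cart[of u] by (simp add: sum_2)

lemma vec2_measurable [measurable]: "(\<lambda>p. vec2 (fst p) (snd p)) \<in> borel_measurable borel"
  unfolding vec2_def by (intro borel_measurable_continuous_onI continuous_intros)

lemma vec2_measurable' [measurable]:
  assumes [measurable]: "f \<in> borel_measurable M" "g \<in> borel_measurable M"
  shows "(\<lambda>x. vec2 (f x) (g x)) \<in> borel_measurable M"
  unfolding vec2_def by measurable

lemma lborel_plane:
  "(lborel :: plane measure) = distr (lborel \<Otimes>\<^sub>M lborel) borel (\<lambda>(x, y). vec2 x y)"
proof (rule lborel_eqI)
  fix l u :: plane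
  assume le: "\<And>b. b \<in> Basis \<Longrightarrow> l \<bullet> b \<le> u \<bullet> b"
  have nth: "l $ i \<le> u $ i" for i
    using le[of "axis i 1"] by (simp add: inner_axis)
  have box: "(\<lambda>(x, y). vec2 x y) -` box l u \<inter> space (lborel \<Otimes>\<^sub>M lborel)
      = {l $ 1 <..< u $ 1} \<times> {l $ 2 <..< u $ 2}"
    by (auto simp: mem_box_cart forall_2 space_pair_measure)
  have "emeasure (distr (lborel \<Otimes>\<^sub>M lborel) borel (\<lambda>(x, y). vec2 x y)) (box l u)
      = emeasure lborel {l $ 1 <..< u $ 1} * emeasure lborel {l $ 2 <..< u $ 2}"
    by (subst emeasure_distr)
       (auto simp: box lborel.emeasure_pair_measure_Times)
  also have "\<dots> = ennreal (\<Prod>b\<in>Basis. (u - l) \<bullet> b)"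
    using nth by (simp add: Basis_vec_def UNION_singleton_eq_range prod.reindex inj_on_def
        axis_eq_axis UNIV_2 inner_axis ennreal_mult mult.commute)
  finally show "emeasure (distr (lborel \<Otimes>\<^sub>M lborel) borel (\<lambda>(x, y). vec2 x y)) (box l u)
      = ennreal (\<Prod>b\<in>Basis. (u - l) \<bullet> b)" .
qed simp

lemma nn_integral_plane:
  fixes F :: "plane \<Rightarrow> ennreal"
  assumes [measurable]: "F \<in> borel_measurable borel"
  shows "(\<integral>\<^sup>+ u. F u \<partial>lborel) = (\<integral>\<^sup>+ x. \<integral>\<^sup>+ y. F (vec2 x y) \<partial>lborel \<partial>lborel)"
  by (subst lborel_plane, subst nn_integral_distr)
     (auto simp: lborel.nn_integral_fst[symmetric] split_beta')

text \<open>A replacement for polar coordinates: \<open>y = x * m\<close> on each vertical line off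
  the null line \<open>x = 0\<close>. Since \<open>x\<close> takes both signs, two opposite rays
  form one line, which suits integrands even in \<open>u\<close>.\<close>

lemma nn_integral_slope:
  fixes F :: "plane \<Rightarrow> ennreal"
  assumes [measurable]: "F \<in> borel_measurable borel"
  shows "(\<integral>\<^sup>+ u. F u \<partial>lborel)
    = (\<integral>\<^sup>+ m. \<integral>\<^sup>+ x. ennreal \<bar>x\<bar> * F (x *\<^sub>R vec2 1 m) \<partial>lborel \<partial>lborel)"
proof -
  have "(\<integral>\<^sup>+ u. F u \<partial>lborel) = (\<integral>\<^sup>+ x. \<integral>\<^sup>+ y. F (vec2 x y) \<partial>lborel \<partial>lborel)"
    by (rule nn_integral_plane) measurable
  also have "\<dots> = (\<integral>\<^sup>+ x. \<integral>\<^sup>+ m. ennreal \<bar>x\<bar> * F (vec2 x (x * m)) \<partial>lborel \<partial>lborel)"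
  proof (rule nn_integral_cong_AE)
    have "AE x in lborel. x \<noteq> (0::real)"
      by (rule AE_lborel_singleton)
    then show "AE x in lborel. (\<integral>\<^sup>+ y. F (vec2 x y) \<partial>lborel)
        = (\<integral>\<^sup>+ m. ennreal \<bar>x\<bar> * F (vec2 x (x * m)) \<partial>lborel)"
    proof eventually_elim
      case (elim x)
      show ?case
        by (subst nn_integral_real_affine[of _ x 0])
           (use elim in \<open>auto simp: nn_integral_cmult\<close>)
    qed
  qed
  also have "\<dots> = (\<integral>\<^sup>+ m. \<integral>\<^sup>+ x. ennreal \<bar>x\<bar> * F (vec2 x (x * m)) \<partial>lborel \<partial>lborel)"
    by (rule lborel_pair.Fubini') measurable
  finally show ?thesis by simp
qed

text \<open>The substitution on compact intervals is exhausted along \<open>{0..n}\<close>;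
  divergence of \<open>k\<close> makes the images fill \<open>{k 0..}\<close>. The derivative is
  only nonnegative, so \<open>k\<close> may be constant on intervals.\<close>

lemma nn_integral_substitution_atLeast:
  fixes G :: "real \<Rightarrow> ennreal" and k k' :: "real \<Rightarrow> real"
  assumes [measurable]: "G \<in> borel_measurable borel"
    and der: "\<And>x. (k has_real_derivative k' x) (at x)"
    and cont: "continuous_on UNIV k'"
    and nonneg: "\<And>x. 0 \<le> x \<Longrightarrow> 0 \<le> k' x"
    and lim: "filterlim k at_top at_top"
  shows "(\<integral>\<^sup>+ x. G (k x) * ennreal (k' x) * indicator {0..} x \<partial>lborel)
    = (\<integral>\<^sup>+ t. G t * indicator {k 0..} t \<partial>lborel)"
proof -
  have [measurable]: "k' \<in> borel_measurable borel"
    by (rule borel_measurable_continuous_onI[OF cont])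
  have "continuous_on UNIV k"
    using der by (meson DERIV_isCont continuous_at_imp_continuous_on)
  then have [measurable]: "k \<in> borel_measurable borel"
    by (rule borel_measurable_continuous_onI)
  have mono: "k x \<le> k y" if "0 \<le> x" "x \<le> y" for x y
    by (rule DERIV_nonneg_imp_nondecreasing[OF that(2)]) (use der nonneg that in force)
  have ex: "\<exists>n::nat. t \<le> k (real n)" for t
  proof -
    have "filterlim (\<lambda>n. k (real n)) at_top sequentially"
      by (rule filterlim_compose[OF lim filterlim_real_sequentially])
    then show ?thesis
      by (auto simp: filterlim_at_top eventually_sequentially)
  qed
  have sup: "(\<integral>\<^sup>+ t. H t * indicator (\<Union>n. S n) t \<partial>lborel)
      = (SUP n. \<integral>\<^sup>+ t. H t * indicator (S n) t \<partial>lborel)"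
    if [measurable]: "H \<in> borel_measurable borel" "\<And>n. S n \<in> sets borel" and inc: "incseq S"
    for H :: "real \<Rightarrow> ennreal" and S :: "nat \<Rightarrow> real set"
  proof -
    have "(SUP n. H t * indicator (S n) t) = H t * indicator (\<Union>n. S n) t" for t
    proof (cases "t \<in> (\<Union>n. S n)")
      case True
      then obtain n where "t \<in> S n" by auto
      then have "H t * indicator (S n) t = H t" by simp
      with True show ?thesis
        by (intro antisym SUP_least SUP_upper2[of n]) (auto split: split_indicator)
    qed auto
    then show ?thesis
      using inc
      by (subst nn_integral_monotone_convergence_SUP[symmetric])
         (auto simp: incseq_def le_fun_def intro!: mult_left_mono split: split_indicator)
  qed
  have "(\<integral>\<^sup>+ x. G (k x) * ennreal (k' x) * indicator (\<Union>n. {0..real n}) x \<partial>lborel)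
      = (SUP n. \<integral>\<^sup>+ x. G (k x) * ennreal (k' x) * indicator {0..real n} x \<partial>lborel)"
    by (rule sup) (auto simp: incseq_def)
  also have "\<dots> = (SUP n. \<integral>\<^sup>+ t. G t * indicator {k 0..k (real n)} t \<partial>lborel)"
  proof (rule SUP_cong)
    fix n
    show "(\<integral>\<^sup>+ x. G (k x) * ennreal (k' x) * indicator {0..real n} x \<partial>lborel)
      = (\<integral>\<^sup>+ t. G t * indicator {k 0..k (real n)} t \<partial>lborel)"
    \<comment> \<open>The substitution rule asks for a nondegenerate interval; for
      \<open>n = 0\<close> both domains are single points, hence null.\<close>
    proof (cases "n = 0")
      case True
      have "AE x in lborel. G (k x) * ennreal (k' x) * indicator {0..real n} x = 0"
        using AE_lborel_singleton[of "0::real"]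
        by eventually_elim (simp add: True indicator_def)
      moreover have "AE t in lborel. G t * indicator {k 0..k (real n)} t = 0"
        using AE_lborel_singleton[of "k 0"]
        by eventually_elim (simp add: True indicator_def)
      ultimately show ?thesis
        by (simp only: nn_integral_cong_AE[of _ "\<lambda>_. 0"])
    next
      case False
      then show ?thesis
        by (subst nn_integral_substitution_aux[where g' = k'])
           (use der nonneg cont in \<open>auto intro: continuous_on_subset\<close>)
    qed
  qed simp
  also have "\<dots> = (\<integral>\<^sup>+ t. G t * indicator (\<Union>n. {k 0..k (real n)}) t \<partial>lborel)"
    by (rule sup[symmetric]) (auto simp: incseq_def intro: order_trans[OF _ mono])
  also have "(\<Union>n. {k 0..k (real n)}) = {k 0..}"
    using ex by auto
  also have "(\<Union>n. {0..real n}) = {0..}"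
    using real_arch_simple by auto
  finally show ?thesis .
qed

lemma nn_integral_even:
  fixes F :: "real \<Rightarrow> ennreal"
  assumes [measurable]: "F \<in> borel_measurable borel" and even: "\<And>x. F (- x) = F x"
  shows "(\<integral>\<^sup>+ x. F x \<partial>lborel) = 2 * (\<integral>\<^sup>+ x. F x * indicator {0..} x \<partial>lborel)"
proof -
  have "(\<integral>\<^sup>+ x. F x \<partial>lborel)
      = (\<integral>\<^sup>+ x. F x * indicator {0..} x + F x * indicator {..<0} x \<partial>lborel)"
    by (intro nn_integral_cong) (auto split: split_indicator)
  also have "\<dots> = (\<integral>\<^sup>+ x. F x * indicator {0..} x \<partial>lborel) + (\<integral>\<^sup>+ x. F x * indicator {..<0} x \<partial>lborel)"
    by (rule nn_integral_add) auto
  also have "(\<integral>\<^sup>+ x. F x * indicator {..<0} x \<partial>lborel) = (\<integral>\<^sup>+ x. F x * indicator {0<..} x \<partial>lborel)"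
    by (subst nn_integral_real_affine[of _ "-1" 0])
       (auto simp: even intro!: nn_integral_cong split: split_indicator)
  also have "\<dots> = (\<integral>\<^sup>+ x. F x * indicator {0..} x \<partial>lborel)"
  proof (rule nn_integral_cong_AE)
    have "AE x in lborel. x \<noteq> (0::real)"
      by (rule AE_lborel_singleton)
    then show "AE x in lborel. F x * indicator {0<..} x = F x * indicator {0..} x"
      by eventually_elim (auto split: split_indicator)
  qed
  finally show ?thesis by (simp add: mult_2)
qed

lemma nn_integral_inverse_1_plus_square:
  "(\<integral>\<^sup>+ m. ennreal (1 / (1 + m\<^sup>2)) \<partial>lborel) = ennreal pi"
proof -
  have "(\<integral>\<^sup>+ m. ennreal (1 / (1 + m\<^sup>2)) * indicator {0..} m \<partial>lborel) = ennreal (pi / 2 - arctan 0)"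
    by (rule nn_integral_FTC_atLeast)
       (auto intro!: derivative_eq_intros tendsto_arctan_at_top simp: field_simps add_nonneg_eq_0_iff)
  then show ?thesis
    by (subst nn_integral_even) (auto simp: ennreal_mult'[symmetric] simp flip: ennreal_numeral)
qed

text \<open>On the line of slope \<open>m\<close>, putting
  \<open>s = (1 + m\<^sup>2) x\<^sup>2\<close> turns \<open>|x| dx\<close> into
  \<open>ds / (2 (1 + m\<^sup>2))\<close>; the two signs of \<open>x\<close> cancel the 2, and the
  slopes integrate to \<pi>.\<close>

lemma nn_integral_radial:
  fixes F :: "real \<Rightarrow> ennreal"
  assumes [measurable]: "F \<in> borel_measurable borel"
  shows "(\<integral>\<^sup>+ u. F ((norm (u - a :: plane))\<^sup>2) \<partial>lborel)
    = ennreal pi * (\<integral>\<^sup>+ s. F s * indicator {0..} s \<partial>lborel)"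
proof -
  have "(\<integral>\<^sup>+ u. F ((norm (u - a :: plane))\<^sup>2) \<partial>lborel) = (\<integral>\<^sup>+ u. F ((norm (u :: plane))\<^sup>2) \<partial>lborel)"
    by (subst lborel_distr_plus[of a, symmetric], subst nn_integral_distr) auto
  also have "\<dots> = (\<integral>\<^sup>+ m. \<integral>\<^sup>+ x. ennreal \<bar>x\<bar> * F ((1 + m\<^sup>2) * x\<^sup>2) \<partial>lborel \<partial>lborel)"
    by (subst nn_integral_slope) (auto simp: norm_plane algebra_simps power_mult_distrib)
  also have "\<dots> = (\<integral>\<^sup>+ m. (\<integral>\<^sup>+ s. F s * indicator {0..} s \<partial>lborel) * ennreal (1 / (1 + m\<^sup>2)) \<partial>lborel)"
  proof (rule nn_integral_cong)
    fix m :: real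
    define c where "c = 1 + m\<^sup>2"
    have pos: "0 < c" by (simp add: c_def add_pos_nonneg)
    have lim: "filterlim (\<lambda>x::real. c * x\<^sup>2) at_top at_top"
      by (intro filterlim_tendsto_pos_mult_at_top[OF tendsto_const pos] filterlim_pow_at_top filterlim_ident) auto
    have weight: "ennreal \<bar>x\<bar> * A * indicator {0..} x
        = ennreal (1 / (2 * c)) * (A * ennreal (c * (2 * x)) * indicator {0..} x)" for x A
    proof (cases "0 \<le> x")
      case True
      then have "ennreal \<bar>x\<bar> = ennreal (1 / (2 * c)) * ennreal (c * (2 * x))"
        using pos by (subst ennreal_mult[symmetric]) auto
      then show ?thesis by (simp only: mult.assoc mult.left_commute mult.commute)
    qed simp
    have "(\<integral>\<^sup>+ x. ennreal \<bar>x\<bar> * F (c * x\<^sup>2) \<partial>lborel)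
        = 2 * (\<integral>\<^sup>+ x. ennreal \<bar>x\<bar> * F (c * x\<^sup>2) * indicator {0..} x \<partial>lborel)"
      by (rule nn_integral_even) auto
    also have "\<dots> = 2 * (ennreal (1 / (2 * c)) *
        (\<integral>\<^sup>+ x. F (c * x\<^sup>2) * ennreal (c * (2 * x)) * indicator {0..} x \<partial>lborel))"
      by (subst nn_integral_cmult[symmetric]) (simp_all only: weight, measurable)
    also have "(\<integral>\<^sup>+ x. F (c * x\<^sup>2) * ennreal (c * (2 * x)) * indicator {0..} x \<partial>lborel)
        = (\<integral>\<^sup>+ s. F s * indicator {c * 0\<^sup>2..} s \<partial>lborel)"
      by (rule nn_integral_substitution_atLeast[OF _ _ _ _ lim])
         (use pos in \<open>auto intro!: derivative_eq_intros continuous_intros\<close>)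
    also have "2 * (ennreal (1 / (2 * c)) * (\<integral>\<^sup>+ s. F s * indicator {c * 0\<^sup>2..} s \<partial>lborel))
        = ennreal (2 * (1 / (2 * c))) * (\<integral>\<^sup>+ s. F s * indicator {0..} s \<partial>lborel)"
      using pos by (subst ennreal_mult) (auto simp: mult.assoc)
    finally show "(\<integral>\<^sup>+ x. ennreal \<bar>x\<bar> * F ((1 + m\<^sup>2) * x\<^sup>2) \<partial>lborel)
        = (\<integral>\<^sup>+ s. F s * indicator {0..} s \<partial>lborel) * ennreal (1 / (1 + m\<^sup>2))"
      using pos by (simp add: mult.commute flip: c_def)
  qed
  also have "\<dots> = (\<integral>\<^sup>+ s. F s * indicator {0..} s \<partial>lborel) * ennreal pi"
    by (subst nn_integral_cmult) (auto simp: nn_integral_inverse_1_plus_square)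
  finally show ?thesis by (simp add: mult.commute)
qed

subsection \<open>Gradient and Hessian of the perturbation\<close>

definition grad :: "(plane \<Rightarrow> real) \<Rightarrow> plane \<Rightarrow> plane" where
  "grad g y = (\<chi> i. partial_derivative i g y)"

lemma has_derivative_partial:
  assumes "g differentiable (at y)"
  shows "(g has_derivative (\<lambda>v. \<Sum>i\<in>UNIV. partial_derivative i g y * v $ i)) (at y)"
proof -
  interpret bounded_linear "frechet_derivative g (at y)"
    using assms by (simp add: frechet_derivative_works has_derivative_bounded_linear)
  have "frechet_derivative g (at y) v = (\<Sum>i\<in>UNIV. partial_derivative i g y * v $ i)" for v
  proof -
    have "v = (\<Sum>i\<in>UNIV. v $ i *\<^sub>R axis i 1)"
      by (simp add: vec_eq_iff axis_def if_distrib sum.delta cong: if_cong)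
    then have "frechet_derivative g (at y) v
        = frechet_derivative g (at y) (\<Sum>i\<in>UNIV. v $ i *\<^sub>R axis i 1)"
      by simp
    also have "\<dots> = (\<Sum>i\<in>UNIV. partial_derivative i g y * v $ i)"
      by (simp add: sum scaleR partial_derivative_def mult.commute)
    finally show ?thesis .
  qed
  then have "frechet_derivative g (at y) = (\<lambda>v. \<Sum>i\<in>UNIV. partial_derivative i g y * v $ i)"
    by blast
  then show ?thesis
    using assms by (metis frechet_derivative_works)
qed

section \<open>The perturbed paraboloid: heights, convexity and the estimate on one fibre\<close>

locale convex_perturbation =
  fixes \<phi> :: "plane \<Rightarrow> real"
  assumes nonneg: "0 \<le> \<phi> y"
    and C2: "twice_continuously_differentiable \<phi>"
    and strict: "strictly_convex \<phi>"
begin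

definition \<psi> :: "plane \<Rightarrow> real" where
  "\<psi> y = (norm y)\<^sup>2 + \<phi> y"

text \<open>The height component of \<open>T\<close> at the pair with midpoint \<open>c\<close> and
  half difference \<open>u\<close>; for fixed \<open>c\<close> it is the only coordinate that varies
  on the fibre.\<close>

definition q :: "plane \<Rightarrow> plane \<Rightarrow> real" where
  "q c u = \<psi> (c + u) + \<psi> (c - u)"

text \<open>\<open>radial c u\<close> is \<open>x\<close> times the derivative at \<open>x = 1\<close> of \<open>q c (x u)\<close>.\<close>

definition radial :: "plane \<Rightarrow> plane \<Rightarrow> real" where
  "radial c u = 4 * (norm u)\<^sup>2 + (grad \<phi> (c + u) - grad \<phi> (c - u)) \<bullet> u"

lemma has_derivative_phi: "(\<phi> has_derivative (\<lambda>v. grad \<phi> y \<bullet> v)) (at y)"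
  using has_derivative_partial[of \<phi> y] C2
  by (simp add: twice_continuously_differentiable_def grad_def inner_vec_def)

lemma has_derivative_grad:
  "((\<lambda>y. grad \<phi> y $ j) has_derivative (\<lambda>v. \<Sum>i\<in>UNIV. hessian \<phi> y $ i $ j * v $ i)) (at y)"
  using has_derivative_partial[of "partial_derivative j \<phi>" y] C2
  by (simp add: twice_continuously_differentiable_def grad_def hessian_def)

lemma continuous_on_hessian: "continuous_on UNIV (\<lambda>y. hessian \<phi> y $ i $ j)"
  using C2 by (simp add: twice_continuously_differentiable_def hessian_def)

lemma continuous_on_phi [continuous_intros]:
  "continuous_on S f \<Longrightarrow> continuous_on S (\<lambda>x. \<phi> (f x))"
  by (rule continuous_on_compose2[OF has_derivative_continuous_on[OF
        has_derivative_at_withinI[OF has_derivative_phi]], of S f UNIV]) auto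

lemma continuous_on_grad [continuous_intros]:
  "continuous_on S f \<Longrightarrow> continuous_on S (\<lambda>x. grad \<phi> (f x))"
proof (rule continuous_on_compose2[of UNIV "grad \<phi>"])
  have "continuous_on UNIV (\<lambda>y. grad \<phi> y $ j)" for j
    by (rule has_derivative_continuous_on[OF has_derivative_at_withinI[OF has_derivative_grad]])
  then have "continuous_on UNIV (\<lambda>y. \<chi> j. grad \<phi> y $ j)"
    by (rule continuous_on_vec_lambda)
  then show "continuous_on UNIV (grad \<phi>)" by simp
qed auto

lemma continuous_on_psi [continuous_intros]:
  "continuous_on S f \<Longrightarrow> continuous_on S (\<lambda>x. \<psi> (f x))"
  unfolding \<psi>_def by (intro continuous_intros)

lemma continuous_on_q [continuous_intros]:
  "continuous_on S f \<Longrightarrow> continuous_on S g \<Longrightarrow> continuous_on S (\<lambda>x. q (f x) (g x))"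
  unfolding q_def by (intro continuous_intros)

lemma phi_measurable [measurable]: "\<phi> \<in> borel_measurable borel"
  by (intro borel_measurable_continuous_onI continuous_intros)

lemma psi_measurable [measurable]: "\<psi> \<in> borel_measurable borel"
  by (intro borel_measurable_continuous_onI continuous_intros)

lemma q_measurable [measurable]:
  assumes [measurable]: "f \<in> borel_measurable M" "g \<in> borel_measurable M"
  shows "(\<lambda>x. q (f x) (g x)) \<in> borel_measurable M"
  unfolding q_def by measurable

lemma strict_convexity:
  "x \<noteq> y \<Longrightarrow> 0 < t \<Longrightarrow> t < 1 \<Longrightarrow>
    \<phi> ((1 - t) *\<^sub>R x + t *\<^sub>R y) < (1 - t) * \<phi> x + t * \<phi> y"
  using strict unfolding strictly_convex_def by blast

text \<open>Along the line from \<open>y\<close> to \<open>z\<close> this is the tangent inequality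
  for a convex function of one variable; the case \<open>a = b\<close> is separated because strict
  convexity only speaks of distinct points.\<close>

lemma gradient_inequality: "\<phi> y + grad \<phi> y \<bullet> (z - y) \<le> \<phi> z"
proof (cases "z = y")
  case False
  define g where "g t = \<phi> (y + t *\<^sub>R (z - y))" for t :: real
  have "convex_on UNIV g"
  proof (rule convex_onI)
    fix s a b :: real
    assume s: "0 < s" "s < 1"
    have split: "y + ((1 - s) * a + s * b) *\<^sub>R (z - y)
        = (1 - s) *\<^sub>R (y + a *\<^sub>R (z - y)) + s *\<^sub>R (y + b *\<^sub>R (z - y))"
      by (simp add: algebra_simps)
    show "g ((1 - s) *\<^sub>R a + s *\<^sub>R b) \<le> (1 - s) * g a + s * g b"
    proof (cases "a = b")
      case True
      then show ?thesis by (simp add: algebra_simps)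
    next
      case ab: False
      with False have "y + a *\<^sub>R (z - y) \<noteq> y + b *\<^sub>R (z - y)" by simp
      then show ?thesis
        unfolding g_def real_scaleR_def split using strict_convexity s less_imp_le by blast
    qed
  qed simp
  moreover have "(g has_field_derivative grad \<phi> y \<bullet> (z - y)) (at 0 within UNIV)"
  proof -
    have "(g has_derivative (\<lambda>t. grad \<phi> (y + 0 *\<^sub>R (z - y)) \<bullet> (t *\<^sub>R (z - y)))) (at 0)"
      unfolding g_def
      by (rule has_derivative_compose[where g = \<phi>]) (auto intro!: derivative_eq_intros has_derivative_phi)
    then show ?thesis
      by (simp add: has_field_derivative_def mult.commute[of _ "grad \<phi> y \<bullet> (z - y)"])
  qed
  ultimately have "g 1 \<ge> g 0 + (grad \<phi> y \<bullet> (z - y)) * (1 - 0)"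
    using convex_on_imp_above_tangent[of UNIV g 0 1 "grad \<phi> y \<bullet> (z - y)"] by simp
  then show ?thesis by (simp add: g_def)
qed simp

lemma grad_mono: "0 \<le> (grad \<phi> y - grad \<phi> z) \<bullet> (y - z)"
  using gradient_inequality[of y z] gradient_inequality[of z y]
  by (simp add: inner_diff_left inner_diff_right)

lemma second_difference_pos:
  assumes "u \<noteq> 0"
  shows "0 < \<phi> (c + u) + \<phi> (c - u) - 2 * \<phi> c"
proof -
  have "c + u \<noteq> c - u"
    using assms by (auto simp: vec_eq_iff)
  then have "\<phi> ((1 - 1 / 2) *\<^sub>R (c + u) + (1 / 2) *\<^sub>R (c - u))
      < (1 - 1 / 2) * \<phi> (c + u) + 1 / 2 * \<phi> (c - u)"
    by (rule strict_convexity) auto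
  moreover have "(1 - 1 / 2) *\<^sub>R (c + u) + (1 / 2) *\<^sub>R (c - u) = c"
    by (simp add: vec_eq_iff field_simps)
  ultimately show ?thesis by simp
qed

lemma second_difference_nonneg: "0 \<le> \<phi> (c + u) + \<phi> (c - u) - 2 * \<phi> c"
  using second_difference_pos[of u c] by (cases "u = 0") auto

text \<open>The gradient inequality at both ends towards \<open>c\<close> turns a gain in values,
  which compactness provides, into a gain in the radial derivative, which the fibre estimate
  consumes.\<close>

lemma second_difference_le_grad:
  "\<phi> (c + u) + \<phi> (c - u) - 2 * \<phi> c \<le> (grad \<phi> (c + u) - grad \<phi> (c - u)) \<bullet> u"
  using gradient_inequality[of "c + u" c] gradient_inequality[of "c - u" c]
  by (simp add: inner_diff_left)

lemma radial_ge: "4 * (norm u)\<^sup>2 + (\<phi> (c + u) + \<phi> (c - u) - 2 * \<phi> c) \<le> radial c u"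
  using second_difference_le_grad[of c u] by (simp add: radial_def)

lemma radial_ge_norm: "4 * (norm u)\<^sup>2 \<le> radial c u"
  using radial_ge[of u c] second_difference_nonneg[of c u] by simp

text \<open>The parallelogram law for the quadratic part; the second difference of \<phi> measures
  the excess over paraboloid growth.\<close>

lemma q_eq: "q c u = 2 * \<psi> c + 2 * (norm u)\<^sup>2 + (\<phi> (c + u) + \<phi> (c - u) - 2 * \<phi> c)"
  unfolding q_def \<psi>_def norm_plane by (simp add: power2_eq_square algebra_simps)

lemma q_ge: "2 * \<psi> c + 2 * (norm u)\<^sup>2 \<le> q c u"
  using q_eq[of c u] second_difference_nonneg[of c u] by simp

lemma norm_le_psi: "(norm y)\<^sup>2 \<le> \<psi> y"
  by (simp add: \<psi>_def nonneg)

lemma psi_nonneg: "0 \<le> \<psi> y"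
  by (simp add: \<psi>_def nonneg)

text \<open>On the line of slope \<open>m\<close> the height \<open>k\<close> is even and
  nondecreasing for \<open>x \<ge> 0\<close>, with \<open>x * k' x\<close> equal to
  \<open>radial\<close>. The hypothesis \<open>gain\<close> therefore reads
  \<open>|x| dx \<le> b m / (2 (1 + m\<^sup>2)) |dk|\<close>, and each line pushes forward to a
  measure of density at most \<open>b m / (1 + m\<^sup>2)\<close>, both rays together. Comparison
  with the paraboloid is \<open>b m = 1/2\<close>; letting \<open>b\<close> depend on the slope
  keeps gains that occur only in some directions.\<close>

lemma fiber_bound:
  fixes G :: "real \<Rightarrow> ennreal" and b :: "real \<Rightarrow> real"
  assumes [measurable]: "G \<in> borel_measurable borel" "V \<in> sets borel" "b \<in> borel_measurable borel"
    and b: "\<And>m. 0 \<le> b m"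
    and gain: "\<And>m x. x *\<^sub>R vec2 1 m \<in> V \<Longrightarrow>
      2 * (norm (x *\<^sub>R vec2 1 m))\<^sup>2 \<le> b m * radial c (x *\<^sub>R vec2 1 m)"
  shows "(\<integral>\<^sup>+ u. G (q c u) * indicator V u \<partial>lborel)
    \<le> (\<integral>\<^sup>+ m. ennreal (b m / (1 + m\<^sup>2)) \<partial>lborel) * (\<integral>\<^sup>+ t. G t \<partial>lborel)"
proof -
  have inner_bound: "(\<integral>\<^sup>+ x. ennreal \<bar>x\<bar> * (G (q c (x *\<^sub>R vec2 1 m)) * indicator V (x *\<^sub>R vec2 1 m)) \<partial>lborel)
      \<le> ennreal (b m / (1 + m\<^sup>2)) * (\<integral>\<^sup>+ t. G t \<partial>lborel)" for m
  proof -
    define e where "e = vec2 1 m"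
    define k where "k x = q c (x *\<^sub>R e)" for x
    define k' where "k' x = 4 * x * (norm e)\<^sup>2 + (grad \<phi> (c + x *\<^sub>R e) - grad \<phi> (c - x *\<^sub>R e)) \<bullet> e" for x
    have e: "(norm e)\<^sup>2 = 1 + m\<^sup>2" by (simp add: e_def norm_plane)
    then have e_pos: "0 < (norm e)\<^sup>2" by (simp add: add_pos_nonneg)
    have norm_xe: "(norm (x *\<^sub>R e))\<^sup>2 = x\<^sup>2 * (1 + m\<^sup>2)" for x
      by (simp add: power_mult_distrib e)
    have xk': "x * k' x = radial c (x *\<^sub>R e)" for x
      unfolding k'_def radial_def norm_scaleR power_mult_distrib power2_abs inner_scaleR_right
      by (simp add: distrib_left power2_eq_square)
    have cont: "continuous_on UNIV k'"
      unfolding k'_def by (intro continuous_intros)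
    then have [measurable]: "k' \<in> borel_measurable borel"
      by (rule borel_measurable_continuous_onI)
    have [measurable]: "k \<in> borel_measurable borel"
      unfolding k_def by measurable
    have der: "(k has_real_derivative k' x) (at x)" for x
    proof -
      have line: "((\<lambda>x. c + (s * x) *\<^sub>R e) has_derivative (\<lambda>t. (s * t) *\<^sub>R e)) (at x)" for s :: real
        by (auto intro!: derivative_eq_intros)
      have "((\<lambda>x. (2 * (norm e)\<^sup>2) * x\<^sup>2) has_derivative (\<lambda>t. 4 * x * (norm e)\<^sup>2 * t)) (at x)"
        by (auto intro!: derivative_eq_intros)
      from has_derivative_add[OF has_derivative_const[of "2 * (norm c)\<^sup>2"]
          has_derivative_add[OF has_derivative_add[OF this
          has_derivative_compose[OF line[of 1] has_derivative_phi]]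
          has_derivative_compose[OF line[of "- 1"] has_derivative_phi]]]
      have "((\<lambda>x. 2 * (norm c)\<^sup>2 + ((2 * (norm e)\<^sup>2) * x\<^sup>2 + \<phi> (c + (1 * x) *\<^sub>R e)
          + \<phi> (c + ((- 1) * x) *\<^sub>R e))) has_derivative (\<lambda>t. k' x * t)) (at x)"
        by (rule has_derivative_eq_rhs) (auto simp: k'_def inner_diff_left algebra_simps)
      also have "(\<lambda>x. 2 * (norm c)\<^sup>2 + ((2 * (norm e)\<^sup>2) * x\<^sup>2 + \<phi> (c + (1 * x) *\<^sub>R e)
          + \<phi> (c + ((- 1) * x) *\<^sub>R e))) = k"
        by (auto simp: k_def q_eq \<psi>_def power_mult_distrib)
      finally show ?thesis
        by (simp add: has_field_derivative_def)
    qed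
    have k'_nonneg: "0 \<le> k' x" if "0 \<le> x" for x
    proof (cases "x = 0")
      case False
      have "0 \<le> radial c (x *\<^sub>R e)"
        by (rule order_trans[OF _ radial_ge_norm]) simp
      with False that show ?thesis
        by (simp add: xk'[symmetric] zero_le_mult_iff)
    qed (simp add: k'_def)
    have lim: "filterlim k at_top at_top"
    proof (rule filterlim_at_top_mono)
      show "filterlim (\<lambda>x. (norm e)\<^sup>2 * x\<^sup>2) at_top at_top"
        by (intro filterlim_tendsto_pos_mult_at_top[OF tendsto_const e_pos] filterlim_pow_at_top
            filterlim_ident) auto
      have "(norm e)\<^sup>2 * x\<^sup>2 \<le> k x" for x
      proof -
        have "0 \<le> x\<^sup>2 * (1 + m\<^sup>2)" by simp
        then show ?thesis
          using q_ge[of c "x *\<^sub>R e"] psi_nonneg[of c] unfolding norm_xe k_def e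
          by (simp only: mult.commute[of "1 + m\<^sup>2"])
      qed
      then show "\<forall>\<^sub>F x in at_top. (norm e)\<^sup>2 * x\<^sup>2 \<le> k x" by simp
    qed
    \<comment> \<open>This is \<open>gain\<close> after cancelling one factor \<open>|x|\<close>; at
      \<open>x = 0\<close> the left side vanishes.\<close>
    have "ennreal \<bar>x\<bar> * (G (k x) * indicator V (x *\<^sub>R e))
        \<le> ennreal (b m / (2 * (1 + m\<^sup>2))) * (G (k x) * ennreal \<bar>k' x\<bar>)" for x
    proof (cases "x *\<^sub>R e \<in> V")
      case True
      have "2 * \<bar>x\<bar> * \<bar>x\<bar> * (1 + m\<^sup>2) \<le> b m * (x * k' x)"
        using gain[of x m, folded e_def, OF True]
        unfolding norm_xe xk' by (simp only: power2_eq_square abs_mult_self_eq mult.assoc)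
      also have "\<dots> \<le> b m * (\<bar>x\<bar> * \<bar>k' x\<bar>)"
        using b by (metis abs_ge_self abs_mult mult_left_mono)
      finally have "\<bar>x\<bar> * (2 * \<bar>x\<bar> * (1 + m\<^sup>2)) \<le> \<bar>x\<bar> * (b m * \<bar>k' x\<bar>)"
        by (simp only: ac_simps)
      then have "2 * \<bar>x\<bar> * (1 + m\<^sup>2) \<le> b m * \<bar>k' x\<bar>"
        using b by (cases "x = 0") (auto dest: mult_left_le_imp_le)
      then have "\<bar>x\<bar> * (2 * (1 + m\<^sup>2)) \<le> b m * \<bar>k' x\<bar>"
        by (simp only: ac_simps)
      then have "\<bar>x\<bar> \<le> b m / (2 * (1 + m\<^sup>2)) * \<bar>k' x\<bar>"
        using e_pos unfolding e times_divide_eq_left by (subst pos_le_divide_eq) auto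
      then have "ennreal \<bar>x\<bar> \<le> ennreal (b m / (2 * (1 + m\<^sup>2))) * ennreal \<bar>k' x\<bar>"
        using b by (subst ennreal_mult[symmetric]) (auto intro: ennreal_leI)
      then have "ennreal \<bar>x\<bar> * G (k x) \<le> ennreal (b m / (2 * (1 + m\<^sup>2))) * ennreal \<bar>k' x\<bar> * G (k x)"
        by (rule mult_right_mono) simp
      then show ?thesis using True by (simp only: indicator_simps mult_1_right mult_1_left ac_simps)
    qed simp
    then have "(\<integral>\<^sup>+ x. ennreal \<bar>x\<bar> * (G (k x) * indicator V (x *\<^sub>R e)) \<partial>lborel)
        \<le> (\<integral>\<^sup>+ x. ennreal (b m / (2 * (1 + m\<^sup>2))) * (G (k x) * ennreal \<bar>k' x\<bar>) \<partial>lborel)"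
      by (rule nn_integral_mono)
    also have "\<dots> = ennreal (b m / (2 * (1 + m\<^sup>2))) * (\<integral>\<^sup>+ x. G (k x) * ennreal \<bar>k' x\<bar> \<partial>lborel)"
      by (rule nn_integral_cmult) measurable
    also have "(\<integral>\<^sup>+ x. G (k x) * ennreal \<bar>k' x\<bar> \<partial>lborel)
        = 2 * (\<integral>\<^sup>+ x. G (k x) * ennreal \<bar>k' x\<bar> * indicator {0..} x \<partial>lborel)"
    proof (rule nn_integral_even)
      have "k (- x) = k x" "k' (- x) = - k' x" for x
        by (simp_all add: k_def q_def k'_def inner_diff_left)
      then show "G (k (- x)) * ennreal \<bar>k' (- x)\<bar> = G (k x) * ennreal \<bar>k' x\<bar>" for x
        by simp
    qed measurable
    also have "(\<integral>\<^sup>+ x. G (k x) * ennreal \<bar>k' x\<bar> * indicator {0..} x \<partial>lborel)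
        = (\<integral>\<^sup>+ x. G (k x) * ennreal (k' x) * indicator {0..} x \<partial>lborel)"
      using k'_nonneg by (intro nn_integral_cong) (auto split: split_indicator)
    also have "\<dots> = (\<integral>\<^sup>+ t. G t * indicator {k 0..} t \<partial>lborel)"
      by (rule nn_integral_substitution_atLeast[OF _ der cont k'_nonneg lim]) auto
    also have "ennreal (b m / (2 * (1 + m\<^sup>2))) * (2 * (\<integral>\<^sup>+ t. G t * indicator {k 0..} t \<partial>lborel))
        = ennreal (b m / (1 + m\<^sup>2)) * (\<integral>\<^sup>+ t. G t * indicator {k 0..} t \<partial>lborel)"
    proof -
      have "ennreal (b m / (1 + m\<^sup>2)) = ennreal (b m / (2 * (1 + m\<^sup>2))) * 2"
        using b e_pos unfolding e
        by (subst ennreal_numeral[symmetric], subst ennreal_mult[symmetric])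
           (auto intro!: arg_cong[where f = ennreal] simp: divide_simps)
      then show ?thesis by (simp add: mult.assoc)
    qed
    also have "\<dots> \<le> ennreal (b m / (1 + m\<^sup>2)) * (\<integral>\<^sup>+ t. G t \<partial>lborel)"
      by (intro mult_left_mono nn_integral_mono) (auto split: split_indicator)
    finally show ?thesis by (simp only: k_def e_def)
  qed
  have "(\<integral>\<^sup>+ u. G (q c u) * indicator V u \<partial>lborel)
      = (\<integral>\<^sup>+ m. \<integral>\<^sup>+ x. ennreal \<bar>x\<bar> * (G (q c (x *\<^sub>R vec2 1 m)) * indicator V (x *\<^sub>R vec2 1 m)) \<partial>lborel \<partial>lborel)"
    by (rule nn_integral_slope) measurable
  also have "\<dots> \<le> (\<integral>\<^sup>+ m. ennreal (b m / (1 + m\<^sup>2)) * (\<integral>\<^sup>+ t. G t \<partial>lborel) \<partial>lborel)"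
    by (intro nn_integral_mono inner_bound)
  also have "\<dots> = (\<integral>\<^sup>+ m. ennreal (b m / (1 + m\<^sup>2)) \<partial>lborel) * (\<integral>\<^sup>+ t. G t \<partial>lborel)"
    by (rule nn_integral_multc) measurable
  finally show ?thesis .
qed


section \<open>Second-order behaviour of the perturbation\<close>

lemma grad_approx:
  assumes "0 < \<epsilon>"
  shows "\<exists>\<rho>>0. \<forall>v j. norm v < \<rho> \<longrightarrow>
    \<bar>grad \<phi> (y + v) $ j - grad \<phi> y $ j - (\<Sum>i\<in>UNIV. hessian \<phi> y $ i $ j * v $ i)\<bar> \<le> \<epsilon> * norm v"
proof -
  have ex: "\<exists>d>0. \<forall>z. norm (z - y) < d \<longrightarrow> norm (grad \<phi> z $ j - grad \<phi> y $ j
      - (\<Sum>i\<in>UNIV. hessian \<phi> y $ i $ j * (z - y) $ i)) \<le> \<epsilon> * norm (z - y)" for j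
    using has_derivative_grad[of j y] assms unfolding has_derivative_at_alt by blast
  obtain d1 d2 where d: "0 < d1" "0 < d2"
    and d1: "\<And>z. norm (z - y) < d1 \<Longrightarrow> norm (grad \<phi> z $ 1 - grad \<phi> y $ 1
      - (\<Sum>i\<in>UNIV. hessian \<phi> y $ i $ 1 * (z - y) $ i)) \<le> \<epsilon> * norm (z - y)"
    and d2: "\<And>z. norm (z - y) < d2 \<Longrightarrow> norm (grad \<phi> z $ 2 - grad \<phi> y $ 2
      - (\<Sum>i\<in>UNIV. hessian \<phi> y $ i $ 2 * (z - y) $ i)) \<le> \<epsilon> * norm (z - y)"
    using ex[of 1] ex[of 2] by blast
  show ?thesis
  proof (intro exI[of _ "min d1 d2"] conjI allI impI)
    fix v :: plane and j :: 2
    assume "norm v < min d1 d2"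
    then show "\<bar>grad \<phi> (y + v) $ j - grad \<phi> y $ j - (\<Sum>i\<in>UNIV. hessian \<phi> y $ i $ j * v $ i)\<bar>
        \<le> \<epsilon> * norm v"
      using d1[of "y + v"] d2[of "y + v"] exhaust_2[of j] by auto
  qed (use d in auto)
qed

text \<open>By the gradient inequality at \<open>y\<close>, the distance to the tangent plane is at
  most the gradient increment paired with the displacement. Each component of the increment is at
  most \<open>3 * \<eta> * norm v\<close>, from two Hessian entries and the linearization error; the
  two components give the 6.\<close>

lemma flat_tangent:
  assumes "0 < \<eta>" and small: "\<And>i j. \<bar>hessian \<phi> y0 $ i $ j\<bar> \<le> \<eta>"
  shows "\<exists>\<rho>>0. \<forall>y. norm (y - y0) < \<rho> \<longrightarrow>
    \<phi> y - \<phi> y0 - grad \<phi> y0 \<bullet> (y - y0) \<le> 6 * \<eta> * (norm (y - y0))\<^sup>2"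
proof -
  obtain \<rho> where "0 < \<rho>" and \<rho>: "\<And>v j. norm v < \<rho> \<Longrightarrow>
    \<bar>grad \<phi> (y0 + v) $ j - grad \<phi> y0 $ j - (\<Sum>i\<in>UNIV. hessian \<phi> y0 $ i $ j * v $ i)\<bar> \<le> \<eta> * norm v"
    using grad_approx[OF assms(1), of y0] by blast
  show ?thesis
  proof (intro exI[of _ \<rho>] conjI allI impI \<open>0 < \<rho>\<close>)
    fix y assume y: "norm (y - y0) < \<rho>"
    define v where "v = y - y0"
    have comp: "\<bar>v $ i\<bar> \<le> norm v" for i by (rule component_le_norm_cart)
    have grad_comp: "\<bar>(grad \<phi> y - grad \<phi> y0) $ j\<bar> \<le> 3 * \<eta> * norm v" for j
    proof -
      have "\<bar>hessian \<phi> y0 $ i $ j * v $ i\<bar> \<le> \<eta> * norm v" for i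
        unfolding abs_mult using small comp assms(1) by (intro mult_mono) auto
      from this[of 1] this[of 2]
      have "\<bar>\<Sum>i\<in>UNIV. hessian \<phi> y0 $ i $ j * v $ i\<bar> \<le> 2 * (\<eta> * norm v)"
        unfolding sum_2 by linarith
      moreover have "\<bar>grad \<phi> y $ j - grad \<phi> y0 $ j - (\<Sum>i\<in>UNIV. hessian \<phi> y0 $ i $ j * v $ i)\<bar>
          \<le> \<eta> * norm v"
        using \<rho>[of v j] y by (simp add: v_def)
      ultimately show ?thesis by simp
    qed
    have "(grad \<phi> y - grad \<phi> y0) $ j * v $ j \<le> 3 * \<eta> * norm v * norm v" for j
    proof -
      have "\<bar>(grad \<phi> y - grad \<phi> y0) $ j * v $ j\<bar> \<le> 3 * \<eta> * norm v * norm v"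
        unfolding abs_mult using grad_comp comp assms(1) by (intro mult_mono) auto
      then show ?thesis by linarith
    qed
    from this[of 1] this[of 2] have "(grad \<phi> y - grad \<phi> y0) \<bullet> v \<le> 6 * \<eta> * (norm v)\<^sup>2"
      by (simp add: inner_plane power2_eq_square)
    then show "\<phi> y - \<phi> y0 - grad \<phi> y0 \<bullet> (y - y0) \<le> 6 * \<eta> * (norm (y - y0))\<^sup>2"
      using gradient_inequality[of y y0] by (simp add: v_def inner_diff_left inner_diff_right)
  qed
qed

text \<open>Cyclic monotonicity of the gradient along the triangle \<open>y\<close>, \<open>y + t e\<^sub>i\<close>, \<open>y + t e\<^sub>j\<close>.\<close>

lemma hessian_le_diagonal: "hessian \<phi> y $ i $ j \<le> hessian \<phi> y $ i $ i + hessian \<phi> y $ j $ j"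
proof (rule ccontr)
  let ?H = "hessian \<phi> y"
  assume "\<not> ?thesis"
  then have pos: "0 < ?H $ i $ j - ?H $ i $ i - ?H $ j $ j" by simp
  \<comment> \<open>A quarter of the supposed defect: three linearization errors of size
    \<open>\<epsilon> * t\<close> enter below, and they cannot make up
    \<open>4 * \<epsilon> * t\<close>.\<close>
  define \<epsilon> where "\<epsilon> = (?H $ i $ j - ?H $ i $ i - ?H $ j $ j) / 4"
  have "0 < \<epsilon>" using pos by (simp add: \<epsilon>_def)
  then obtain \<rho> where "0 < \<rho>" and \<rho>: "\<And>v k. norm v < \<rho> \<Longrightarrow>
    \<bar>grad \<phi> (y + v) $ k - grad \<phi> y $ k - (\<Sum>i\<in>UNIV. ?H $ i $ k * v $ i)\<bar> \<le> \<epsilon> * norm v"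
    using grad_approx[of \<epsilon> y] by blast
  define t where "t = \<rho> / 2"
  have t: "0 < t" "t < \<rho>" using \<open>0 < \<rho>\<close> by (auto simp: t_def)
  define a where "a l = y + t *\<^sub>R axis l (1::real)" for l :: 2
  have err: "\<bar>grad \<phi> (a l) $ k - grad \<phi> y $ k - t * ?H $ l $ k\<bar> \<le> \<epsilon> * t" for l k
  proof -
    have "(\<Sum>i\<in>UNIV. ?H $ i $ k * (t *\<^sub>R axis l (1::real)) $ i) = t * ?H $ l $ k"
      by (simp add: axis_def if_distrib sum.delta cong: if_cong)
    then show ?thesis
      using \<rho>[of "t *\<^sub>R axis l 1" k] t by (simp add: a_def)
  qed
  have ax: "v \<bullet> axis l 1 = v $ l" for v :: plane and l
    by (simp add: inner_axis)
  \<comment> \<open>The gradient inequalities along the three edges are added; the values of \<phi>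
    cancel and only gradient components remain.\<close>
  have "t * (grad \<phi> y $ i) + t * (grad \<phi> (a i) $ j - grad \<phi> (a i) $ i) - t * (grad \<phi> (a j) $ j) \<le> 0"
    using gradient_inequality[of y "a i"] gradient_inequality[of "a i" "a j"] gradient_inequality[of "a j" y]
    by (simp add: a_def inner_diff_right ax algebra_simps)
  then have "t * (grad \<phi> y $ i + grad \<phi> (a i) $ j - grad \<phi> (a i) $ i - grad \<phi> (a j) $ j) \<le> 0"
    by (simp add: algebra_simps)
  then have "grad \<phi> y $ i + grad \<phi> (a i) $ j - grad \<phi> (a i) $ i - grad \<phi> (a j) $ j \<le> 0"
    using t by (simp add: mult_le_0_iff)
  then have "t * ?H $ i $ j - t * ?H $ i $ i - t * ?H $ j $ j \<le> 3 * (\<epsilon> * t)"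
    using err[of i j] err[of i i] err[of j j] by linarith
  then have "t * (?H $ i $ j - ?H $ i $ i - ?H $ j $ j) \<le> t * (3 * \<epsilon>)"
    by (simp add: algebra_simps)
  then have "4 * \<epsilon> \<le> 3 * \<epsilon>"
    using t unfolding \<epsilon>_def by (simp add: mult_le_cancel_left)
  with \<open>0 < \<epsilon>\<close> show False by simp
qed

text \<open>The Hessian quadratic form in the direction \<open>vec2 1 m\<close>, with the two mixed
  entries kept as separate iterated derivatives.\<close>

definition slope_form :: "plane \<Rightarrow> real \<Rightarrow> real" where
  "slope_form y m = hessian \<phi> y $ 1 $ 1 + m * (hessian \<phi> y $ 1 $ 2 + hessian \<phi> y $ 2 $ 1)
    + m\<^sup>2 * hessian \<phi> y $ 2 $ 2"

lemma slope_derivative: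
  "((\<lambda>t. grad \<phi> (c + t *\<^sub>R vec2 x (m * x)) \<bullet> vec2 x (m * x)) has_real_derivative
    x\<^sup>2 * slope_form (c + t *\<^sub>R vec2 x (m * x)) m) (at t)"
proof -
  let ?e = "vec2 x (m * x)"
  have line: "((\<lambda>t. c + t *\<^sub>R ?e) has_derivative (\<lambda>s. s *\<^sub>R ?e)) (at t)"
    unfolding scaleR_vec2[symmetric] by (rule derivative_eq_intros refl)+ simp
  note D = has_derivative_compose[OF line has_derivative_grad]
  have "((\<lambda>t. grad \<phi> (c + t *\<^sub>R ?e) $ 1 * x + grad \<phi> (c + t *\<^sub>R ?e) $ 2 * (m * x)) has_derivative
    (\<lambda>s. (x\<^sup>2 * slope_form (c + t *\<^sub>R ?e) m) * s)) (at t)"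
    by (rule has_derivative_eq_rhs[OF has_derivative_add[OF has_derivative_mult_left[OF D]
          has_derivative_mult_left[OF D]]])
       (auto simp: sum_2 slope_form_def algebra_simps power2_eq_square)
  then show ?thesis
    by (simp add: has_field_derivative_def inner_plane)
qed

text \<open>Monotonicity of the gradient makes the directional derivative nondecreasing along a
  line, and the form is its derivative at 0.\<close>

lemma slope_form_nonneg: "0 \<le> slope_form y m"
proof -
  have "mono_on UNIV (\<lambda>t. grad \<phi> (y + t *\<^sub>R vec2 1 (m * 1)) \<bullet> vec2 1 (m * 1))"
  proof (rule mono_onI)
    fix s t :: real
    assume "s \<le> t"
    let ?e = "vec2 1 (m * 1)"
    have "0 \<le> (t - s) * ((grad \<phi> (y + t *\<^sub>R ?e) - grad \<phi> (y + s *\<^sub>R ?e)) \<bullet> ?e)"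
      using grad_mono[of "y + t *\<^sub>R ?e" "y + s *\<^sub>R ?e"]
      unfolding add_diff_add diff_self add_0 scaleR_left_diff_distrib[symmetric] inner_scaleR_right .
    then show "grad \<phi> (y + s *\<^sub>R ?e) \<bullet> ?e \<le> grad \<phi> (y + t *\<^sub>R ?e) \<bullet> ?e"
      using \<open>s \<le> t\<close> by (cases "s = t") (auto simp: zero_le_mult_iff inner_diff_left)
  qed
  then have "0 \<le> 1\<^sup>2 * slope_form (y + 0 *\<^sub>R vec2 1 (m * 1)) m"
    by (rule mono_on_imp_deriv_nonneg[OF _ slope_derivative]) simp
  then show ?thesis by (simp del: scaleR_vec2)
qed

text \<open>A form vanishing for all slopes is the zero polynomial in \<open>m\<close>, which kills
  the diagonal and the sum of the mixed entries. The bound \<open>hessian_le_diagonal\<close> then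
  makes each mixed entry nonpositive, hence zero.\<close>

lemma slope_form_pos:
  assumes "hessian \<phi> y \<noteq> 0"
  shows "\<exists>m. 0 < slope_form y m"
proof (rule ccontr)
  assume "\<not> ?thesis"
  then have z: "slope_form y m = 0" for m
    using slope_form_nonneg[of y m] by (meson antisym not_le)
  have "hessian \<phi> y $ 1 $ 1 = 0"
    using z[of 0] by (simp add: slope_form_def)
  moreover have "hessian \<phi> y $ 2 $ 2 = 0" "hessian \<phi> y $ 1 $ 2 + hessian \<phi> y $ 2 $ 1 = 0"
    using z[of 1] z[of "- 1"] calculation by (simp_all add: slope_form_def)
  ultimately have "hessian \<phi> y = 0"
    using hessian_le_diagonal[of y 1 2] hessian_le_diagonal[of y 2 1]
    by (simp add: vec_eq_iff forall_2)
  with assms show False by simp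
qed

text \<open>The form is positive at some slope \<open>m0\<close> and jointly continuous in point and
  slope, so it stays above half its value nearby; the mean value theorem on the segment between the
  two arguments of the gradient converts this into growth.\<close>

lemma curved_gain:
  assumes "hessian \<phi> y0 \<noteq> 0"
  obtains m0 d \<eta> \<rho> where "0 < d" "0 < \<eta>" "0 < \<rho>"
    "\<And>c x m. norm (c - y0) < \<rho> \<Longrightarrow> norm (vec2 x (m * x)) < \<rho> \<Longrightarrow> \<bar>m - m0\<bar> < d \<Longrightarrow>
      \<eta> * x\<^sup>2 \<le> (grad \<phi> (c + vec2 x (m * x)) - grad \<phi> (c - vec2 x (m * x))) \<bullet> vec2 x (m * x)"
proof -
  obtain m0 where pos: "0 < slope_form y0 m0"
    using slope_form_pos[OF assms] by blast
  define \<eta> where "\<eta> = slope_form y0 m0 / 2"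
  have "0 < \<eta>" using pos by (simp add: \<eta>_def)
  have hess: "continuous_on UNIV (\<lambda>p :: plane \<times> real. hessian \<phi> (fst p) $ i $ j)" for i j
    by (rule continuous_on_compose2[OF continuous_on_hessian]) (auto intro: continuous_intros)
  have "continuous_on UNIV (\<lambda>p. slope_form (fst p) (snd p))"
    unfolding slope_form_def by (intro continuous_intros hess)
  then have "isCont (\<lambda>p. slope_form (fst p) (snd p)) (y0, m0)"
    by (simp add: continuous_on_eq_continuous_at)
  then obtain r where "0 < r" and r: "\<And>p. dist p (y0, m0) < r \<Longrightarrow>
      dist (slope_form (fst p) (snd p)) (slope_form y0 m0) < \<eta>"
    unfolding continuous_at_eps_delta using \<open>0 < \<eta>\<close> by fastforce
  \<comment> \<open>Midpoint and displacement take \<open>r / 4\<close> each and the slope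
    \<open>r / 2\<close>, so that point and slope together stay within \<open>r\<close> of
    \<open>(y0, m0)\<close>.\<close>
  show thesis
  proof (rule that[of "r / 2" \<eta> "r / 4" m0])
    fix c :: plane and x m :: real
    let ?e = "vec2 x (m * x)"
    assume c: "norm (c - y0) < r / 4" and e: "norm ?e < r / 4" and m: "\<bar>m - m0\<bar> < r / 2"
    define g where "g t = grad \<phi> (c + t *\<^sub>R ?e) \<bullet> ?e" for t
    obtain t where t: "- 1 < t" "t < 1"
      and mvt: "g 1 - g (- 1) = (1 - (- 1)) * (x\<^sup>2 * slope_form (c + t *\<^sub>R ?e) m)"
      using MVT2[of "- 1" 1 g "\<lambda>t. x\<^sup>2 * slope_form (c + t *\<^sub>R ?e) m"] slope_derivative
      unfolding g_def by auto
    have "\<bar>t\<bar> * norm ?e \<le> 1 * norm ?e"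
      using t by (intro mult_right_mono) auto
    then have "norm (t *\<^sub>R ?e) < r / 4"
      using e unfolding norm_scaleR by linarith
    moreover have "norm (c + t *\<^sub>R ?e - y0) \<le> norm (c - y0) + norm (t *\<^sub>R ?e)"
      by (metis add_diff_eq add.commute norm_triangle_ineq diff_add_eq)
    ultimately have "dist (c + t *\<^sub>R ?e) y0 < r / 2"
      using c by (simp only: dist_norm)
    then have "dist (c + t *\<^sub>R ?e, m) (y0, m0) < r"
      using m unfolding dist_Pair_Pair
      by (intro le_less_trans[OF sqrt_sum_squares_le_sum]) (auto simp: dist_real_def)
    then have "\<eta> \<le> slope_form (c + t *\<^sub>R ?e) m"
      using r[of "(c + t *\<^sub>R ?e, m)"] unfolding \<eta>_def fst_conv snd_conv dist_real_def by linarith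
    then have "x\<^sup>2 * \<eta> \<le> x\<^sup>2 * slope_form (c + t *\<^sub>R ?e) m"
      by (rule mult_left_mono) simp
    moreover have "0 \<le> x\<^sup>2 * \<eta>" using \<open>0 < \<eta>\<close> by simp
    ultimately have "\<eta> * x\<^sup>2 \<le> g 1 - g (- 1)"
      unfolding mvt by (simp add: mult.commute)
    then show "\<eta> * x\<^sup>2 \<le> (grad \<phi> (c + ?e) - grad \<phi> (c - ?e)) \<bullet> ?e"
      by (simp add: g_def inner_diff_left del: scaleR_vec2)
  qed (use \<open>0 < r\<close> \<open>0 < \<eta>\<close> in auto)
qed

text \<open>On a compact set of \<open>(c, u)\<close> the positive second difference attains its
  minimum; the excess \<open>a\<close> of \<open>q\<close> keeps \<open>u\<close> away from 0. The
  constraints are written in \<open>c\<close> and \<open>q c u\<close> because these are functions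
  of the image point under \<open>T\<close>, which makes the set of pairs a full preimage.\<close>

lemma uniform_gain:
  assumes "0 < a"
  obtains \<gamma> where "0 < \<gamma>"
    "\<And>c u. norm c \<le> R \<Longrightarrow> q c u \<le> M \<Longrightarrow> 2 * \<psi> c + a \<le> q c u \<Longrightarrow>
      \<gamma> \<le> \<phi> (c + u) + \<phi> (c - u) - 2 * \<phi> c"
proof -
  let ?K = "{p. norm (fst p) \<le> R \<and> q (fst p) (snd p) \<le> M \<and> 2 * \<psi> (fst p) + a \<le> q (fst p) (snd p)}"
  define g where "g p = \<phi> (fst p + snd p) + \<phi> (fst p - snd p) - 2 * \<phi> (fst p)" for p
  have "closed ?K"
    by (intro closed_Collect_conj closed_Collect_le continuous_intros)
  moreover have "bounded ?K"
  proof (rule bounded_subset)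
    show "bounded (cball (0::plane) R \<times> cball (0::plane) (sqrt M))"
      by (intro bounded_Times bounded_cball)
    have "norm u \<le> sqrt M" if "q c u \<le> M" for c u
    proof (rule real_le_rsqrt)
      show "(norm u)\<^sup>2 \<le> M"
        using that q_ge[of c u] psi_nonneg[of c] zero_le_power2[of "norm u"] by linarith
    qed
    then show "?K \<subseteq> cball 0 R \<times> cball 0 (sqrt M)"
      by auto
  qed
  ultimately have "compact ?K"
    by (simp add: compact_eq_bounded_closed)
  moreover have cont: "continuous_on ?K g"
    unfolding g_def by (intro continuous_intros)
  moreover have gpos: "0 < g p" if "p \<in> ?K" for p
  proof -
    have "snd p \<noteq> 0"
    proof
      assume "snd p = 0"
      then have "q (fst p) (snd p) = 2 * \<psi> (fst p)" by (simp add: q_def)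
      with that assms show False by simp
    qed
    then show ?thesis unfolding g_def by (rule second_difference_pos)
  qed
  ultimately obtain \<gamma> where "0 < \<gamma>" "\<And>p. p \<in> ?K \<Longrightarrow> \<gamma> \<le> g p"
  proof (cases "?K = {}")
    case False
    then obtain p where "p \<in> ?K" "\<forall>p'\<in>?K. g p \<le> g p'"
      using continuous_attains_inf[OF \<open>compact ?K\<close> _ cont] by blast
    then show ?thesis using gpos that[of "g p"] by blast
  \<comment> \<open>For an empty constraint set the constant 1 serves.\<close>
  qed (use zero_less_one in blast)
  then show thesis
    by (intro that[of \<gamma>]) (force simp: g_def)+
qed

end

subsection \<open>Weights dominating the push-forward measure\<close>

lemma nn_integral_translate:
  fixes F :: "'a::euclidean_space \<Rightarrow> ennreal"
  assumes [measurable]: "F \<in> borel_measurable borel"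
  shows "(\<integral>\<^sup>+ x. F (a + x) \<partial>lborel) = (\<integral>\<^sup>+ x. F x \<partial>lborel)"
  by (subst (2) lborel_distr_plus[of a, symmetric], subst nn_integral_distr) auto

lemma nn_integral_lborel_pair:
  fixes F :: "'a::euclidean_space \<times> 'b::euclidean_space \<Rightarrow> ennreal"
  assumes "F \<in> borel_measurable borel"
  shows "(\<integral>\<^sup>+ p. F p \<partial>lborel) = (\<integral>\<^sup>+ x. \<integral>\<^sup>+ y. F (x, y) \<partial>lborel \<partial>lborel)"
proof -
  have "F \<in> borel_measurable (lborel \<Otimes>\<^sub>M lborel)"
    using assms by (simp add: lborel_prod)
  from lborel.nn_integral_fst[OF this] show ?thesis
    by (simp add: lborel_prod)
qed

text \<open>Two translations, of \<open>z\<close> for fixed \<open>y\<close> and of \<open>y\<close>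
  for fixed sum, with Fubini in between; passing to sum and half difference thus has Jacobian
  1.\<close>

lemma nn_integral_midpoint:
  fixes F :: "'a::euclidean_space \<times> 'a \<Rightarrow> ennreal"
  assumes [measurable]: "F \<in> borel_measurable borel"
  shows "(\<integral>\<^sup>+ p. F p \<partial>lborel)
    = (\<integral>\<^sup>+ \<xi>. \<integral>\<^sup>+ u. F ((1/2) *\<^sub>R \<xi> + u, (1/2) *\<^sub>R \<xi> - u) \<partial>lborel \<partial>lborel)"
proof -
  have half: "- ((1/2) *\<^sub>R \<xi> + u) + \<xi> = (1/2) *\<^sub>R \<xi> - u" for \<xi> u :: 'a
    by (simp add: algebra_simps flip: scaleR_left_distrib scaleR_add_left)
  have "(\<integral>\<^sup>+ p. F p \<partial>lborel) = (\<integral>\<^sup>+ y. \<integral>\<^sup>+ z. F (y, z) \<partial>lborel \<partial>lborel)"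
    by (rule nn_integral_lborel_pair) measurable
  also have "\<dots> = (\<integral>\<^sup>+ y. \<integral>\<^sup>+ \<xi>. F (y, - y + \<xi>) \<partial>lborel \<partial>lborel)"
    by (intro nn_integral_cong nn_integral_translate[symmetric]) measurable
  also have "\<dots> = (\<integral>\<^sup>+ \<xi>. \<integral>\<^sup>+ y. F (y, - y + \<xi>) \<partial>lborel \<partial>lborel)"
    by (rule lborel_pair.Fubini') measurable
  also have "\<dots> = (\<integral>\<^sup>+ \<xi>. \<integral>\<^sup>+ u. F ((1/2) *\<^sub>R \<xi> + u, - ((1/2) *\<^sub>R \<xi> + u) + \<xi>) \<partial>lborel \<partial>lborel)"
    by (intro nn_integral_cong nn_integral_translate[symmetric]) measurable
  finally show ?thesis unfolding half .
qed

context convex_perturbation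
begin

definition T :: "plane \<times> plane \<Rightarrow> space3" where
  "T p = (fst p + snd p, \<psi> (fst p) + \<psi> (snd p))"

lemma continuous_on_T: "continuous_on UNIV T"
  unfolding T_def by (intro continuous_intros)

lemma T_measurable [measurable]: "T \<in> borel_measurable borel"
  by (rule borel_measurable_continuous_onI[OF continuous_on_T])

lemma T_midpoint: "T ((1/2) *\<^sub>R \<xi> + u, (1/2) *\<^sub>R \<xi> - u) = (\<xi>, q ((1/2) *\<^sub>R \<xi>) u)"
  by (simp add: T_def q_def flip: scaleR_left_distrib)

text \<open>The fibre bound is integrated over the sum \<xi>, so the slope total has to be bounded
  uniformly in the midpoint.\<close>

lemma pushforward_bound:
  fixes G :: "space3 \<Rightarrow> ennreal"
  assumes [measurable]: "G \<in> borel_measurable borel" "V \<in> sets borel"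
    and b: "\<And>c. b c \<in> borel_measurable borel" "\<And>c m. 0 \<le> b c m"
    and gain: "\<And>c m x. (c + x *\<^sub>R vec2 1 m, c - x *\<^sub>R vec2 1 m) \<in> V \<Longrightarrow>
      2 * (norm (x *\<^sub>R vec2 1 m))\<^sup>2 \<le> b c m * radial c (x *\<^sub>R vec2 1 m)"
    and total: "\<And>c. (\<integral>\<^sup>+ m. ennreal (b c m / (1 + m\<^sup>2)) \<partial>lborel) \<le> \<kappa>"
  shows "(\<integral>\<^sup>+ p. G (T p) * indicator V p \<partial>lborel) \<le> \<kappa> * (\<integral>\<^sup>+ x. G x \<partial>lborel)"
proof -
  have "(\<integral>\<^sup>+ p. G (T p) * indicator V p \<partial>lborel) = (\<integral>\<^sup>+ \<xi>. \<integral>\<^sup>+ u. G (\<xi>, q ((1/2) *\<^sub>R \<xi>) u)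
      * indicator V ((1/2) *\<^sub>R \<xi> + u, (1/2) *\<^sub>R \<xi> - u) \<partial>lborel \<partial>lborel)"
    by (subst nn_integral_midpoint) (auto simp: T_midpoint)
  also have "\<dots> \<le> (\<integral>\<^sup>+ \<xi>. \<kappa> * (\<integral>\<^sup>+ t. G (\<xi>, t) \<partial>lborel) \<partial>lborel)"
  proof (rule nn_integral_mono)
    fix \<xi> :: plane
    define c where "c = (1/2) *\<^sub>R \<xi>"
    have [measurable]: "{u. (c + u, c - u) \<in> V} \<in> sets borel"
      by measurable
    have "(\<integral>\<^sup>+ u. G (\<xi>, q c u) * indicator {u. (c + u, c - u) \<in> V} u \<partial>lborel)
        \<le> (\<integral>\<^sup>+ m. ennreal (b c m / (1 + m\<^sup>2)) \<partial>lborel) * (\<integral>\<^sup>+ t. G (\<xi>, t) \<partial>lborel)"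
      by (rule fiber_bound) (use b gain in auto)
    also have "\<dots> \<le> \<kappa> * (\<integral>\<^sup>+ t. G (\<xi>, t) \<partial>lborel)"
      by (intro mult_right_mono total) auto
    also have "indicator {u. (c + u, c - u) \<in> V} = (\<lambda>u. indicator V (c + u, c - u))"
      by (auto simp: indicator_def)
    finally show "(\<integral>\<^sup>+ u. G (\<xi>, q ((1/2) *\<^sub>R \<xi>) u)
        * indicator V ((1/2) *\<^sub>R \<xi> + u, (1/2) *\<^sub>R \<xi> - u) \<partial>lborel) \<le> \<kappa> * (\<integral>\<^sup>+ t. G (\<xi>, t) \<partial>lborel)"
      by (simp only: c_def)
  qed
  also have "\<dots> = \<kappa> * (\<integral>\<^sup>+ x. G x \<partial>lborel)"
    by (subst nn_integral_cmult) (auto simp: nn_integral_lborel_pair[of G])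
  finally show ?thesis .
qed

text \<open>The choice \<open>b = 1/2\<close> encodes
  \<open>4 * (norm u)\<^sup>2 \<le> radial c u\<close>, and half of the angular mass \<pi> gives the
  constant.\<close>

lemma pushforward_bound_half_pi:
  fixes G :: "space3 \<Rightarrow> ennreal"
  assumes [measurable]: "G \<in> borel_measurable borel"
  shows "(\<integral>\<^sup>+ p. G (T p) \<partial>lborel) \<le> ennreal (pi / 2) * (\<integral>\<^sup>+ x. G x \<partial>lborel)"
proof -
  have "(\<integral>\<^sup>+ m. ennreal (1 / 2 / (1 + m\<^sup>2)) \<partial>lborel)
      = (\<integral>\<^sup>+ m. ennreal (1 / 2) * ennreal (1 / (1 + m\<^sup>2)) \<partial>lborel)"
    by (intro nn_integral_cong) (simp add: ennreal_mult'[symmetric] del: ennreal_half)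
  also have "\<dots> = ennreal (pi / 2)"
    by (subst nn_integral_cmult, measurable, unfold nn_integral_inverse_1_plus_square,
        subst ennreal_mult[symmetric]) auto
  finally have "(\<integral>\<^sup>+ p. G (T p) * indicator UNIV p \<partial>lborel) \<le> ennreal (pi / 2) * (\<integral>\<^sup>+ x. G x \<partial>lborel)"
    by (intro pushforward_bound[where b = "\<lambda>_ _. 1 / 2"]) (use radial_ge_norm in auto)
  then show ?thesis by simp
qed

definition admissible :: "(plane \<times> plane \<Rightarrow> real) \<Rightarrow> bool" where
  "admissible W \<longleftrightarrow> W \<in> borel_measurable borel \<and> (\<forall>p. 0 < W p) \<and>
    (\<forall>G \<in> borel_measurable borel.
      (\<integral>\<^sup>+ p. G (T p) * ennreal (1 / W p) \<partial>lborel) \<le> (\<integral>\<^sup>+ x. G x \<partial>lborel))"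

text \<open>Pairs mapped into \<open>E\<close> and pairs mapped outside have disjoint images, so the
  two bounds apply to separate parts of Lebesgue measure and the weight over \<open>E\<close>
  changes at no cost elsewhere.\<close>

lemma admissible_target:
  assumes [measurable]: "E \<in> sets borel" and "0 < \<kappa>"
    and bound: "\<And>G :: space3 \<Rightarrow> ennreal. G \<in> borel_measurable borel \<Longrightarrow>
      (\<integral>\<^sup>+ p. G (T p) * indicator (T -` E) p \<partial>lborel) \<le> ennreal \<kappa> * (\<integral>\<^sup>+ x. G x \<partial>lborel)"
  shows "admissible (\<lambda>p. if T p \<in> E then \<kappa> else pi / 2)"
  unfolding admissible_def
proof (intro conjI ballI allI)
  fix G :: "space3 \<Rightarrow> ennreal" assume [measurable]: "G \<in> borel_measurable borel"
  have [measurable]: "T -` E \<in> sets borel"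
    using measurable_sets[OF T_measurable, of E] by simp
  let ?G1 = "\<lambda>x. G x * indicator E x" and ?G2 = "\<lambda>x. G x * indicator (- E) x"
  have "(\<integral>\<^sup>+ p. G (T p) * ennreal (1 / (if T p \<in> E then \<kappa> else pi / 2)) \<partial>lborel)
      = (\<integral>\<^sup>+ p. ennreal (1 / \<kappa>) * (?G1 (T p) * indicator (T -` E) p) + ennreal (1 / (pi / 2)) * ?G2 (T p) \<partial>lborel)"
    by (intro nn_integral_cong) (auto simp: mult.commute split: split_indicator)
  also have "\<dots> = ennreal (1 / \<kappa>) * (\<integral>\<^sup>+ p. ?G1 (T p) * indicator (T -` E) p \<partial>lborel)
      + ennreal (1 / (pi / 2)) * (\<integral>\<^sup>+ p. ?G2 (T p) \<partial>lborel)"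
    by (subst nn_integral_add) (auto simp: nn_integral_cmult)
  also have "\<dots> \<le> ennreal (1 / \<kappa>) * (ennreal \<kappa> * (\<integral>\<^sup>+ x. ?G1 x \<partial>lborel))
      + ennreal (1 / (pi / 2)) * (ennreal (pi / 2) * (\<integral>\<^sup>+ x. ?G2 x \<partial>lborel))"
    by (intro add_mono mult_left_mono bound pushforward_bound_half_pi) auto
  also have "\<dots> = (\<integral>\<^sup>+ x. ?G1 x \<partial>lborel) + (\<integral>\<^sup>+ x. ?G2 x \<partial>lborel)"
    using \<open>0 < \<kappa>\<close> by (simp add: mult.assoc[symmetric] ennreal_mult'[symmetric])
  also have "\<dots> = (\<integral>\<^sup>+ x. G x \<partial>lborel)"
    by (subst nn_integral_add[symmetric]) (auto intro!: nn_integral_cong split: split_indicator)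
  finally show "(\<integral>\<^sup>+ p. G (T p) * ennreal (1 / (if T p \<in> E then \<kappa> else pi / 2)) \<partial>lborel)
      \<le> (\<integral>\<^sup>+ x. G x \<partial>lborel)" .
qed (use \<open>0 < \<kappa>\<close> in \<open>auto\<close>)

lemma admissible_half_pi: "admissible (\<lambda>_. pi / 2)"
  using admissible_target[of "{}" 1] by simp

text \<open>The set \<open>S\<close> may cut through fibres of \<open>T\<close>, so its image can
  overlap that of the other pairs. The two contributions to the density then add up, and
  \<open>AB\<close> is the budget: for positive \<kappa>, \<open>A\<close> must exceed \<pi>/2 a
  little to make room for \<open>B\<close>.\<close>

lemma admissible_source:
  assumes [measurable]: "S \<in> sets borel" and pos: "0 < A" "0 < B" "0 \<le> \<kappa>"
    and bound: "\<And>G :: space3 \<Rightarrow> ennreal. G \<in> borel_measurable borel \<Longrightarrow>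
      (\<integral>\<^sup>+ p. G (T p) * indicator S p \<partial>lborel) \<le> ennreal \<kappa> * (\<integral>\<^sup>+ x. G x \<partial>lborel)"
    and AB: "(pi / 2) / A + \<kappa> / B \<le> 1"
  shows "admissible (\<lambda>p. if p \<in> S then B else A)"
  unfolding admissible_def
proof (intro conjI ballI allI)
  fix G :: "space3 \<Rightarrow> ennreal" assume [measurable]: "G \<in> borel_measurable borel"
  have "(\<integral>\<^sup>+ p. G (T p) * ennreal (1 / (if p \<in> S then B else A)) \<partial>lborel)
      \<le> (\<integral>\<^sup>+ p. ennreal (1 / A) * G (T p) + ennreal (1 / B) * (G (T p) * indicator S p) \<partial>lborel)"
    by (intro nn_integral_mono) (auto simp: mult.commute split: split_indicator)
  also have "\<dots> = ennreal (1 / A) * (\<integral>\<^sup>+ p. G (T p) \<partial>lborel)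
      + ennreal (1 / B) * (\<integral>\<^sup>+ p. G (T p) * indicator S p \<partial>lborel)"
    by (subst nn_integral_add) (auto simp: nn_integral_cmult)
  also have "\<dots> \<le> ennreal (1 / A) * (ennreal (pi / 2) * (\<integral>\<^sup>+ x. G x \<partial>lborel))
      + ennreal (1 / B) * (ennreal \<kappa> * (\<integral>\<^sup>+ x. G x \<partial>lborel))"
    by (intro add_mono mult_left_mono bound pushforward_bound_half_pi) auto
  also have "\<dots> = ennreal ((pi / 2) / A + \<kappa> / B) * (\<integral>\<^sup>+ x. G x \<partial>lborel)"
  proof -
    have "ennreal ((pi / 2) / A + \<kappa> / B) = ennreal ((pi / 2) / A) + ennreal (\<kappa> / B)"
      using pos by (intro ennreal_plus) auto
    moreover have "ennreal (1 / A) * ennreal (pi / 2) = ennreal ((pi / 2) / A)"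
      "ennreal (1 / B) * ennreal \<kappa> = ennreal (\<kappa> / B)"
      using pos by (simp_all add: ennreal_mult[symmetric] del: ennreal_half)
    ultimately show ?thesis by (simp only: distrib_right mult.assoc[symmetric])
  qed
  also have "\<dots> \<le> 1 * (\<integral>\<^sup>+ x. G x \<partial>lborel)"
    using AB by (intro mult_right_mono) auto
  finally show "(\<integral>\<^sup>+ p. G (T p) * ennreal (1 / (if p \<in> S then B else A)) \<partial>lborel)
      \<le> (\<integral>\<^sup>+ x. G x \<partial>lborel)" by simp
qed (use pos in auto)

end

section \<open>Angular measure of the lines that meet a disc\<close>

lemma nn_integral_slope_const:
  assumes "0 \<le> b"
  shows "(\<integral>\<^sup>+ m. ennreal (b / (1 + m\<^sup>2)) \<partial>lborel) = ennreal (b * pi)"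
proof -
  have "(\<integral>\<^sup>+ m. ennreal (b / (1 + m\<^sup>2)) \<partial>lborel)
      = (\<integral>\<^sup>+ m. ennreal b * ennreal (1 / (1 + m\<^sup>2)) \<partial>lborel)"
    using assms by (intro nn_integral_cong) (simp add: ennreal_mult'[symmetric])
  also have "\<dots> = ennreal b * ennreal pi"
    by (subst nn_integral_cmult) (auto simp: nn_integral_inverse_1_plus_square)
  finally show ?thesis using assms by (simp add: ennreal_mult)
qed

text \<open>The vector \<open>vec2 (- m) 1\<close> is normal to the line of slope \<open>m\<close>,
  so moving along the line does not change the inner product, and Cauchy-Schwarz can be applied at
  the point near the origin.\<close>

lemma cross_le_of_near_line:
  assumes "norm (c + x *\<^sub>R vec2 1 m) \<le> \<rho>"
  shows "\<bar>c $ 2 - m * c $ 1\<bar> \<le> \<rho> * sqrt (1 + m\<^sup>2)"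
proof -
  define y where "y = c + x *\<^sub>R vec2 1 m"
  have "c $ 2 - m * c $ 1 = y \<bullet> vec2 (- m) 1"
    by (simp add: y_def inner_plane algebra_simps)
  also have "\<bar>\<dots>\<bar> \<le> norm y * norm (vec2 (- m) 1)"
    by (rule Cauchy_Schwarz_ineq2)
  also have "norm (vec2 (- m) 1) = sqrt (1 + m\<^sup>2)"
    using norm_plane[of "vec2 (- m) 1"] by (simp add: real_sqrt_unique add.commute)
  also have "norm y * sqrt (1 + m\<^sup>2) \<le> \<rho> * sqrt (1 + m\<^sup>2)"
    using assms by (intro mult_right_mono) (auto simp: y_def)
  finally show ?thesis .
qed

text \<open>The directions in which a disc of fixed radius is seen from far away have small measure.\<close>

lemma small_angle:
  assumes "0 < \<kappa>" "0 \<le> \<rho>"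
  obtains L where "0 < L"
    "\<And>c :: plane. L \<le> norm c \<Longrightarrow>
      (\<integral>\<^sup>+ m. ennreal (indicator {m. \<bar>c $ 2 - m * c $ 1\<bar> \<le> \<rho> * sqrt (1 + m\<^sup>2)} m / 2 / (1 + m\<^sup>2)) \<partial>lborel)
        \<le> ennreal \<kappa>"
proof -
  have "\<forall>\<^sub>F N in at_top. pi / 2 - \<kappa> / 2 < arctan N"
    using assms by (intro order_tendstoD(1)[OF tendsto_arctan_at_top]) auto
  then have "\<forall>\<^sub>F N in at_top. pi / 2 - \<kappa> / 2 < arctan N \<and> 1 \<le> N"
    using eventually_ge_at_top by (rule eventually_conj)
  \<comment> \<open>Each of the two tails beyond \<open>N\<close> and \<open>- N\<close> has angular
    mass below \<open>\<kappa> / 2\<close>; with the factor 1/2 of the integrand they contribute at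
    most \<open>\<kappa> / 2\<close> together.\<close>
  then obtain N where N: "pi / 2 - \<kappa> / 2 < arctan N" "1 \<le> N"
    by (auto dest: eventually_happens simp: trivial_limit_at_top_linorder)
  define s where "s = \<rho> * sqrt (1 + N\<^sup>2)"
  have "0 \<le> s" using assms by (simp add: s_def)
  \<comment> \<open>The term \<open>2 * s\<close> rules out centres too steep to be met by slopes
    below \<open>N\<close>; the last term makes the interval of remaining slopes no longer than
    \<kappa>.\<close>
  define L where "L = 2 * s + 1 + 8 * s * N / \<kappa>"
  have div_nonneg: "0 \<le> 8 * s * N / \<kappa>"
    using \<open>0 \<le> s\<close> N assms by simp
  then have L: "2 * s < L" "0 < L"
    using \<open>0 \<le> s\<close> by (simp_all add: L_def)
  have "8 * s * N / \<kappa> \<le> L" using \<open>0 \<le> s\<close> by (simp add: L_def)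
  then have L2: "8 * s * N \<le> L * \<kappa>"
    using assms by (simp add: pos_divide_le_eq)
  show thesis
  proof (rule that[OF \<open>0 < L\<close>])
    fix c :: plane
    assume c: "L \<le> norm c"
    let ?A = "{m. \<bar>c $ 2 - m * c $ 1\<bar> \<le> \<rho> * sqrt (1 + m\<^sup>2)}"
    let ?I = "{c $ 2 / c $ 1 - s / \<bar>c $ 1\<bar> .. c $ 2 / c $ 1 + s / \<bar>c $ 1\<bar>}"
    \<comment> \<open>For slopes of size below \<open>N\<close> the condition confines
      \<open>m\<close> to an interval about \<open>c $ 2 / c $ 1\<close>, unless
      \<open>c $ 1\<close> is small against \<open>norm c\<close>, in which case no such slope
      exists.\<close>
    define J where "J = (if norm c \<le> 4 * N * \<bar>c $ 1\<bar> then ?I else {})"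
    have cover: "m \<in> J \<or> N \<le> \<bar>m\<bar>" if m: "m \<in> ?A" for m
    proof (rule disjCI)
      assume "\<not> N \<le> \<bar>m\<bar>"
      then have mN: "\<bar>m\<bar> \<le> N" by simp
      then have "\<bar>m\<bar>\<^sup>2 \<le> N\<^sup>2" by (rule power_mono) simp
      then have "\<rho> * sqrt (1 + m\<^sup>2) \<le> s"
        unfolding s_def using assms by (intro mult_left_mono) auto
      then have ms: "\<bar>c $ 2 - m * c $ 1\<bar> \<le> s" using m by simp
      show "m \<in> J"
      proof (cases "norm c \<le> 4 * N * \<bar>c $ 1\<bar>")
        case True
        then have c1: "c $ 1 \<noteq> 0" using c L by auto
        have "\<bar>c $ 2 / c $ 1 - m\<bar> = \<bar>c $ 2 - m * c $ 1\<bar> / \<bar>c $ 1\<bar>"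
          using c1 by (simp add: abs_divide[symmetric] diff_divide_distrib)
        also have "\<dots> \<le> s / \<bar>c $ 1\<bar>" by (rule divide_right_mono[OF ms]) simp
        finally show ?thesis using True by (simp add: J_def abs_le_iff)
      next
        case False
        have "\<bar>m * c $ 1\<bar> \<le> N * \<bar>c $ 1\<bar>"
          unfolding abs_mult by (rule mult_right_mono[OF mN]) simp
        moreover have "1 * \<bar>c $ 1\<bar> \<le> N * \<bar>c $ 1\<bar>"
          by (rule mult_right_mono[OF N(2)]) simp
        moreover have "norm c \<le> \<bar>c $ 1\<bar> + \<bar>c $ 2\<bar>" by (rule norm_plane_le)
        ultimately have "norm c \<le> 2 * s" using ms False by linarith
        with c L show ?thesis by simp
      qed
    qed
    have J_meas [measurable]: "J \<in> sets borel" by (simp add: J_def)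
    have J_measure: "emeasure lborel J \<le> ennreal \<kappa>"
    proof (cases "norm c \<le> 4 * N * \<bar>c $ 1\<bar>")
      case True
      then have c1: "0 < \<bar>c $ 1\<bar>" using c L by auto
      have "L * \<kappa> \<le> 4 * N * \<bar>c $ 1\<bar> * \<kappa>"
        using True c assms by (intro mult_right_mono) auto
      then have "N * (2 * s) \<le> N * (\<kappa> * \<bar>c $ 1\<bar>)"
        using L2 by (simp add: algebra_simps)
      then have "2 * s \<le> \<kappa> * \<bar>c $ 1\<bar>"
        using N by (simp add: mult_le_cancel_left)
      then have "2 * (s / \<bar>c $ 1\<bar>) \<le> \<kappa>"
        using c1 by (simp add: divide_le_eq)
      then show ?thesis
        using True \<open>0 \<le> s\<close> by (simp add: J_def emeasure_lborel_Icc_eq ennreal_leI)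
    qed (simp add: J_def)
    have tail: "(\<integral>\<^sup>+ m. ennreal (1 / (1 + m\<^sup>2)) * indicator {N..} m \<partial>lborel) \<le> ennreal (\<kappa> / 2)"
    proof -
      have "(\<integral>\<^sup>+ m. ennreal (1 / (1 + m\<^sup>2)) * indicator {N..} m \<partial>lborel) = ennreal (pi / 2 - arctan N)"
        by (rule nn_integral_FTC_atLeast)
           (auto intro!: derivative_eq_intros tendsto_arctan_at_top simp: field_simps add_nonneg_eq_0_iff)
      then show ?thesis using N by (auto intro: ennreal_leI)
    qed
    have tails: "(\<integral>\<^sup>+ m. ennreal (1 / 2) * (ennreal (1 / (1 + m\<^sup>2)) * indicator {m. N \<le> \<bar>m\<bar>} m) \<partial>lborel)
        \<le> ennreal (\<kappa> / 2)"
    proof -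
      have "(\<integral>\<^sup>+ m. ennreal (1 / (1 + m\<^sup>2)) * indicator {m. N \<le> \<bar>m\<bar>} m \<partial>lborel)
          = 2 * (\<integral>\<^sup>+ m. ennreal (1 / (1 + m\<^sup>2)) * indicator {m. N \<le> \<bar>m\<bar>} m * indicator {0..} m \<partial>lborel)"
        by (rule nn_integral_even) (auto simp: indicator_def)
      also have "\<dots> = 2 * (\<integral>\<^sup>+ m. ennreal (1 / (1 + m\<^sup>2)) * indicator {N..} m \<partial>lborel)"
        using N by (intro arg_cong[where f = "\<lambda>x. 2 * x"] nn_integral_cong) (auto simp: indicator_def)
      also have "\<dots> \<le> 2 * ennreal (\<kappa> / 2)"
        by (intro mult_left_mono tail) simp
      finally have "ennreal (1 / 2) * (\<integral>\<^sup>+ m. ennreal (1 / (1 + m\<^sup>2)) * indicator {m. N \<le> \<bar>m\<bar>} m \<partial>lborel)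
          \<le> ennreal (1 / 2) * (2 * ennreal (\<kappa> / 2))"
        by (rule mult_left_mono) simp
      also have "\<dots> = ennreal (\<kappa> / 2)"
        using assms by (simp add: ennreal_mult'[symmetric] mult.assoc[symmetric] del: ennreal_half
            flip: ennreal_numeral)
      finally show ?thesis by (subst nn_integral_cmult) auto
    qed
    have "(\<integral>\<^sup>+ m. ennreal (indicator ?A m / 2 / (1 + m\<^sup>2)) \<partial>lborel)
        \<le> (\<integral>\<^sup>+ m. ennreal (1 / 2) * (ennreal (1 / (1 + m\<^sup>2)) * indicator {m. N \<le> \<bar>m\<bar>} m)
          + ennreal (1 / 2) * indicator J m \<partial>lborel)"
    proof (rule nn_integral_mono)
      fix m
      consider "m \<notin> ?A" | "m \<in> ?A" "N \<le> \<bar>m\<bar>" | "m \<in> ?A" "m \<in> J"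
        using cover by blast
      then show "ennreal (indicator ?A m / 2 / (1 + m\<^sup>2))
          \<le> ennreal (1 / 2) * (ennreal (1 / (1 + m\<^sup>2)) * indicator {m. N \<le> \<bar>m\<bar>} m)
            + ennreal (1 / 2) * indicator J m"
      proof cases
        case 2
        then have "ennreal (indicator ?A m / 2 / (1 + m\<^sup>2))
            = ennreal (1 / 2) * (ennreal (1 / (1 + m\<^sup>2)) * indicator {m. N \<le> \<bar>m\<bar>} m)"
          by (simp add: ennreal_mult'[symmetric] del: ennreal_half)
        then show ?thesis by simp
      next
        case 3
        have "1 / 2 / (1 + m\<^sup>2) \<le> 1 / 2"
          by (simp add: divide_le_eq add_pos_nonneg)
        then have "ennreal (indicator ?A m / 2 / (1 + m\<^sup>2)) \<le> ennreal (1 / 2) * indicator J m"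
          using 3 by (simp add: ennreal_leI del: ennreal_half)
        then show ?thesis by (rule order_trans) simp
      qed simp
    qed
    also have "\<dots> = (\<integral>\<^sup>+ m. ennreal (1 / 2) * (ennreal (1 / (1 + m\<^sup>2)) * indicator {m. N \<le> \<bar>m\<bar>} m) \<partial>lborel)
        + ennreal (1 / 2) * emeasure lborel J"
      by (subst nn_integral_add) (auto simp: nn_integral_cmult)
    also have "\<dots> \<le> ennreal (\<kappa> / 2) + ennreal (1 / 2) * ennreal \<kappa>"
      by (intro add_mono tails mult_left_mono J_measure) simp
    also have "\<dots> = ennreal \<kappa>"
      using assms by (simp add: ennreal_mult'[symmetric] ennreal_plus[symmetric] del: ennreal_half ennreal_plus)
    finally show "(\<integral>\<^sup>+ m. ennreal (indicator ?A m / 2 / (1 + m\<^sup>2)) \<partial>lborel) \<le> ennreal \<kappa>" .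
  qed
qed

section \<open>Weights lowered off the diagonal, at a curved point, and between bounded and far
  points\<close>

context convex_perturbation
begin

text \<open>The pairs are enclosed in the full preimage of \<open>E\<close>, on which
  \<open>uniform_gain\<close> bounds the second difference below by \<gamma>. Since
  \<open>2 * (norm u)\<^sup>2 \<le> M\<close> there, \<gamma> is at least
  \<open>2 * \<gamma> / M * (norm u)\<^sup>2\<close>, a gain proportional to the quadratic term, so
  the slope weight drops to some \<open>b < 1/2\<close> for all slopes at once.\<close>

lemma weight_off_diagonal:
  assumes "0 < a"
  obtains \<delta> W where "0 < \<delta>" "admissible W"
    "\<And>p. W p + \<delta> * indicator {p. norm (fst p) \<le> R \<and> norm (snd p) \<le> R \<and> a \<le> norm (fst p - snd p)} p \<le> pi / 2"
proof -
  let ?S = "{p :: plane \<times> plane. norm (fst p) \<le> R \<and> norm (snd p) \<le> R \<and> a \<le> norm (fst p - snd p)}"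
  have "compact (\<psi> ` cball 0 R)"
    by (intro compact_continuous_image continuous_intros) auto
  then have "bounded (\<psi> ` cball 0 R)" by (rule compact_imp_bounded)
  then obtain M0 where "0 < M0" and M0': "\<forall>v\<in>\<psi> ` cball 0 R. norm v \<le> M0"
    unfolding bounded_pos by blast
  have M0: "\<psi> y \<le> M0" if "norm y \<le> R" for y
    using M0' that by (auto simp: abs_le_iff)
  define M where "M = 2 * M0"
  have "0 < M" using \<open>0 < M0\<close> by (simp add: M_def)
  obtain \<gamma> where "0 < \<gamma>" and \<gamma>: "\<And>c u. norm c \<le> R \<Longrightarrow> q c u \<le> M \<Longrightarrow> 2 * \<psi> c + a\<^sup>2 / 2 \<le> q c u \<Longrightarrow>
      \<gamma> \<le> \<phi> (c + u) + \<phi> (c - u) - 2 * \<phi> c"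
    using uniform_gain[of "a\<^sup>2 / 2" R M] assms by auto
  \<comment> \<open>Distance at least \<open>a\<close> means half difference at least
    \<open>a / 2\<close>, which raises \<open>q\<close> above \<open>2 * \<psi> c\<close> by at
    least \<open>a\<^sup>2 / 2\<close>.\<close>
  define E where "E = {x :: space3. norm (fst x) \<le> 2 * R \<and> snd x \<le> M
      \<and> 2 * \<psi> ((1/2) *\<^sub>R fst x) + a\<^sup>2 / 2 \<le> snd x}"
  have "closed E"
    unfolding E_def by (intro closed_Collect_conj closed_Collect_le continuous_intros)
  then have [measurable]: "E \<in> sets borel" by simp
  have [measurable]: "T -` E \<in> sets borel"
    using measurable_sets[OF T_measurable, of E] by simp
  define b where "b = 2 / (4 + 2 * \<gamma> / M)"
  have den: "0 < 2 * \<gamma> / M" using \<open>0 < \<gamma>\<close> \<open>0 < M\<close> by simp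
  have "0 < 2 / (4 + t) \<and> 2 / (4 + t) < 1 / 2 \<and> 2 / (4 + t) * (4 + t) = 2" if "0 < t" for t :: real
    using that by (simp add: divide_simps)
  from this[OF den] have b: "0 < b" "b < 1 / 2" "b * (4 + 2 * \<gamma> / M) = 2"
    unfolding b_def by blast+
  have W: "admissible (\<lambda>p. if T p \<in> E then b * pi else pi / 2)"
  proof (rule admissible_target)
    fix G :: "space3 \<Rightarrow> ennreal" assume "G \<in> borel_measurable borel"
    then show "(\<integral>\<^sup>+ p. G (T p) * indicator (T -` E) p \<partial>lborel) \<le> ennreal (b * pi) * (\<integral>\<^sup>+ x. G x \<partial>lborel)"
    proof (rule pushforward_bound[where b = "\<lambda>_ _. b"])
      fix c :: plane and x m :: real
      define u where "u = x *\<^sub>R vec2 1 m"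
      assume "(c + x *\<^sub>R vec2 1 m, c - x *\<^sub>R vec2 1 m) \<in> T -` E"
      then have "T (c + u, c - u) \<in> E" by (simp only: u_def vimage_eq)
      moreover have "T (c + u, c - u) = (2 *\<^sub>R c, q c u)"
        using T_midpoint[of "2 *\<^sub>R c" u] by simp
      ultimately have cu: "norm c \<le> R" "q c u \<le> M" "2 * \<psi> c + a\<^sup>2 / 2 \<le> q c u"
        by (auto simp: E_def)
      have "2 * (norm u)\<^sup>2 \<le> M"
        using cu(2) q_ge[of c u] psi_nonneg[of c] by linarith
      then have "(2 * \<gamma> / M) * (norm u)\<^sup>2 \<le> \<gamma>"
        using \<open>0 < \<gamma>\<close> \<open>0 < M\<close> by (simp add: divide_le_eq mult.commute mult.left_commute)
      then have "(4 + 2 * \<gamma> / M) * (norm u)\<^sup>2 \<le> radial c u"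
        using radial_ge[of u c] \<gamma>[OF cu] by (simp add: distrib_right)
      then have "b * ((4 + 2 * \<gamma> / M) * (norm u)\<^sup>2) \<le> b * radial c u"
        using b by (intro mult_left_mono) auto
      then show "2 * (norm (x *\<^sub>R vec2 1 m))\<^sup>2 \<le> b * radial c (x *\<^sub>R vec2 1 m)"
        unfolding u_def[symmetric] mult.assoc[symmetric] b(3) .
    qed (use b in \<open>auto simp: nn_integral_slope_const\<close>)
  qed (use b in auto)
  show thesis
  proof (rule that[OF _ W])
    have "b * pi < 1 / 2 * pi" using b by (intro mult_strict_right_mono) auto
    then show bpi: "0 < pi / 2 - b * pi" by simp
    have "T p \<in> E" if "p \<in> ?S" for p
    proof -
      obtain y z where p: "p = (y, z)" by fastforce
      define \<xi> where "\<xi> = y + z"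
      define u where "u = (1/2) *\<^sub>R (y - z)"
      have yz: "y = (1/2) *\<^sub>R \<xi> + u" "z = (1/2) *\<^sub>R \<xi> - u"
        by (simp_all add: \<xi>_def u_def vec_eq_iff field_simps)
      have Tp: "T p = (\<xi>, q ((1/2) *\<^sub>R \<xi>) u)"
        unfolding p by (subst yz(1), subst yz(2)) (rule T_midpoint)
      have "(a / 2)\<^sup>2 \<le> (norm u)\<^sup>2"
        using that assms by (intro power_mono) (auto simp: u_def p)
      then have "2 * \<psi> ((1/2) *\<^sub>R \<xi>) + a\<^sup>2 / 2 \<le> q ((1/2) *\<^sub>R \<xi>) u"
        using q_ge[of "(1/2) *\<^sub>R \<xi>" u] by (simp add: power_divide)
      moreover have "norm \<xi> \<le> 2 * R"
        using that norm_triangle_ineq[of y z] by (simp add: p \<xi>_def)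
      moreover have "snd (T p) \<le> M"
        using that M0[of y] M0[of z] by (simp add: p T_def M_def)
      ultimately show ?thesis by (simp add: E_def Tp)
    qed
    then show "(if T p \<in> E then b * pi else pi / 2) + (pi / 2 - b * pi) * indicator ?S p \<le> pi / 2" for p
      using bpi by (cases "p \<in> ?S") auto
  qed
qed

text \<open>Growth is faster only for slopes near \<open>m0\<close>, so the slope weight is lowered
  on the interval \<open>I\<close> alone; the total over all slopes still falls below \<pi>/2 by a
  fixed amount, and does so over a whole neighbourhood \<open>E\<close> of
  \<open>T (y0, y0)\<close>.\<close>

lemma weight_curved_point:
  assumes "hessian \<phi> y0 \<noteq> 0"
  obtains \<delta> \<rho> W where "0 < \<delta>" "0 < \<rho>" "admissible W"
    "\<And>p. W p + \<delta> * indicator (ball y0 \<rho> \<times> ball y0 \<rho>) p \<le> pi / 2"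
proof -
  obtain m0 d \<eta> r where pos: "0 < d" "0 < \<eta>" "0 < r"
    and gain: "\<And>c x m. norm (c - y0) < r \<Longrightarrow> norm (vec2 x (m * x)) < r \<Longrightarrow> \<bar>m - m0\<bar> < d \<Longrightarrow>
      \<eta> * x\<^sup>2 \<le> (grad \<phi> (c + vec2 x (m * x)) - grad \<phi> (c - vec2 x (m * x))) \<bullet> vec2 x (m * x)"
    using curved_gain[OF assms] by metis
  \<comment> \<open>Locality expressed through the image point: the midpoint is near
    \<open>y0\<close>, and the height bound forces \<open>norm u < r\<close> because
    \<open>q\<close> exceeds \<open>2 * \<psi> c\<close> by at least
    \<open>2 * (norm u)\<^sup>2\<close>.\<close>
  define E where "E = {x :: space3. norm ((1/2) *\<^sub>R fst x - y0) < r
      \<and> snd x < 2 * \<psi> ((1/2) *\<^sub>R fst x) + 2 * r\<^sup>2}"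
  have "open E"
    unfolding E_def by (intro open_Collect_conj open_Collect_less continuous_intros)
  then have [measurable]: "E \<in> sets borel" by simp
  have [measurable]: "T -` E \<in> sets borel"
    using measurable_sets[OF T_measurable, of E] by simp
  \<comment> \<open>An upper bound for \<open>1 + m\<^sup>2\<close> on \<open>I\<close>; it compares
    \<open>(norm u)\<^sup>2\<close> with \<open>x\<^sup>2\<close> and bounds the angular density
    from below.\<close>
  define l where "l = 1 + (\<bar>m0\<bar> + d)\<^sup>2"
  have "0 < l" by (simp add: l_def add_pos_nonneg)
  define b1 where "b1 = 2 / (4 + \<eta> / l)"
  have den: "0 < \<eta> / l" using pos \<open>0 < l\<close> by simp
  have "0 < 2 / (4 + t) \<and> 2 / (4 + t) < 1 / 2 \<and> 2 / (4 + t) * (4 + t) = 2" if "0 < t" for t :: real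
    using that by (simp add: divide_simps)
  from this[OF den] have b1: "0 < b1" "b1 < 1 / 2" "b1 * (4 + \<eta> / l) = 2"
    unfolding b1_def by blast+
  define I where "I = {m0 - d <..< m0 + d}"
  define b where "b m = (if m \<in> I then b1 else 1 / 2)" for m
  \<comment> \<open>The decrease of the slope weight times a lower bound for the angular mass of
    \<open>I\<close>; the cap \<pi>/4 keeps the new weight positive.\<close>
  define j where "j = min ((1 / 2 - b1) / l * (2 * d)) (pi / 4)"
  have "0 < (1 / 2 - b1) / l * (2 * d)"
    using b1 pos \<open>0 < l\<close> by simp
  then have j: "0 < j" "j \<le> pi / 4" unfolding j_def by (simp_all only: min_less_iff_conj min.cobounded2) simp
  have I_bound: "1 + m\<^sup>2 \<le> l" if "m \<in> I" for m
  proof -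
    have "\<bar>m\<bar> \<le> \<bar>m0\<bar> + d" using that by (auto simp: I_def)
    then have "\<bar>m\<bar>\<^sup>2 \<le> (\<bar>m0\<bar> + d)\<^sup>2" by (rule power_mono) simp
    then show ?thesis by (simp add: l_def)
  qed
  have b_meas [measurable]: "b \<in> borel_measurable borel"
    unfolding b_def I_def by measurable
  have total: "(\<integral>\<^sup>+ m. ennreal (b m / (1 + m\<^sup>2)) \<partial>lborel) \<le> ennreal (pi / 2 - j)"
  proof -
    have "(\<integral>\<^sup>+ m. ennreal (b m / (1 + m\<^sup>2)) \<partial>lborel) + ennreal ((1 / 2 - b1) / l * (2 * d))
        = (\<integral>\<^sup>+ m. ennreal (b m / (1 + m\<^sup>2)) \<partial>lborel) + (\<integral>\<^sup>+ m. ennreal ((1 / 2 - b1) / l) * indicator I m \<partial>lborel)"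
    proof -
      have "emeasure lborel I = ennreal (2 * d)" using pos by (simp add: I_def)
      then have "(\<integral>\<^sup>+ m. ennreal ((1 / 2 - b1) / l) * indicator I m \<partial>lborel)
          = ennreal ((1 / 2 - b1) / l) * ennreal (2 * d)"
        by (subst nn_integral_cmult_indicator) (auto simp: I_def)
      also have "\<dots> = ennreal ((1 / 2 - b1) / l * (2 * d))"
        using b1 \<open>0 < l\<close> pos by (intro ennreal_mult[symmetric]) auto
      finally show ?thesis by simp
    qed
    also have "\<dots> = (\<integral>\<^sup>+ m. ennreal (b m / (1 + m\<^sup>2)) + ennreal ((1 / 2 - b1) / l) * indicator I m \<partial>lborel)"
      by (subst nn_integral_add) (auto simp: I_def)
    also have "\<dots> \<le> (\<integral>\<^sup>+ m. ennreal ((1 / 2) / (1 + m\<^sup>2)) \<partial>lborel)"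
    proof (rule nn_integral_mono)
      fix m
      show "ennreal (b m / (1 + m\<^sup>2)) + ennreal ((1 / 2 - b1) / l) * indicator I m
          \<le> ennreal ((1 / 2) / (1 + m\<^sup>2))"
      proof (cases "m \<in> I")
        case True
        have "(1 / 2 - b1) / l \<le> (1 / 2 - b1) / (1 + m\<^sup>2)"
          using b1 \<open>0 < l\<close> I_bound[OF True] by (intro divide_left_mono) (auto simp: add_pos_nonneg)
        then have "b m / (1 + m\<^sup>2) + (1 / 2 - b1) / l \<le> (1 / 2) / (1 + m\<^sup>2)"
          using True by (simp add: b_def diff_divide_distrib)
        moreover have "ennreal (b m / (1 + m\<^sup>2)) + ennreal ((1 / 2 - b1) / l)
            = ennreal (b m / (1 + m\<^sup>2) + (1 / 2 - b1) / l)"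
          using b1 \<open>0 < l\<close> True by (intro ennreal_plus[symmetric]) (auto simp: b_def)
        ultimately show ?thesis using True by (simp add: ennreal_leI)
      qed (simp add: b_def)
    qed
    also have "\<dots> = ennreal (pi / 2)" by (subst nn_integral_slope_const) auto
    finally have sum: "(\<integral>\<^sup>+ m. ennreal (b m / (1 + m\<^sup>2)) \<partial>lborel) + ennreal ((1 / 2 - b1) / l * (2 * d))
        \<le> ennreal (pi / 2)" .
    have "ennreal j \<le> ennreal ((1 / 2 - b1) / l * (2 * d))"
      by (intro ennreal_leI) (simp add: j_def)
    then have "(\<integral>\<^sup>+ m. ennreal (b m / (1 + m\<^sup>2)) \<partial>lborel) + ennreal j \<le> ennreal (pi / 2)"
      using sum by (meson add_left_mono order_trans)
    then show ?thesis
      using j by (cases "\<integral>\<^sup>+ m. ennreal (b m / (1 + m\<^sup>2)) \<partial>lborel")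
        (auto simp: ennreal_plus[symmetric] top_unique simp del: ennreal_plus)
  qed
  have W: "admissible (\<lambda>p. if T p \<in> E then pi / 2 - j else pi / 2)"
  proof (rule admissible_target)
    fix G :: "space3 \<Rightarrow> ennreal" assume "G \<in> borel_measurable borel"
    then show "(\<integral>\<^sup>+ p. G (T p) * indicator (T -` E) p \<partial>lborel)
        \<le> ennreal (pi / 2 - j) * (\<integral>\<^sup>+ x. G x \<partial>lborel)"
    proof (rule pushforward_bound[where b = "\<lambda>_. b"])
      fix c :: plane and x m :: real
      define u where "u = x *\<^sub>R vec2 1 m"
      have u: "u = vec2 x (m * x)" by (simp add: u_def mult.commute)
      assume "(c + x *\<^sub>R vec2 1 m, c - x *\<^sub>R vec2 1 m) \<in> T -` E"
      then have "T (c + u, c - u) \<in> E" by (simp only: u_def vimage_eq)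
      moreover have "T (c + u, c - u) = (2 *\<^sub>R c, q c u)"
        using T_midpoint[of "2 *\<^sub>R c" u] by simp
      ultimately have cu: "norm (c - y0) < r" "q c u < 2 * \<psi> c + 2 * r\<^sup>2"
        by (auto simp: E_def)
      have "(norm u)\<^sup>2 < r\<^sup>2" using cu(2) q_ge[of c u] by linarith
      then have ur: "norm u < r" using pos by (simp add: power_less_imp_less_base)
      show "2 * (norm (x *\<^sub>R vec2 1 m))\<^sup>2 \<le> b m * radial c (x *\<^sub>R vec2 1 m)"
        unfolding u_def[symmetric]
      proof (cases "m \<in> I")
        case True
        then have "\<eta> * x\<^sup>2 \<le> (grad \<phi> (c + u) - grad \<phi> (c - u)) \<bullet> u"
          using gain[of c x m] cu ur unfolding u by (auto simp: I_def abs_less_iff)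
        moreover have "\<eta> / l * (norm u)\<^sup>2 \<le> \<eta> * x\<^sup>2"
        proof -
          have "(norm u)\<^sup>2 = x\<^sup>2 * (1 + m\<^sup>2)"
            by (simp add: u norm_plane power_mult_distrib algebra_simps)
          also have "\<dots> \<le> x\<^sup>2 * l" by (intro mult_left_mono I_bound[OF True]) simp
          finally have "\<eta> / l * (norm u)\<^sup>2 \<le> \<eta> / l * (x\<^sup>2 * l)"
            using den by (intro mult_left_mono) auto
          then show ?thesis using \<open>0 < l\<close> by simp
        qed
        ultimately have "(4 + \<eta> / l) * (norm u)\<^sup>2 \<le> radial c u"
          by (simp add: radial_def distrib_right)
        then have "b1 * ((4 + \<eta> / l) * (norm u)\<^sup>2) \<le> b1 * radial c u"
          using b1 by (intro mult_left_mono) auto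
        then show "2 * (norm u)\<^sup>2 \<le> b m * radial c u"
          using True unfolding mult.assoc[symmetric] b1(3) by (simp add: b_def)
      next
        case False
        then show "2 * (norm u)\<^sup>2 \<le> b m * radial c u"
          using radial_ge_norm[of u c] by (simp add: b_def)
      qed
    qed (use b1 total in \<open>auto simp: b_def\<close>)
  qed (use j pi_gt_zero in \<open>auto simp: field_simps\<close>)
  have "T (y0, y0) \<in> E"
    using pos by (simp add: T_def E_def flip: scaleR_2)
  moreover have "open (T -` E)"
    using \<open>open E\<close> continuous_on_T by (simp add: open_vimage)
  ultimately obtain e where "0 < e" and e: "ball (y0, y0) e \<subseteq> T -` E"
    by (metis openE vimageI2)
  show thesis
  proof (rule that[OF \<open>0 < j\<close> _ W, of "e / 2"])
    have "T p \<in> E" if "p \<in> ball y0 (e / 2) \<times> ball y0 (e / 2)" for p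
    proof -
      have "dist (y0, y0) p \<le> dist y0 (fst p) + dist y0 (snd p)"
        unfolding dist_prod_def by (simp add: sqrt_sum_squares_le_sum)
      also have "\<dots> < e" using that by (auto simp: mem_Times_iff)
      finally have "p \<in> ball (y0, y0) e" by simp
      with e show ?thesis by blast
    qed
    then show "(if T p \<in> E then pi / 2 - j else pi / 2) + j * indicator (ball y0 (e / 2) \<times> ball y0 (e / 2)) p \<le> pi / 2" for p
      using j by (cases "p \<in> ball y0 (e / 2) \<times> ball y0 (e / 2)") auto
  qed (use \<open>0 < e\<close> in auto)
qed

text \<open>From the far midpoint the disc of radius \<rho> is seen in few directions, so these
  pairs push forward with total at most \<open>e\<^sup>2\<close>. They are not a full preimage under
  \<open>T\<close>, already because \<open>T\<close> is symmetric in the two points. Hence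
  \<open>admissible_source\<close>: a small weight on them, paid for by the factor
  \<open>1 + e\<close> elsewhere.\<close>

lemma weight_far:
  assumes "0 \<le> \<rho>" "0 < \<eta>"
  obtains R W where "admissible W"
    "\<And>p. W p + 1 / 2 * indicator {p. norm (fst p) \<le> \<rho> \<and> R \<le> norm (snd p)} p \<le> pi / 2 + \<eta>"
proof -
  \<comment> \<open>The bound 1/4 leaves room for the gap 1/2 under \<pi>/2; the bound
    \<open>\<eta> / 2\<close> together with \<pi> < 4 keeps the raise elsewhere at most
    \<eta>.\<close>
  define e where "e = min (1 / 4) (\<eta> / 2)"
  have e: "0 < e" "e \<le> 1 / 4" "e \<le> \<eta> / 2" using assms by (auto simp: e_def)
  obtain L where "0 < L" and L: "\<And>c :: plane. L \<le> norm c \<Longrightarrow>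
      (\<integral>\<^sup>+ m. ennreal (indicator {m. \<bar>c $ 2 - m * c $ 1\<bar> \<le> \<rho> * sqrt (1 + m\<^sup>2)} m / 2 / (1 + m\<^sup>2)) \<partial>lborel)
        \<le> ennreal (e\<^sup>2)"
    using small_angle[of "e\<^sup>2" \<rho>] e assms by auto
  define S where "S = {p :: plane \<times> plane. norm (fst p) \<le> \<rho> \<and> 2 * L + \<rho> \<le> norm (snd p)}"
  have "closed S"
    unfolding S_def by (intro closed_Collect_conj closed_Collect_le continuous_intros)
  then have [measurable]: "S \<in> sets borel" by simp
  \<comment> \<open>No pair of \<open>S\<close> has its midpoint within \<open>L\<close> of the
    origin. For other midpoints the weight is 1/2 on the slopes whose line through \<open>c\<close>
    meets the disc of radius \<rho>, and 0 on the rest.\<close>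
  define b where "b c m = (if L \<le> norm c
      then indicator {m. \<bar>c $ 2 - m * c $ 1\<bar> \<le> \<rho> * sqrt (1 + m\<^sup>2)} m / 2 else 0 :: real)"
    for c :: plane and m :: real
  have "admissible (\<lambda>p. if p \<in> S then e * (1 + e) else pi / 2 * (1 + e))"
  proof (rule admissible_source[where \<kappa> = "e\<^sup>2"])
    fix G :: "space3 \<Rightarrow> ennreal" assume "G \<in> borel_measurable borel"
    then show "(\<integral>\<^sup>+ p. G (T p) * indicator S p \<partial>lborel) \<le> ennreal (e\<^sup>2) * (\<integral>\<^sup>+ x. G x \<partial>lborel)"
    proof (rule pushforward_bound[where b = b])
      fix c :: plane and x m :: real
      define u where "u = x *\<^sub>R vec2 1 m"
      assume "(c + x *\<^sub>R vec2 1 m, c - x *\<^sub>R vec2 1 m) \<in> S"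
      then have S: "norm (c + u) \<le> \<rho>" "2 * L + \<rho> \<le> norm (c - u)" by (auto simp: S_def u_def)
      have "2 *\<^sub>R c - (c + u) = c - u" by (simp add: scaleR_2)
      then have "norm (c - u) \<le> 2 * norm c + norm (c + u)"
        by (metis norm_triangle_ineq4 norm_scaleR abs_numeral)
      then have "L \<le> norm c" using S by simp
      moreover have "\<bar>c $ 2 - m * c $ 1\<bar> \<le> \<rho> * sqrt (1 + m\<^sup>2)"
        using cross_le_of_near_line S(1) unfolding u_def .
      ultimately have half: "b c m = 1 / 2" by (simp add: b_def)
      show "2 * (norm (x *\<^sub>R vec2 1 m))\<^sup>2 \<le> b c m * radial c (x *\<^sub>R vec2 1 m)"
        unfolding half using radial_ge_norm[of "x *\<^sub>R vec2 1 m" c] by linarith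
    next
      show "b c \<in> borel_measurable borel" for c
        unfolding b_def by measurable
      show "(\<integral>\<^sup>+ m. ennreal (b c m / (1 + m\<^sup>2)) \<partial>lborel) \<le> ennreal (e\<^sup>2)" for c
        using L[of c] by (cases "L \<le> norm c") (simp_all add: b_def)
    qed (auto simp: b_def)
  next
    \<comment> \<open>The two shares are \<open>1 / (1 + e)\<close> and \<open>e / (1 + e)\<close>,
      so the budget is spent exactly.\<close>
    show "pi / 2 / (pi / 2 * (1 + e)) + e\<^sup>2 / (e * (1 + e)) \<le> 1"
    proof -
      have "pi / 2 / (pi / 2 * (1 + e)) = 1 / (1 + e)" by simp
      moreover have "e\<^sup>2 / (e * (1 + e)) = e / (1 + e)"
        using e by (simp add: power2_eq_square)
      ultimately show ?thesis using e by (simp add: add_divide_distrib[symmetric])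
    qed
  qed (use e in auto)
  then show thesis
  proof (rule that[where R = "2 * L + \<rho>"])
    fix p :: "plane \<times> plane"
    have "pi * e \<le> 4 * (\<eta> / 2)"
      using pi_less_4 e by (intro mult_mono) auto
    then have A: "pi / 2 * (1 + e) \<le> pi / 2 + \<eta>" by (simp add: algebra_simps)
    have "e * (1 + e) \<le> 1 / 4 * (1 + 1 / 4)" using e by (intro mult_mono) auto
    also have "\<dots> \<le> (pi / 2 + \<eta>) - 1 / 2" using pi_gt3 assms by simp
    finally have B: "e * (1 + e) + 1 / 2 \<le> pi / 2 + \<eta>" by (simp only: le_diff_eq)
    have "{p. norm (fst p) \<le> \<rho> \<and> 2 * L + \<rho> \<le> norm (snd p)} = S" by (simp add: S_def)
    then show "(if p \<in> S then e * (1 + e) else pi / 2 * (1 + e))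
        + 1 / 2 * indicator {p. norm (fst p) \<le> \<rho> \<and> 2 * L + \<rho> \<le> norm (snd p)} p \<le> pi / 2 + \<eta>"
      using A B by (simp split: split_indicator)
  qed
qed

end

subsection \<open>The convolution density\<close>

lemma ennreal_sqrt_power2 [simp]: "(ennreal_sqrt x)\<^sup>2 = x"
  by (cases x) (auto simp: ennreal_sqrt_def ennreal_power)

lemma ennreal_sqrt_less_top_iff [simp]: "ennreal_sqrt x < top \<longleftrightarrow> x < top"
  by (cases x) (auto simp: ennreal_sqrt_def)

lemma L2_norm_power2: "(L2_norm f)\<^sup>2 = (\<integral>\<^sup>+ x. ennreal ((cmod (f x))\<^sup>2) \<partial>lborel)"
  by (simp add: L2_norm_def)

lemma L2_iff: "f \<in> L2 \<longleftrightarrow> f \<in> borel_measurable borel \<and> (\<integral>\<^sup>+ x. ennreal ((cmod (f x))\<^sup>2) \<partial>lborel) < \<infinity>"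
  by (simp add: L2_def L2_norm_def)

lemma norm_integral_le_nn_integral:
  fixes F :: "'a \<Rightarrow> 'b::{banach, second_countable_topology}"
  shows "ennreal (norm (integral\<^sup>L M F)) \<le> (\<integral>\<^sup>+ x. ennreal (norm (F x)) \<partial>M)"
  by (cases "integrable M F") (auto simp: integral_norm_bound_ennreal not_integrable_integral_eq)

lemma fst_borel [measurable]:
  "fst \<in> borel_measurable (borel :: ('a::topological_space \<times> 'b::topological_space) measure)"
  by (intro borel_measurable_continuous_onI continuous_intros)

lemma snd_borel [measurable]:
  "snd \<in> borel_measurable (borel :: ('a::topological_space \<times> 'b::topological_space) measure)"
  by (intro borel_measurable_continuous_onI continuous_intros)

lemma cball_borel [measurable]: "cball (a :: 'a::metric_space) r \<in> sets borel"
  by simp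

lemma L2_locally_integrable:
  assumes "f \<in> L2" and [measurable]: "S \<in> sets borel" and S: "emeasure lborel S < \<infinity>"
  shows "(\<integral>\<^sup>+ x. ennreal (cmod (f x)) * indicator S x \<partial>lborel) < \<infinity>"
proof -
  have [measurable]: "f \<in> borel_measurable borel" using assms(1) by (simp add: L2_iff)
  have le: "cmod (f x) \<le> 1 + (cmod (f x))\<^sup>2" for x
    using sum_squares_ge_zero[of "cmod (f x) - 1 / 2" 0]
    by (simp add: power2_eq_square algebra_simps)
  have "(\<integral>\<^sup>+ x. ennreal (cmod (f x)) * indicator S x \<partial>lborel)
      \<le> (\<integral>\<^sup>+ x. indicator S x + ennreal ((cmod (f x))\<^sup>2) \<partial>lborel)"
  proof (rule nn_integral_mono)
    fix x
    have "ennreal (cmod (f x)) \<le> ennreal (1 + (cmod (f x))\<^sup>2)"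
      by (rule ennreal_leI[OF le])
    then show "ennreal (cmod (f x)) * indicator S x \<le> indicator S x + ennreal ((cmod (f x))\<^sup>2)"
      by (auto simp: ennreal_plus split: split_indicator)
  qed
  also have "\<dots> = emeasure lborel S + (\<integral>\<^sup>+ x. ennreal ((cmod (f x))\<^sup>2) \<partial>lborel)"
    by (subst nn_integral_add) auto
  also have "\<dots> < \<infinity>" using S assms(1) by (simp add: L2_iff)
  finally show ?thesis .
qed

section \<open>Existence of the convolution density and its dual upper bound\<close>

context convex_perturbation
begin

definition graph_map :: "plane \<Rightarrow> space3" where
  "graph_map y = (y, \<psi> y)"

lemma graph_map_measurable [measurable]: "graph_map \<in> borel_measurable borel"
  unfolding graph_map_def by measurable

lemma projection_measure_eq: "projection_measure \<phi> = distr lborel borel graph_map"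
proof -
  have "graph_map = (\<lambda>y. (y, (norm y)\<^sup>2 + \<phi> y))"
    by (simp add: fun_eq_iff graph_map_def \<psi>_def)
  then show ?thesis by (simp add: projection_measure_def)
qed

text \<open>Cylinders over discs exhaust the space, and each has the area of its disc as mass. This
  lets the product of \<sigma> with itself be written as an image of Lebesgue measure.\<close>

lemma sigma_finite_projection: "sigma_finite_measure (distr lborel borel graph_map)"
proof
  let ?A = "range (\<lambda>n. fst -` ball (0::plane) (real n) :: space3 set)"
  have sets: "fst -` ball (0::plane) r \<in> sets (borel :: space3 measure)" for r
    by (intro borel_open open_vimage_fst) simp
  show "\<exists>A. countable A \<and> A \<subseteq> sets (distr lborel borel graph_map) \<and>
      \<Union>A = space (distr lborel borel graph_map) \<and> (\<forall>a\<in>A. emeasure (distr lborel borel graph_map) a \<noteq> \<infinity>)"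
  proof (intro exI[of _ ?A] conjI ballI)
    show "\<Union>?A = space (distr lborel borel graph_map)"
      using reals_Archimedean2 by auto
    fix a assume "a \<in> ?A"
    then obtain n where a: "a = fst -` ball (0::plane) (real n)" by blast
    have "graph_map -` a = ball 0 (real n)" by (auto simp: a graph_map_def)
    then show "emeasure (distr lborel borel graph_map) a \<noteq> \<infinity>"
      using emeasure_lborel_ball_finite[of "0::plane" "real n"] sets
      by (subst emeasure_distr) (auto simp: a)
  qed (use sets in auto)
qed

lemma integral_projection_pair:
  fixes k :: "space3 \<times> space3 \<Rightarrow> complex"
  assumes [measurable]: "k \<in> borel_measurable borel"
  shows "(\<integral>p. k p \<partial>(projection_measure \<phi> \<Otimes>\<^sub>M projection_measure \<phi>))
    = (\<integral>p. k (graph_map (fst p), graph_map (snd p)) \<partial>lborel)"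
proof -
  have [measurable]: "k \<in> borel_measurable (borel \<Otimes>\<^sub>M borel)"
    using assms by (simp add: borel_prod)
  have "projection_measure \<phi> \<Otimes>\<^sub>M projection_measure \<phi>
      = distr (lborel \<Otimes>\<^sub>M lborel) (borel \<Otimes>\<^sub>M borel) (\<lambda>(x, y). (graph_map x, graph_map y))"
    unfolding projection_measure_eq by (rule pair_measure_distr) (auto intro: sigma_finite_projection)
  then have "(\<integral>p. k p \<partial>(projection_measure \<phi> \<Otimes>\<^sub>M projection_measure \<phi>))
      = (\<integral>p. k ((\<lambda>(x, y). (graph_map x, graph_map y)) p) \<partial>(lborel \<Otimes>\<^sub>M lborel))"
    by (simp only:) (rule integral_distr, measurable)
  then show ?thesis by (simp add: lborel_prod split_beta')
qed

text \<open>Pulling both factors back to the plane exhibits the convolution as the image under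
  \<open>T\<close> of the density f(y)f(z); later arguments work with this form.\<close>

lemma is_convolution_density_iff:
  assumes [measurable]: "f \<in> borel_measurable borel"
  shows "is_convolution_density (projection_measure \<phi>) f h \<longleftrightarrow>
     h \<in> borel_measurable borel \<and> (\<forall>r. set_integrable lborel (cball 0 r) h) \<and>
     (\<forall>g. g \<in> borel_measurable borel \<longrightarrow> bounded (range g) \<longrightarrow> bounded {x. g x \<noteq> 0} \<longrightarrow>
        (\<integral>x. g x * h x \<partial>lborel) = (\<integral>p. g (T p) * (f (fst p) * f (snd p)) \<partial>lborel))"
proof -
  have "(\<integral>p. g (fst p + snd p) * f (fst (fst p)) * f (fst (snd p))
      \<partial>(projection_measure \<phi> \<Otimes>\<^sub>M projection_measure \<phi>))
      = (\<integral>p. g (T p) * (f (fst p) * f (snd p)) \<partial>lborel)"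
    if [measurable]: "g \<in> borel_measurable borel" for g
  proof -
    have "(\<lambda>p. g (fst p + snd p) * f (fst (fst p)) * f (fst (snd p))) \<in> borel_measurable borel"
      by measurable
    then show ?thesis
      by (subst integral_projection_pair) (auto simp: graph_map_def T_def mult.assoc)
  qed
  then show ?thesis unfolding is_convolution_density_def by auto
qed

text \<open>The bound with constant \<pi>/2, applied to indicators of null sets, makes the image
  measure absolutely continuous, so Radon-Nikodym applies. Finite mass on balls makes the extended
  density finite almost everywhere, which gives a real representative.\<close>

lemma pushforward_density_nonneg:
  fixes v :: "plane \<times> plane \<Rightarrow> real"
  assumes [measurable]: "v \<in> borel_measurable borel" and v: "\<And>p. 0 \<le> v p"
    and fin: "\<And>r. (\<integral>\<^sup>+ p. ennreal (v p) * indicator (cball 0 r) (T p) \<partial>lborel) < \<infinity>"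
  obtains h :: "space3 \<Rightarrow> real" where "h \<in> borel_measurable borel" "\<And>x. 0 \<le> h x"
    "\<And>r. set_integrable lborel (cball 0 r) h"
    "\<And>g :: space3 \<Rightarrow> complex. g \<in> borel_measurable borel \<Longrightarrow>
      (\<integral>x. h x *\<^sub>R g x \<partial>lborel) = (\<integral>p. v p *\<^sub>R g (T p) \<partial>lborel)"
proof -
  define N where "N = distr (density lborel (\<lambda>p. ennreal (v p))) borel T"
  have N: "emeasure N B = (\<integral>\<^sup>+ p. ennreal (v p) * indicator B (T p) \<partial>lborel)"
    if [measurable]: "B \<in> sets borel" for B
  proof -
    have "T -` B \<in> sets borel" using measurable_sets[OF T_measurable that] by simp
    then show ?thesis
      unfolding N_def by (subst emeasure_distr, simp_all add: emeasure_density)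
        (auto intro!: nn_integral_cong split: split_indicator)
  qed
  have "absolutely_continuous lborel N"
    unfolding absolutely_continuous_def
  proof
    fix B :: "space3 set" assume B: "B \<in> null_sets lborel"
    then have [measurable]: "B \<in> sets borel" by auto
    have "(\<integral>\<^sup>+ p. indicator B (T p) \<partial>lborel) \<le> ennreal (pi / 2) * (\<integral>\<^sup>+ x. indicator B x \<partial>lborel)"
      by (rule pushforward_bound_half_pi) measurable
    then have "(\<integral>\<^sup>+ p. indicator B (T p) \<partial>lborel) = 0"
      using B by (simp add: null_setsD1)
    then have "AE p in lborel. indicator B (T p) = (0::ennreal)"
      by (subst (asm) nn_integral_0_iff_AE) auto
    then have "(\<integral>\<^sup>+ p. ennreal (v p) * indicator B (T p) \<partial>lborel) = 0"
      by (subst nn_integral_0_iff_AE) (auto elim!: eventually_mono)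
    then show "B \<in> null_sets N" by (simp add: null_sets_def N) (simp add: N_def)
  qed
  moreover have "sets N = sets lborel" by (simp add: N_def)
  ultimately obtain k where [measurable]: "k \<in> borel_measurable borel" and k: "density lborel k = N"
    using sigma_finite_measure.Radon_Nikodym[OF sigma_finite_lborel, of N] by auto
  define h where "h x = enn2real (k x)" for x
  have [measurable]: "h \<in> borel_measurable borel" unfolding h_def by measurable
  have kN: "(\<integral>\<^sup>+ x. k x * indicator (cball 0 r) x \<partial>lborel) < \<infinity>" for r
    using fin[of r] N[of "cball 0 r"] by (simp add: k[symmetric] emeasure_density)
  have "AE x in lborel. \<forall>n::nat. k x * indicator (cball 0 (real n)) x \<noteq> \<infinity>"
    unfolding AE_all_countable using kN by (intro allI nn_integral_PInf_AE) (auto simp: less_top)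
  then have "AE x in lborel. k x = ennreal (h x)"
  proof eventually_elim
    case (elim x)
    obtain n :: nat where "norm x \<le> real n" using real_arch_simple by blast
    with elim[rule_format, of n] have "k x \<noteq> \<infinity>" by simp
    then show ?case by (simp add: h_def less_top)
  qed
  note kh = this
  then have Nh: "N = density lborel (\<lambda>x. ennreal (h x))"
    unfolding k[symmetric] by (intro density_cong) auto
  show thesis
  proof (rule that)
    fix r :: real
    have "(\<integral>\<^sup>+ x. ennreal (norm (indicator (cball 0 r) x *\<^sub>R h x)) \<partial>lborel)
        = (\<integral>\<^sup>+ x. k x * indicator (cball 0 r) x \<partial>lborel)"
      using kh by (intro nn_integral_cong_AE) (auto elim!: eventually_mono simp: h_def split: split_indicator)
    then show "set_integrable lborel (cball 0 r) h"
      unfolding set_integrable_def using kN[of r] by (intro integrableI_bounded) auto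
  next
    fix g :: "space3 \<Rightarrow> complex" assume [measurable]: "g \<in> borel_measurable borel"
    have "(\<integral>x. h x *\<^sub>R g x \<partial>lborel) = (\<integral>x. g x \<partial>N)"
      unfolding Nh by (subst integral_density) (auto simp: h_def)
    also have "\<dots> = (\<integral>p. g (T p) \<partial>density lborel (\<lambda>p. ennreal (v p)))"
      unfolding N_def by (rule integral_distr) auto
    also have "\<dots> = (\<integral>p. v p *\<^sub>R g (T p) \<partial>lborel)"
      by (subst integral_density) (auto simp: v)
    finally show "(\<integral>x. h x *\<^sub>R g x \<partial>lborel) = (\<integral>p. v p *\<^sub>R g (T p) \<partial>lborel)" .
  qed (auto simp: h_def)
qed

text \<open>Positive and negative parts of the real and imaginary parts are treated separately and
  recombined linearly; boundedness and bounded support of the test function keep all four integrals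
  finite on both sides.\<close>

lemma pushforward_density:
  fixes w :: "plane \<times> plane \<Rightarrow> complex"
  assumes [measurable]: "w \<in> borel_measurable borel"
    and fin: "\<And>r. (\<integral>\<^sup>+ p. ennreal (norm (w p)) * indicator (cball 0 r) (T p) \<partial>lborel) < \<infinity>"
  obtains h :: "space3 \<Rightarrow> complex" where "h \<in> borel_measurable borel"
    "\<And>r. set_integrable lborel (cball 0 r) h"
    "\<And>g. g \<in> borel_measurable borel \<Longrightarrow> bounded (range g) \<Longrightarrow> bounded {x. g x \<noteq> 0} \<Longrightarrow>
      (\<integral>x. g x * h x \<partial>lborel) = (\<integral>p. g (T p) * w p \<partial>lborel)"
proof -
  define part where "part F p = max 0 (F (w p))" for F :: "complex \<Rightarrow> real" and p
  have ex: "\<exists>h :: space3 \<Rightarrow> real. h \<in> borel_measurable borel \<and> (\<forall>r. set_integrable lborel (cball 0 r) h) \<and>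
    (\<forall>g :: space3 \<Rightarrow> complex. g \<in> borel_measurable borel \<longrightarrow> bounded (range g) \<longrightarrow> bounded {x. g x \<noteq> 0} \<longrightarrow>
      integrable lborel (\<lambda>x. h x *\<^sub>R g x) \<and> integrable lborel (\<lambda>p. part F p *\<^sub>R g (T p)) \<and>
      (\<integral>x. h x *\<^sub>R g x \<partial>lborel) = (\<integral>p. part F p *\<^sub>R g (T p) \<partial>lborel))" (is "\<exists>h. ?P h")
    if F [measurable]: "F \<in> borel_measurable borel" and le: "\<And>z. \<bar>F z\<bar> \<le> norm z"
    for F :: "complex \<Rightarrow> real"
  proof -
    have [measurable]: "part F \<in> borel_measurable borel" unfolding part_def by measurable
    have part_le: "0 \<le> part F p" "part F p \<le> norm (w p)" for p
      using le[of "w p"] by (auto simp: part_def)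
    have fin': "(\<integral>\<^sup>+ p. ennreal (part F p) * indicator (cball 0 r) (T p) \<partial>lborel) < \<infinity>" for r
      by (rule le_less_trans[OF nn_integral_mono fin[of r]])
         (auto intro!: mult_right_mono ennreal_leI part_le)
    obtain h :: "space3 \<Rightarrow> real" where [measurable]: "h \<in> borel_measurable borel" and h: "\<And>x. 0 \<le> h x"
      "\<And>r. set_integrable lborel (cball 0 r) h"
      "\<And>g :: space3 \<Rightarrow> complex. g \<in> borel_measurable borel \<Longrightarrow>
        (\<integral>x. h x *\<^sub>R g x \<partial>lborel) = (\<integral>p. part F p *\<^sub>R g (T p) \<partial>lborel)"
      by (rule pushforward_density_nonneg[of "part F", OF _ part_le(1) fin']) auto
    have "?P h"
    proof (intro conjI allI impI h)
      fix g :: "space3 \<Rightarrow> complex"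
      assume [measurable]: "g \<in> borel_measurable borel"
        and bg: "bounded (range g)" and sg: "bounded {x. g x \<noteq> 0}"
      obtain C where C: "\<And>x. norm (g x) \<le> C" "0 \<le> C"
        using bg unfolding bounded_pos by (auto intro: less_imp_le)
      obtain r where r: "\<And>x. g x \<noteq> 0 \<Longrightarrow> norm x \<le> r"
        using sg unfolding bounded_pos by auto
      have "integrable lborel (\<lambda>x. C * (indicator (cball 0 r) x *\<^sub>R h x))"
        using h(2)[of r] unfolding set_integrable_def by (rule integrable_mult_right)
      then show "integrable lborel (\<lambda>x. h x *\<^sub>R g x)"
      proof (rule Bochner_Integration.integrable_bound)
        have "norm (h x *\<^sub>R g x) \<le> norm (C * (indicator (cball 0 r) x *\<^sub>R h x))" for x
          using mult_left_mono[OF C(1)[of x] h(1)[of x]] C(2) h(1)[of x] r[of x]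
          by (cases "g x = 0") (auto simp: mult.commute)
        then show "AE x in lborel. norm (h x *\<^sub>R g x) \<le> norm (C * (indicator (cball 0 r) x *\<^sub>R h x))"
          by simp
      qed measurable
      show "integrable lborel (\<lambda>p. part F p *\<^sub>R g (T p))"
      proof (rule integrableI_bounded)
        have "(\<integral>\<^sup>+ p. ennreal (norm (part F p *\<^sub>R g (T p))) \<partial>lborel)
            \<le> (\<integral>\<^sup>+ p. ennreal C * (ennreal (norm (w p)) * indicator (cball 0 r) (T p)) \<partial>lborel)"
        proof (rule nn_integral_mono)
          fix p
          have "part F p * norm (g (T p)) \<le> norm (w p) * C"
            using part_le[of p] C by (intro mult_mono) auto
          then show "ennreal (norm (part F p *\<^sub>R g (T p)))
              \<le> ennreal C * (ennreal (norm (w p)) * indicator (cball 0 r) (T p))"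
            using r[of "T p"] part_le[of p] C(2)
            by (cases "g (T p) = 0") (auto simp: ennreal_mult[symmetric] mult.commute intro!: ennreal_leI)
        qed
        also have "\<dots> = ennreal C * (\<integral>\<^sup>+ p. ennreal (norm (w p)) * indicator (cball 0 r) (T p) \<partial>lborel)"
          by (rule nn_integral_cmult) measurable
        also have "\<dots> < \<infinity>" using fin[of r] by (simp add: ennreal_mult_less_top)
        finally show "(\<integral>\<^sup>+ p. ennreal (norm (part F p *\<^sub>R g (T p))) \<partial>lborel) < \<infinity>" .
      qed measurable
    qed auto
    then show ?thesis by blast
  qed
  have norms: "\<bar>Re z\<bar> \<le> norm z" "\<bar>- Re z\<bar> \<le> norm z" "\<bar>Im z\<bar> \<le> norm z" "\<bar>- Im z\<bar> \<le> norm z" for z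
    by (simp_all add: abs_Re_le_cmod abs_Im_le_cmod)
  obtain h1 :: "space3 \<Rightarrow> real" where h1 [measurable]: "h1 \<in> borel_measurable borel"
    and i1: "\<And>r. set_integrable lborel (cball 0 r) h1"
    and g1: "\<And>g :: space3 \<Rightarrow> complex. g \<in> borel_measurable borel \<Longrightarrow> bounded (range g) \<Longrightarrow> bounded {x. g x \<noteq> 0} \<Longrightarrow>
      integrable lborel (\<lambda>x. h1 x *\<^sub>R g x) \<and> integrable lborel (\<lambda>p. part Re p *\<^sub>R g (T p)) \<and>
      (\<integral>x. h1 x *\<^sub>R g x \<partial>lborel) = (\<integral>p. part Re p *\<^sub>R g (T p) \<partial>lborel)"
    using ex[OF _ norms(1)] by auto
  obtain h2 :: "space3 \<Rightarrow> real" where h2 [measurable]: "h2 \<in> borel_measurable borel"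
    and i2: "\<And>r. set_integrable lborel (cball 0 r) h2"
    and g2: "\<And>g :: space3 \<Rightarrow> complex. g \<in> borel_measurable borel \<Longrightarrow> bounded (range g) \<Longrightarrow> bounded {x. g x \<noteq> 0} \<Longrightarrow>
      integrable lborel (\<lambda>x. h2 x *\<^sub>R g x) \<and> integrable lborel (\<lambda>p. part (\<lambda>z. - Re z) p *\<^sub>R g (T p)) \<and>
      (\<integral>x. h2 x *\<^sub>R g x \<partial>lborel) = (\<integral>p. part (\<lambda>z. - Re z) p *\<^sub>R g (T p) \<partial>lborel)"
    using ex[OF _ norms(2)] by auto
  obtain h3 :: "space3 \<Rightarrow> real" where h3 [measurable]: "h3 \<in> borel_measurable borel"
    and i3: "\<And>r. set_integrable lborel (cball 0 r) h3"
    and g3: "\<And>g :: space3 \<Rightarrow> complex. g \<in> borel_measurable borel \<Longrightarrow> bounded (range g) \<Longrightarrow> bounded {x. g x \<noteq> 0} \<Longrightarrow>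
      integrable lborel (\<lambda>x. h3 x *\<^sub>R g x) \<and> integrable lborel (\<lambda>p. part Im p *\<^sub>R g (T p)) \<and>
      (\<integral>x. h3 x *\<^sub>R g x \<partial>lborel) = (\<integral>p. part Im p *\<^sub>R g (T p) \<partial>lborel)"
    using ex[OF _ norms(3)] by auto
  obtain h4 :: "space3 \<Rightarrow> real" where h4 [measurable]: "h4 \<in> borel_measurable borel"
    and i4: "\<And>r. set_integrable lborel (cball 0 r) h4"
    and g4: "\<And>g :: space3 \<Rightarrow> complex. g \<in> borel_measurable borel \<Longrightarrow> bounded (range g) \<Longrightarrow> bounded {x. g x \<noteq> 0} \<Longrightarrow>
      integrable lborel (\<lambda>x. h4 x *\<^sub>R g x) \<and> integrable lborel (\<lambda>p. part (\<lambda>z. - Im z) p *\<^sub>R g (T p)) \<and>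
      (\<integral>x. h4 x *\<^sub>R g x \<partial>lborel) = (\<integral>p. part (\<lambda>z. - Im z) p *\<^sub>R g (T p) \<partial>lborel)"
    using ex[OF _ norms(4)] by auto
  define h where "h x = complex_of_real (h1 x) - complex_of_real (h2 x)
    + \<i> * (complex_of_real (h3 x) - complex_of_real (h4 x))" for x
  show thesis
  proof (rule that)
    show "h \<in> borel_measurable borel" unfolding h_def by measurable
    have of_real: "set_integrable lborel (cball 0 r) (\<lambda>x. complex_of_real (k x))"
      if "set_integrable lborel (cball 0 r) k" for k :: "space3 \<Rightarrow> real" and r
      using integrable_of_real[OF that[unfolded set_integrable_def], where ?'a = complex]
      unfolding set_integrable_def by (simp add: scaleR_conv_of_real)
    show "set_integrable lborel (cball 0 r) h" for r
      unfolding h_def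
      by (intro set_integral_add(1) set_integral_diff(1) set_integrable_mult_right of_real i1 i2 i3 i4)
    fix g :: "space3 \<Rightarrow> complex"
    assume g: "g \<in> borel_measurable borel" "bounded (range g)" "bounded {x. g x \<noteq> 0}"
    note G = g1[OF g] g2[OF g] g3[OF g] g4[OF g]
    have "(\<integral>x. g x * h x \<partial>lborel) = (\<integral>x. (h1 x *\<^sub>R g x - h2 x *\<^sub>R g x)
        + \<i> * (h3 x *\<^sub>R g x - h4 x *\<^sub>R g x) \<partial>lborel)"
      by (intro Bochner_Integration.integral_cong) (auto simp: h_def scaleR_conv_of_real algebra_simps)
    also have "\<dots> = ((\<integral>x. h1 x *\<^sub>R g x \<partial>lborel) - (\<integral>x. h2 x *\<^sub>R g x \<partial>lborel))
        + \<i> * ((\<integral>x. h3 x *\<^sub>R g x \<partial>lborel) - (\<integral>x. h4 x *\<^sub>R g x \<partial>lborel))"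
      using G by simp
    also have "\<dots> = ((\<integral>p. part Re p *\<^sub>R g (T p) \<partial>lborel) - (\<integral>p. part (\<lambda>z. - Re z) p *\<^sub>R g (T p) \<partial>lborel))
        + \<i> * ((\<integral>p. part Im p *\<^sub>R g (T p) \<partial>lborel) - (\<integral>p. part (\<lambda>z. - Im z) p *\<^sub>R g (T p) \<partial>lborel))"
      using G by simp
    also have "\<dots> = (\<integral>p. (part Re p *\<^sub>R g (T p) - part (\<lambda>z. - Re z) p *\<^sub>R g (T p))
        + \<i> * (part Im p *\<^sub>R g (T p) - part (\<lambda>z. - Im z) p *\<^sub>R g (T p)) \<partial>lborel)"
      using G by simp
    also have "\<dots> = (\<integral>p. g (T p) * w p \<partial>lborel)"
    proof (intro Bochner_Integration.integral_cong refl)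
      fix p
      have w: "w p = complex_of_real (part Re p - part (\<lambda>z. - Re z) p)
          + \<i> * complex_of_real (part Im p - part (\<lambda>z. - Im z) p)"
        by (simp add: complex_eq_iff part_def max_def)
      show "(part Re p *\<^sub>R g (T p) - part (\<lambda>z. - Re z) p *\<^sub>R g (T p))
        + \<i> * (part Im p *\<^sub>R g (T p) - part (\<lambda>z. - Im z) p *\<^sub>R g (T p)) = g (T p) * w p"
        by (subst w) (simp add: scaleR_conv_of_real algebra_simps)
    qed
    finally show "(\<integral>x. g x * h x \<partial>lborel) = (\<integral>p. g (T p) * w p \<partial>lborel)" .
  qed
qed

text \<open>If \<open>norm (T p) \<le> r\<close>, the two nonnegative heights are at most
  \<open>r\<close>, and so are the squared norms below them: preimages of balls lie in bounded sets,
  on which \<open>f\<close> is integrable. Thus the choice in \<open>convolution_density\<close> has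
  a witness.\<close>

lemma is_convolution_density_convolution_density:
  assumes "f \<in> L2"
  shows "is_convolution_density (projection_measure \<phi>) f (convolution_density (projection_measure \<phi>) f)"
proof -
  have f [measurable]: "f \<in> borel_measurable borel" using assms by (simp add: L2_iff)
  have "(\<integral>\<^sup>+ p. ennreal (norm (f (fst p) * f (snd p))) * indicator (cball 0 r) (T p) \<partial>lborel) < \<infinity>" for r
  proof -
    define I where "I y = ennreal (cmod (f y)) * indicator (cball 0 (sqrt r)) y" for y
    have [measurable]: "I \<in> borel_measurable borel" unfolding I_def by measurable
    have "(\<integral>\<^sup>+ p. ennreal (norm (f (fst p) * f (snd p))) * indicator (cball 0 r) (T p) \<partial>lborel)
        \<le> (\<integral>\<^sup>+ p. I (fst p) * I (snd p) \<partial>lborel)"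
    proof (rule nn_integral_mono)
      fix p :: "plane \<times> plane"
      have "fst p \<in> cball 0 (sqrt r) \<and> snd p \<in> cball 0 (sqrt r)" if "T p \<in> cball 0 r"
      proof -
        have "\<psi> (fst p) + \<psi> (snd p) \<le> norm (T p)"
          using norm_snd_le[of "snd (T p)" "fst (T p)"] by (simp add: T_def)
        then have "(norm (fst p))\<^sup>2 \<le> r" "(norm (snd p))\<^sup>2 \<le> r"
          using that norm_le_psi[of "fst p"] norm_le_psi[of "snd p"] psi_nonneg[of "fst p"] psi_nonneg[of "snd p"]
          by auto
        then show ?thesis by (auto intro: real_le_rsqrt)
      qed
      then show "ennreal (norm (f (fst p) * f (snd p))) * indicator (cball 0 r) (T p)
          \<le> I (fst p) * I (snd p)"
        by (cases "T p \<in> cball 0 r") (auto simp: I_def norm_mult ennreal_mult)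
    qed
    also have "\<dots> = (\<integral>\<^sup>+ y. I y \<partial>lborel) * (\<integral>\<^sup>+ y. I y \<partial>lborel)"
      by (subst nn_integral_lborel_pair) (auto simp: nn_integral_cmult nn_integral_multc)
    also have "\<dots> < \<infinity>"
      using L2_locally_integrable[OF assms, of "cball 0 (sqrt r)"] emeasure_lborel_cball_finite[of "0::plane" "sqrt r"]
      by (simp add: I_def[abs_def] ennreal_mult_less_top)
    finally show ?thesis .
  qed
  then obtain h where "is_convolution_density (projection_measure \<phi>) f h"
    unfolding is_convolution_density_iff[OF f]
    by (rule pushforward_density[of "\<lambda>p. f (fst p) * f (snd p)", rotated]) auto
  then show ?thesis
    unfolding convolution_density_def
    by (rule someI[of "is_convolution_density (projection_measure \<phi>) f"])
qed

text \<open>The density is tested against its own conjugate, truncated to where value and argument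
  are bounded. The inequality \<open>a * b \<le> a\<^sup>2 / (2 * W) + W * b\<^sup>2 / 2\<close>
  splits the pairing; admissibility returns the first half as at most \<open>I n / 2\<close>, which
  is absorbed on the left.\<close>

lemma convolution_density_bound:
  assumes h: "is_convolution_density (projection_measure \<phi>) f h"
    and [measurable]: "f \<in> borel_measurable borel" and W: "admissible W"
  shows "(\<integral>\<^sup>+ x. ennreal ((cmod (h x))\<^sup>2) \<partial>lborel)
    \<le> (\<integral>\<^sup>+ p. ennreal (W p * ((cmod (f (fst p)))\<^sup>2 * (cmod (f (snd p)))\<^sup>2)) \<partial>lborel)" (is "_ \<le> ?V")
proof -
  have [measurable]: "h \<in> borel_measurable borel"
    using h by (simp add: is_convolution_density_iff)
  have [measurable]: "W \<in> borel_measurable borel" and Wpos: "\<And>p. 0 < W p"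
    using W by (auto simp: admissible_def)
  define S where "S n = {x. cmod (h x) \<le> real n \<and> norm x \<le> real n}" for n :: nat
  have [measurable]: "S n \<in> sets borel" for n unfolding S_def by measurable
  define I where "I n = (\<integral>\<^sup>+ x. ennreal ((cmod (h x))\<^sup>2) * indicator (S n) x \<partial>lborel)" for n
  have bound: "I n \<le> ?V" for n
  proof -
    define g where "g x = (indicator (S n) x :: real) *\<^sub>R cnj (h x)" for x
    have [measurable]: "cnj \<in> borel_measurable borel"
      by (intro borel_measurable_continuous_onI continuous_intros)
    have [measurable]: "g \<in> borel_measurable borel" unfolding g_def by measurable
    have "I n \<le> (\<integral>\<^sup>+ x. ennreal ((real n)\<^sup>2) * indicator (cball (0::space3) (real n)) x \<partial>lborel)"
      unfolding I_def by (intro nn_integral_mono)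
        (auto simp: S_def intro!: ennreal_leI power_mono split: split_indicator)
    also have "\<dots> = ennreal ((real n)\<^sup>2) * emeasure lborel (cball (0::space3) (real n))"
      by (rule nn_integral_cmult_indicator) auto
    also have "\<dots> < \<infinity>"
      using emeasure_lborel_cball_finite[of "0::space3" "real n"] by (simp add: ennreal_mult_less_top)
    finally have I_fin: "I n < \<infinity>" .
    have gI: "(\<integral>\<^sup>+ x. ennreal ((cmod (g x))\<^sup>2) \<partial>lborel) = I n"
      unfolding I_def g_def by (intro nn_integral_cong) (auto simp: norm_mult split: split_indicator)
    have gh: "g x * h x = complex_of_real ((cmod (h x))\<^sup>2 * indicator (S n) x)" for x
      using complex_norm_square[of "h x"] by (simp add: g_def mult.commute split: split_indicator)
    have "norm (g x) \<le> real n" "g x \<noteq> 0 \<Longrightarrow> norm x \<le> real n" for x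
      by (auto simp: g_def S_def norm_mult split: split_indicator_asm split_indicator)
    then have "bounded (range g)" "bounded {x. g x \<noteq> 0}"
      unfolding bounded_iff by blast+
    then have eq: "(\<integral>x. g x * h x \<partial>lborel) = (\<integral>p. g (T p) * (f (fst p) * f (snd p)) \<partial>lborel)"
      using h by (simp add: is_convolution_density_iff)
    have "(\<integral>x. (cmod (h x))\<^sup>2 * indicator (S n) x \<partial>lborel) = enn2real (I n)"
      unfolding I_def by (subst integral_eq_nn_integral)
        (auto intro!: arg_cong[where f = enn2real] nn_integral_cong simp: ennreal_mult' split: split_indicator)
    then have "(\<integral>x. g x * h x \<partial>lborel) = complex_of_real (enn2real (I n))"
      unfolding gh by (simp only: integral_complex_of_real)
    then have "I n = ennreal (norm (\<integral>p. g (T p) * (f (fst p) * f (snd p)) \<partial>lborel))"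
      using I_fin by (simp add: eq[symmetric])
    also have "\<dots> \<le> (\<integral>\<^sup>+ p. ennreal (norm (g (T p) * (f (fst p) * f (snd p)))) \<partial>lborel)"
      by (rule norm_integral_le_nn_integral)
    also have "\<dots> \<le> (\<integral>\<^sup>+ p. ennreal (1 / 2) * (ennreal ((cmod (g (T p)))\<^sup>2) * ennreal (1 / W p))
        + ennreal (1 / 2) * ennreal (W p * ((cmod (f (fst p)))\<^sup>2 * (cmod (f (snd p)))\<^sup>2)) \<partial>lborel)"
    proof (rule nn_integral_mono)
      fix p
      define a b where "a = cmod (g (T p))" and "b = cmod (f (fst p)) * cmod (f (snd p))"
      have "0 \<le> (a - W p * b)\<^sup>2 / W p" using Wpos[of p] by simp
      also have "\<dots> = a\<^sup>2 * (1 / W p) - 2 * (a * b) + W p * b\<^sup>2"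
        using Wpos[of p] by (simp add: field_simps power2_eq_square)
      finally have "a * b \<le> 1 / 2 * (a\<^sup>2 * (1 / W p)) + 1 / 2 * (W p * b\<^sup>2)" by simp
      then have "ennreal (a * b) \<le> ennreal (1 / 2 * (a\<^sup>2 * (1 / W p)) + 1 / 2 * (W p * b\<^sup>2))"
        by (rule ennreal_leI)
      also have "\<dots> = ennreal (1 / 2) * (ennreal (a\<^sup>2) * ennreal (1 / W p)) + ennreal (1 / 2) * ennreal (W p * b\<^sup>2)"
        using less_imp_le[OF Wpos[of p]]
        by (simp add: ennreal_mult[symmetric] ennreal_plus[symmetric] del: ennreal_half ennreal_plus)
      finally show "ennreal (norm (g (T p) * (f (fst p) * f (snd p))))
          \<le> ennreal (1 / 2) * (ennreal ((cmod (g (T p)))\<^sup>2) * ennreal (1 / W p))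
        + ennreal (1 / 2) * ennreal (W p * ((cmod (f (fst p)))\<^sup>2 * (cmod (f (snd p)))\<^sup>2))"
        by (simp only: a_def b_def norm_mult power_mult_distrib)
    qed
    also have "\<dots> = ennreal (1 / 2) * (\<integral>\<^sup>+ p. ennreal ((cmod (g (T p)))\<^sup>2) * ennreal (1 / W p) \<partial>lborel)
        + ennreal (1 / 2) * ?V"
      by (subst nn_integral_add) (auto simp: nn_integral_cmult)
    also have "\<dots> \<le> ennreal (1 / 2) * I n + ennreal (1 / 2) * ?V"
    proof -
      have "(\<integral>\<^sup>+ p. ennreal ((cmod (g (T p)))\<^sup>2) * ennreal (1 / W p) \<partial>lborel)
          \<le> (\<integral>\<^sup>+ x. ennreal ((cmod (g x))\<^sup>2) \<partial>lborel)"
        by (rule W[unfolded admissible_def, THEN conjunct2, THEN conjunct2, rule_format]) measurable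
      then show ?thesis unfolding gI by (intro add_right_mono mult_left_mono) auto
    qed
    finally have le: "I n \<le> ennreal (1 / 2) * I n + ennreal (1 / 2) * ?V" .
    \<comment> \<open>Absorbing \<open>I n / 2\<close> is legitimate because the truncation made
      \<open>I n\<close> finite.\<close>
    show ?thesis
    proof (cases "?V = \<infinity>")
      case False
      then obtain V' where V': "?V = ennreal V'" "0 \<le> V'" by (cases ?V) auto
      obtain I' where I': "I n = ennreal I'" "0 \<le> I'"
        using I_fin by (cases "I n") auto
      have "ennreal (1 / 2) * ennreal I' + ennreal (1 / 2) * ennreal V' = ennreal (1 / 2 * I' + 1 / 2 * V')"
        using ennreal_mult[of "1 / 2" I'] ennreal_mult[of "1 / 2" V'] I'(2) V'(2) by simp
      with le have "ennreal I' \<le> ennreal (1 / 2 * I' + 1 / 2 * V')"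
        unfolding I'(1) V'(1) by simp
      then have "I' \<le> 1 / 2 * I' + 1 / 2 * V'"
        using I'(2) V'(2) by (subst (asm) ennreal_le_iff) auto
      then show ?thesis unfolding I'(1) V'(1) by (intro ennreal_leI) simp
    qed simp
  qed
  have "(SUP n. ennreal ((cmod (h x))\<^sup>2) * indicator (S n) x) = ennreal ((cmod (h x))\<^sup>2)" for x
  proof (rule antisym)
    obtain n :: nat where "max (cmod (h x)) (norm x) \<le> real n" using real_arch_simple by blast
    then have "x \<in> S n" by (simp add: S_def)
    then show "ennreal ((cmod (h x))\<^sup>2) \<le> (SUP n. ennreal ((cmod (h x))\<^sup>2) * indicator (S n) x)"
      by (intro SUP_upper2[of n]) auto
  qed (auto intro!: SUP_least split: split_indicator)
  then have "(\<integral>\<^sup>+ x. ennreal ((cmod (h x))\<^sup>2) \<partial>lborel)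
      = (\<integral>\<^sup>+ x. (SUP n. ennreal ((cmod (h x))\<^sup>2) * indicator (S n) x) \<partial>lborel)"
    by simp
  also have "\<dots> = (SUP n. I n)"
    unfolding I_def
  proof (rule nn_integral_monotone_convergence_SUP)
    have "indicator (S m) x \<le> (indicator (S n) x :: ennreal)" if "m \<le> n" for m n x
    proof -
      have "S m \<subseteq> S n" using that by (auto simp: S_def)
      then show ?thesis by (auto split: split_indicator)
    qed
    then show "incseq (\<lambda>n x. ennreal ((cmod (h x))\<^sup>2) * indicator (S n) x)"
      by (intro monoI le_funI mult_left_mono) auto
  qed measurable
  also have "\<dots> \<le> ?V" by (rule SUP_least[OF bound])
  finally show ?thesis .
qed

end

subsection \<open>Lower bound for the optimal constant\<close>

lemma nn_integral_exp_Icc: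
  assumes "0 < a" "0 \<le> s"
  shows "(\<integral>\<^sup>+ t. ennreal (exp (- a * t)) * indicator {0..s} t \<partial>lborel) = ennreal ((1 - exp (- a * s)) / a)"
proof -
  have "(\<integral>\<^sup>+ t. ennreal (exp (- a * t)) * indicator {0..s} t \<partial>lborel)
      = ennreal (- exp (- a * s) / a - (- exp (- a * 0) / a))"
    using assms by (intro nn_integral_FTC_Icc) (auto intro!: derivative_eq_intros)
  also have "- exp (- a * s) / a - (- exp (- a * 0) / a) = (1 - exp (- a * s)) / a"
    by (simp add: diff_divide_distrib)
  finally show ?thesis .
qed

lemma nn_integral_exp_atLeast:
  assumes "0 < a"
  shows "(\<integral>\<^sup>+ t. ennreal (exp (- a * (t - c))) * indicator {s..} t \<partial>lborel) = ennreal (exp (- a * (s - c)) / a)"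
proof -
  have "filterlim (\<lambda>t. t - c) at_top at_top"
    using filterlim_tendsto_add_at_top[OF tendsto_const[of "- c"] filterlim_ident] by simp
  then have "filterlim (\<lambda>t. - a * (t - c)) at_bot at_top"
    using assms by (intro filterlim_tendsto_neg_mult_at_bot[OF tendsto_const]) auto
  then have "((\<lambda>t. exp (- a * (t - c))) \<longlongrightarrow> 0) at_top"
    by (rule filterlim_compose[OF exp_at_bot])
  then have "((\<lambda>t. - exp (- a * (t - c)) / a) \<longlongrightarrow> - 0 / a) at_top"
    using assms by (intro tendsto_intros) auto
  then have "(\<integral>\<^sup>+ t. ennreal (exp (- a * (t - c))) * indicator {s..} t \<partial>lborel)
      = ennreal (0 - (- exp (- a * (s - c)) / a))"
    using assms by (intro nn_integral_FTC_atLeast) (auto intro!: derivative_eq_intros)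
  then show ?thesis by simp
qed

lemma nn_integral_gaussian_plane:
  assumes "0 < a"
  shows "(\<integral>\<^sup>+ u. ennreal (exp (- a * (norm (u - c :: plane))\<^sup>2)) \<partial>lborel) = ennreal (pi / a)"
proof -
  have "(\<integral>\<^sup>+ u. ennreal (exp (- a * (norm (u - c :: plane))\<^sup>2)) \<partial>lborel)
      = ennreal pi * (\<integral>\<^sup>+ t. ennreal (exp (- a * t)) * indicator {0..} t \<partial>lborel)"
    by (rule nn_integral_radial[where F = "\<lambda>t. ennreal (exp (- a * t))"]) measurable
  also have "\<dots> = ennreal pi * ennreal (1 / a)"
    using nn_integral_exp_atLeast[OF assms, of 0 0] by simp
  finally show ?thesis using assms by (simp add: ennreal_mult'[symmetric])
qed

lemma nn_integral_gaussian_disc: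
  assumes "0 < a" "0 \<le> \<rho>"
  shows "(\<integral>\<^sup>+ u. ennreal (exp (- a * (norm (u - c :: plane))\<^sup>2)) * indicator (cball c \<rho>) u \<partial>lborel)
    = ennreal (pi * (1 - exp (- a * \<rho>\<^sup>2)) / a)"
proof -
  have "norm (u - c) \<le> \<rho> \<longleftrightarrow> (norm (u - c))\<^sup>2 \<le> \<rho>\<^sup>2" for u :: plane
    using assms abs_le_square_iff[of "norm (u - c)" \<rho>] by simp
  then have "(\<integral>\<^sup>+ u. ennreal (exp (- a * (norm (u - c :: plane))\<^sup>2)) * indicator (cball c \<rho>) u \<partial>lborel)
      = (\<integral>\<^sup>+ u. ennreal (exp (- a * (norm (u - c :: plane))\<^sup>2)) * indicator {0..\<rho>\<^sup>2} ((norm (u - c))\<^sup>2) \<partial>lborel)"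
    by (intro nn_integral_cong) (auto simp: dist_norm norm_minus_commute split: split_indicator)
  also have "\<dots> = ennreal pi * (\<integral>\<^sup>+ t. ennreal (exp (- a * t)) * indicator {0..\<rho>\<^sup>2} t * indicator {0..} t \<partial>lborel)"
    by (rule nn_integral_radial[where F = "\<lambda>t. ennreal (exp (- a * t)) * indicator {0..\<rho>\<^sup>2} t"]) measurable
  also have "(\<integral>\<^sup>+ t. ennreal (exp (- a * t)) * indicator {0..\<rho>\<^sup>2} t * indicator {0..} t \<partial>lborel)
      = (\<integral>\<^sup>+ t. ennreal (exp (- a * t)) * indicator {0..\<rho>\<^sup>2} t \<partial>lborel)"
    by (intro nn_integral_cong) (auto split: split_indicator)
  also have "\<dots> = ennreal ((1 - exp (- a * \<rho>\<^sup>2)) / a)"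
    using assms by (intro nn_integral_exp_Icc) auto
  finally show ?thesis using assms by (simp add: ennreal_mult'[symmetric])
qed

text \<open>The fourth power of the quotient in \<open>optimal_constant\<close> is the squared norm
  of the density divided by \<open>F\<^sup>2\<close>, free of roots.\<close>

lemma optimal_ratio_le:
  assumes "f \<in> L2" "L2_norm f \<noteq> 0"
    and F: "(\<integral>\<^sup>+ x. ennreal ((cmod (f x))\<^sup>2) \<partial>lborel) = ennreal F" "0 < F"
    and N: "ennreal (c * F\<^sup>2) \<le> (\<integral>\<^sup>+ x. ennreal ((cmod (convolution_density (projection_measure \<phi>) f x))\<^sup>2) \<partial>lborel)"
    and "0 \<le> c"
  shows "ennreal c \<le> (optimal_constant \<phi>) ^ 4"
proof -
  let ?h = "convolution_density (projection_measure \<phi>) f"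
  have nf: "L2_norm f = ennreal (sqrt F)"
    using F by (simp add: L2_norm_def ennreal_sqrt_def)
  have pos: "0 < sqrt F" using F by simp
  have "ennreal_sqrt (L2_norm ?h) / L2_norm f \<le> optimal_constant \<phi>"
    unfolding optimal_constant_def using assms by (intro SUP_upper) auto
  then have "(ennreal_sqrt (L2_norm ?h) / L2_norm f) ^ 4 \<le> (optimal_constant \<phi>) ^ 4"
    by (rule power_mono) simp
  moreover have "(ennreal_sqrt (L2_norm ?h) / L2_norm f) ^ 4
      = (ennreal_sqrt (L2_norm ?h)) ^ 4 * (ennreal (1 / sqrt F)) ^ 4"
    unfolding nf divide_ennreal_def using pos by (simp add: inverse_ennreal power_mult_distrib inverse_eq_divide)
  moreover have "(ennreal_sqrt (L2_norm ?h)) ^ 4 = (\<integral>\<^sup>+ x. ennreal ((cmod (?h x))\<^sup>2) \<partial>lborel)"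
  proof -
    have "(ennreal_sqrt (L2_norm ?h)) ^ 4 = ((ennreal_sqrt (L2_norm ?h))\<^sup>2)\<^sup>2"
      unfolding power_mult[symmetric] by simp
    then show ?thesis by (simp only: ennreal_sqrt_power2 L2_norm_power2)
  qed
  moreover have "(ennreal (1 / sqrt F)) ^ 4 = ennreal (1 / F\<^sup>2)"
  proof -
    have "(1 / sqrt F) ^ 4 = ((1 / sqrt F)\<^sup>2)\<^sup>2" unfolding power_mult[symmetric] by simp
    also have "\<dots> = 1 / F\<^sup>2" using F by (simp add: power_divide)
    finally show ?thesis using pos by (simp add: ennreal_power)
  qed
  moreover have "ennreal c = ennreal (c * F\<^sup>2) * ennreal (1 / F\<^sup>2)"
    using assms by (simp add: ennreal_mult[symmetric])
  moreover have "ennreal (c * F\<^sup>2) * ennreal (1 / F\<^sup>2)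
      \<le> (\<integral>\<^sup>+ x. ennreal ((cmod (?h x))\<^sup>2) \<partial>lborel) * ennreal (1 / F\<^sup>2)"
    by (rule mult_right_mono[OF N]) simp
  ultimately show ?thesis by simp
qed

section \<open>Exponential test functions near almost flat points\<close>

context convex_perturbation
begin

text \<open>By \<open>gf\<close>, wherever f(y)f(z) is nonzero it equals \<open>g\<close> at the
  image point, so pairing \<open>h\<close> with \<open>g\<close> gives \<open>F\<^sup>2\<close>.
  Cauchy-Schwarz against the norm of \<open>g\<close>, in additive form, bounds the norm of
  \<open>h\<close> from below.\<close>

lemma convolution_density_lower_bound:
  fixes f :: "plane \<Rightarrow> real" and g :: "space3 \<Rightarrow> real"
  assumes h: "is_convolution_density (projection_measure \<phi>) (\<lambda>y. complex_of_real (f y)) h"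
    and [measurable]: "f \<in> borel_measurable borel" "g \<in> borel_measurable borel"
    and F: "(\<integral>\<^sup>+ y. ennreal ((f y)\<^sup>2) \<partial>lborel) = ennreal F" "0 < F"
    and g: "bounded (range g)" "bounded {x. g x \<noteq> 0}"
    and gf: "\<And>p. g (T p) * (f (fst p) * f (snd p)) = (f (fst p))\<^sup>2 * (f (snd p))\<^sup>2"
    and A: "(\<integral>\<^sup>+ x. ennreal ((g x)\<^sup>2) \<partial>lborel) \<le> ennreal A" "0 < A"
  shows "ennreal (F ^ 4 / A) \<le> (\<integral>\<^sup>+ x. ennreal ((cmod (h x))\<^sup>2) \<partial>lborel)"
proof -
  have cf [measurable]: "(\<lambda>y. complex_of_real (f y)) \<in> borel_measurable borel" by measurable
  have [measurable]: "h \<in> borel_measurable borel"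
    using h unfolding is_convolution_density_iff[OF cf] by blast
  define gc where "gc x = complex_of_real (g x)" for x
  have "gc \<in> borel_measurable borel" unfolding gc_def by measurable
  moreover have "bounded (range gc)"
    using g(1) unfolding bounded_iff gc_def by simp
  moreover have "bounded {x. gc x \<noteq> 0}" using g(2) by (simp add: gc_def)
  ultimately have "(\<integral>x. gc x * h x \<partial>lborel)
      = (\<integral>p. gc (T p) * (complex_of_real (f (fst p)) * complex_of_real (f (snd p))) \<partial>lborel)"
    using h unfolding is_convolution_density_iff[OF cf] by blast
  also have "\<dots> = (\<integral>p. complex_of_real ((f (fst p))\<^sup>2 * (f (snd p))\<^sup>2) \<partial>lborel)"
    by (simp only: gc_def of_real_mult[symmetric] gf)
  also have "\<dots> = complex_of_real (\<integral>p. (f (fst p))\<^sup>2 * (f (snd p))\<^sup>2 \<partial>lborel)"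
    by (rule integral_complex_of_real)
  also have "(\<integral>p. (f (fst p))\<^sup>2 * (f (snd p))\<^sup>2 \<partial>lborel)
      = enn2real (\<integral>\<^sup>+ p. ennreal ((f (fst p))\<^sup>2 * (f (snd p))\<^sup>2) \<partial>lborel)"
    by (rule integral_eq_nn_integral) auto
  also have "(\<integral>\<^sup>+ p. ennreal ((f (fst p))\<^sup>2 * (f (snd p))\<^sup>2) \<partial>lborel) = ennreal F * ennreal F"
    by (subst nn_integral_lborel_pair)
       (auto simp: ennreal_mult nn_integral_cmult nn_integral_multc F(1))
  finally have "(\<integral>x. gc x * h x \<partial>lborel) = complex_of_real (F\<^sup>2)"
    using F(2) by (simp add: ennreal_mult[symmetric] power2_eq_square)
  then have "ennreal (F\<^sup>2) = ennreal (norm (\<integral>x. gc x * h x \<partial>lborel))"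
    by (simp only: norm_of_real abs_power2)
  also have "\<dots> \<le> (\<integral>\<^sup>+ x. ennreal (norm (gc x * h x)) \<partial>lborel)"
    by (rule norm_integral_le_nn_integral)
  also have "\<dots> \<le> (\<integral>\<^sup>+ x. ennreal (F\<^sup>2 / (2 * A)) * ennreal ((g x)\<^sup>2) + ennreal (A / (2 * F\<^sup>2)) * ennreal ((cmod (h x))\<^sup>2) \<partial>lborel)"
  proof (rule nn_integral_mono)
    fix x
    \<comment> \<open>The value \<open>F\<^sup>2 / A\<close> balances the two squares: the
      \<open>g\<close> term then takes at most half of \<open>F\<^sup>2\<close> and can be
      subtracted.\<close>
    define a b t where "a = \<bar>g x\<bar>" and "b = cmod (h x)" and "t = F\<^sup>2 / A"
    have "0 < t" using F A by (simp add: t_def)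
    have "0 \<le> (t * a - b)\<^sup>2 / (2 * t)" using \<open>0 < t\<close> by simp
    also have "\<dots> = t / 2 * a\<^sup>2 + 1 / (2 * t) * b\<^sup>2 - a * b"
      using \<open>0 < t\<close> by (simp add: field_simps power2_eq_square)
    finally have "a * b \<le> t / 2 * a\<^sup>2 + 1 / (2 * t) * b\<^sup>2" by simp
    moreover have "t / 2 = F\<^sup>2 / (2 * A)" "1 / (2 * t) = A / (2 * F\<^sup>2)"
      using F A by (simp_all add: t_def)
    ultimately have "a * b \<le> F\<^sup>2 / (2 * A) * a\<^sup>2 + A / (2 * F\<^sup>2) * b\<^sup>2" by simp
    then have "ennreal (a * b) \<le> ennreal (F\<^sup>2 / (2 * A) * a\<^sup>2 + A / (2 * F\<^sup>2) * b\<^sup>2)"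
      by (rule ennreal_leI)
    also have "\<dots> = ennreal (F\<^sup>2 / (2 * A)) * ennreal (a\<^sup>2) + ennreal (A / (2 * F\<^sup>2)) * ennreal (b\<^sup>2)"
      using F A by (simp add: ennreal_mult[symmetric] ennreal_plus[symmetric] del: ennreal_plus)
    finally show "ennreal (norm (gc x * h x)) \<le> ennreal (F\<^sup>2 / (2 * A)) * ennreal ((g x)\<^sup>2)
        + ennreal (A / (2 * F\<^sup>2)) * ennreal ((cmod (h x))\<^sup>2)"
      by (simp add: a_def b_def gc_def norm_mult)
  qed
  also have "\<dots> = ennreal (F\<^sup>2 / (2 * A)) * (\<integral>\<^sup>+ x. ennreal ((g x)\<^sup>2) \<partial>lborel)
      + ennreal (A / (2 * F\<^sup>2)) * (\<integral>\<^sup>+ x. ennreal ((cmod (h x))\<^sup>2) \<partial>lborel)"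
    by (subst nn_integral_add) (auto simp: nn_integral_cmult)
  also have "\<dots> \<le> ennreal (F\<^sup>2 / (2 * A)) * ennreal A
      + ennreal (A / (2 * F\<^sup>2)) * (\<integral>\<^sup>+ x. ennreal ((cmod (h x))\<^sup>2) \<partial>lborel)"
    by (intro add_right_mono mult_left_mono A) simp
  also have "ennreal (F\<^sup>2 / (2 * A)) * ennreal A = ennreal (F\<^sup>2 / 2)"
    using F A by (simp add: ennreal_mult[symmetric])
  finally have le: "ennreal (F\<^sup>2) \<le> ennreal (F\<^sup>2 / 2)
      + ennreal (A / (2 * F\<^sup>2)) * (\<integral>\<^sup>+ x. ennreal ((cmod (h x))\<^sup>2) \<partial>lborel)" .
  show ?thesis
  proof (cases "\<integral>\<^sup>+ x. ennreal ((cmod (h x))\<^sup>2) \<partial>lborel")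
    case (real N)
    have "ennreal (F\<^sup>2) \<le> ennreal (F\<^sup>2 / 2 + A / (2 * F\<^sup>2) * N)"
      using le F A real(1) unfolding real(2)
      by (simp add: ennreal_mult[symmetric] ennreal_plus[symmetric] del: ennreal_plus)
    moreover have "0 \<le> F\<^sup>2 / 2 + A / (2 * F\<^sup>2) * N"
      using real(1) F A by simp
    ultimately have "F\<^sup>2 \<le> F\<^sup>2 / 2 + A / (2 * F\<^sup>2) * N"
      by (simp only: ennreal_le_iff)
    then have "F\<^sup>2 / 2 \<le> (A * N) / (2 * F\<^sup>2)" by simp
    then have "F\<^sup>2 / 2 * (2 * F\<^sup>2) \<le> A * N"
      using F by (subst (asm) pos_le_divide_eq) auto
    then have "F ^ 4 \<le> N * A" by (simp add: power4_eq_xxxx power2_eq_square mult_ac)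
    then show ?thesis using A real by (simp add: pos_divide_le_eq ennreal_leI)
  qed simp
qed

text \<open>\<open>P\<close> is the height of the surface above its tangent plane \<open>lin\<close>
  at \<open>y0\<close>. As \<open>lin\<close> is affine, \<open>P y + P z\<close> depends on the
  pair only through \<open>T\<close>, which provides \<open>g\<close>. The integral of
  \<open>g\<^sup>2\<close> is bounded through \<open>(norm (y - y0))\<^sup>2 \<le> P y\<close>, the
  mass of \<open>f\<close> through the almost matching bound from above on the disc. The powers of
  \<open>b\<close> cancel in the quotient and leave \<pi>/2, up to
  \<open>(1 + \<eta>)\<^sup>2\<close> and the error of truncating to the disc.\<close>

lemma trial_function:
  assumes "0 < \<eta>" "0 < \<rho>" "0 < b"
    and tangent: "\<And>y. norm (y - y0) \<le> \<rho> \<Longrightarrow> \<phi> y - \<phi> y0 - grad \<phi> y0 \<bullet> (y - y0) \<le> \<eta> * (norm (y - y0))\<^sup>2"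
  shows "ennreal (pi / 2 * ((1 - exp (- (2 * b * (1 + \<eta>)) * \<rho>\<^sup>2)) / (1 + \<eta>))\<^sup>2) \<le> (optimal_constant \<phi>) ^ 4"
proof -
  define lin where "lin y = \<psi> y0 + (2 *\<^sub>R y0 + grad \<phi> y0) \<bullet> (y - y0)" for y
  define P where "P y = \<psi> y - lin y" for y
  have P_eq: "P y = (norm (y - y0))\<^sup>2 + (\<phi> y - \<phi> y0 - grad \<phi> y0 \<bullet> (y - y0))" for y
    unfolding P_def lin_def \<psi>_def norm_plane inner_plane
    by (simp add: power2_eq_square algebra_simps)
  have P_ge: "(norm (y - y0))\<^sup>2 \<le> P y" for y
    using gradient_inequality[of y0 y] by (simp add: P_eq)
  have P_nonneg: "0 \<le> P y" for y by (rule order_trans[OF zero_le_power2 P_ge])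
  have P_le: "P y \<le> (1 + \<eta>) * (norm (y - y0))\<^sup>2" if "norm (y - y0) \<le> \<rho>" for y
    using tangent[OF that] by (simp add: P_eq distrib_right)
  have lin_cont: "continuous_on UNIV lin"
    unfolding lin_def by (intro continuous_intros)
  then have [measurable]: "lin \<in> borel_measurable borel" by (rule borel_measurable_continuous_onI)
  have [measurable]: "P \<in> borel_measurable borel" unfolding P_def by measurable
  have lin_mid: "2 * lin ((1/2) *\<^sub>R (y + z)) = lin y + lin z" for y z
    by (simp add: lin_def inner_diff_right inner_add_right algebra_simps)
  define D where "D = cball y0 \<rho>"
  have [measurable]: "D \<in> sets borel" by (simp add: D_def)
  \<comment> \<open>The cutoff to \<open>D\<close> keeps \<open>f\<close> where
    \<open>tangent\<close> holds and gives \<open>g\<close> a bounded support.\<close>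
  define f where "f y = exp (- b * P y) * indicator D y" for y
  have [measurable]: "f \<in> borel_measurable borel" unfolding f_def by measurable
  have f2: "(f y)\<^sup>2 = exp (- (2 * b) * P y) * indicator D y" for y
    by (simp add: f_def power_mult_distrib exp_double[symmetric] power2_eq_square[of "indicator D y"]
        split: split_indicator)
  have "compact (T ` (D \<times> D))"
    unfolding D_def by (intro compact_continuous_image continuous_on_subset[OF continuous_on_T] compact_Times) auto
  then obtain B where B: "\<And>p. p \<in> D \<times> D \<Longrightarrow> norm (T p) \<le> B"
    by (metis compact_imp_bounded bounded_iff imageI)
  \<comment> \<open>By convexity the image of \<open>T\<close> lies above twice the height at the
    midpoint; on that region the exponent of \<open>g\<close> is nonpositive, hence \<open>g\<close>
    is at most 1.\<close>
  define K where "K = {x :: space3. 2 * \<psi> ((1/2) *\<^sub>R fst x) \<le> snd x} \<inter> cball 0 B"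
  define g where "g x = exp (- b * (snd x - 2 * lin ((1/2) *\<^sub>R fst x))) * indicator K x" for x :: space3
  have "closed K" unfolding K_def
    by (intro closed_Int closed_Collect_le continuous_intros closed_cball)
  then have [measurable]: "K \<in> sets borel" by simp
  have [measurable]: "g \<in> borel_measurable borel" unfolding g_def by measurable
  have g_le: "\<bar>g x\<bar> \<le> 1" for x
  proof (cases "x \<in> K")
    case True
    then have "0 \<le> snd x - 2 * lin ((1/2) *\<^sub>R fst x)"
      using P_nonneg[of "(1/2) *\<^sub>R fst x"] by (simp add: K_def P_def)
    then have "- b * (snd x - 2 * lin ((1/2) *\<^sub>R fst x)) \<le> 0"
      using \<open>0 < b\<close> by (simp add: mult_nonneg_nonneg)
    then show ?thesis using True by (simp add: g_def)
  qed (simp add: g_def)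
  have g_bounded: "bounded (range g)" "bounded {x. g x \<noteq> 0}"
  proof -
    show "bounded (range g)" using g_le unfolding bounded_iff by (auto intro!: exI[of _ 1])
    have "{x. g x \<noteq> 0} \<subseteq> cball 0 B" by (auto simp: g_def K_def split: split_indicator_asm)
    then show "bounded {x. g x \<noteq> 0}" by (rule bounded_subset[OF bounded_cball])
  qed
  have gf: "g (T p) * (f (fst p) * f (snd p)) = (f (fst p))\<^sup>2 * (f (snd p))\<^sup>2" for p
  proof (cases "p \<in> D \<times> D")
    case True
    obtain y z where p: "p = (y, z)" by fastforce
    have "2 * \<psi> ((1/2) *\<^sub>R (y + z)) \<le> \<psi> y + \<psi> z"
    proof -
      have "(1/2) *\<^sub>R (y + z) + (1/2) *\<^sub>R (y - z) = y" "(1/2) *\<^sub>R (y + z) - (1/2) *\<^sub>R (y - z) = z"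
        by (simp_all add: vec_eq_iff field_simps)
      then have "q ((1/2) *\<^sub>R (y + z)) ((1/2) *\<^sub>R (y - z)) = \<psi> y + \<psi> z" by (simp only: q_def)
      then show ?thesis
        using q_ge[of "(1/2) *\<^sub>R (y + z)" "(1/2) *\<^sub>R (y - z)"] zero_le_power2[of "norm ((1/2) *\<^sub>R (y - z))"]
        by linarith
    qed
    then have "T p \<in> K" using B[OF True] by (simp add: K_def p T_def)
    then have "g (T p) = exp (- b * (\<psi> y + \<psi> z - 2 * lin ((1/2) *\<^sub>R (y + z))))"
      by (simp add: g_def p T_def)
    also have "\<dots> = exp (- b * P y) * exp (- b * P z)"
      unfolding lin_mid P_def exp_add[symmetric] by (simp add: algebra_simps)
    finally show ?thesis using True by (simp add: f_def p power2_eq_square)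
  next
    case False
    then show ?thesis by (cases p) (auto simp: f_def)
  qed
  have A: "(\<integral>\<^sup>+ x. ennreal ((g x)\<^sup>2) \<partial>lborel) \<le> ennreal (pi / (2 * b\<^sup>2))"
  proof -
    have "(\<integral>\<^sup>+ x. ennreal ((g x)\<^sup>2) \<partial>lborel) = (\<integral>\<^sup>+ \<xi>. \<integral>\<^sup>+ t. ennreal ((g (\<xi>, t))\<^sup>2) \<partial>lborel \<partial>lborel)"
      by (rule nn_integral_lborel_pair) measurable
    also have "\<dots> \<le> (\<integral>\<^sup>+ \<xi>. ennreal (1 / (2 * b)) * ennreal (exp (- b * (norm (\<xi> - 2 *\<^sub>R y0))\<^sup>2)) \<partial>lborel)"
    proof (rule nn_integral_mono)
      fix \<xi> :: plane
      define c where "c = (1/2) *\<^sub>R \<xi>"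
      have "(\<integral>\<^sup>+ t. ennreal ((g (\<xi>, t))\<^sup>2) \<partial>lborel)
          \<le> (\<integral>\<^sup>+ t. ennreal (exp (- (2 * b) * (t - 2 * lin c))) * indicator {2 * \<psi> c..} t \<partial>lborel)"
        by (intro nn_integral_mono)
           (auto simp: g_def K_def c_def power_mult_distrib exp_double[symmetric] split: split_indicator)
      also have "\<dots> = ennreal (exp (- (2 * b) * (2 * \<psi> c - 2 * lin c)) / (2 * b))"
        using \<open>0 < b\<close> by (intro nn_integral_exp_atLeast) simp
      \<comment> \<open>The half-line integral leaves \<open>exp (- 4 * b * P c)\<close>, and
        \<open>4 * P c\<close> dominates \<open>(norm (\<xi> - 2 *\<^sub>R y0))\<^sup>2\<close>
        because \<open>c\<close> is half of \<xi>.\<close>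
      also have "\<dots> \<le> ennreal (exp (- b * (norm (\<xi> - 2 *\<^sub>R y0))\<^sup>2) / (2 * b))"
      proof -
        have "\<xi> - 2 *\<^sub>R y0 = 2 *\<^sub>R (c - y0)" by (simp add: c_def scaleR_diff_right)
        then have "(norm (\<xi> - 2 *\<^sub>R y0))\<^sup>2 = 4 * (norm (c - y0))\<^sup>2"
          by (simp add: power_mult_distrib)
        also have "\<dots> \<le> 4 * P c" using P_ge[of c] by simp
        finally have "b * (norm (\<xi> - 2 *\<^sub>R y0))\<^sup>2 \<le> b * (4 * P c)"
          using \<open>0 < b\<close> by (intro mult_left_mono) auto
        then have "- (2 * b) * (2 * \<psi> c - 2 * lin c) \<le> - b * (norm (\<xi> - 2 *\<^sub>R y0))\<^sup>2"
          by (simp add: P_def algebra_simps)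
        then show ?thesis using \<open>0 < b\<close> by (intro ennreal_leI divide_right_mono) auto
      qed
      also have "\<dots> = ennreal (1 / (2 * b)) * ennreal (exp (- b * (norm (\<xi> - 2 *\<^sub>R y0))\<^sup>2))"
        using \<open>0 < b\<close> by (simp add: ennreal_mult[symmetric])
      finally show "(\<integral>\<^sup>+ t. ennreal ((g (\<xi>, t))\<^sup>2) \<partial>lborel)
          \<le> ennreal (1 / (2 * b)) * ennreal (exp (- b * (norm (\<xi> - 2 *\<^sub>R y0))\<^sup>2))" .
    qed
    also have "\<dots> = ennreal (1 / (2 * b)) * ennreal (pi / b)"
      using \<open>0 < b\<close> nn_integral_gaussian_plane[of b "2 *\<^sub>R y0"] by (subst nn_integral_cmult) auto
    also have "\<dots> = ennreal (pi / (2 * b\<^sup>2))"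
      using \<open>0 < b\<close> by (simp add: ennreal_mult[symmetric] power2_eq_square)
    finally show ?thesis .
  qed
  define a where "a = 2 * b * (1 + \<eta>)"
  have "0 < a" using assms by (simp add: a_def)
  define I where "I = (\<integral>\<^sup>+ y. ennreal ((f y)\<^sup>2) \<partial>lborel)"
  have I_le: "I \<le> ennreal (pi / (2 * b))"
  proof -
    have "I \<le> (\<integral>\<^sup>+ y. ennreal (exp (- (2 * b) * (norm (y - y0))\<^sup>2)) \<partial>lborel)"
      unfolding I_def f2 using P_ge \<open>0 < b\<close>
      by (intro nn_integral_mono ennreal_leI) (auto split: split_indicator)
    also have "\<dots> = ennreal (pi / (2 * b))" using \<open>0 < b\<close> by (intro nn_integral_gaussian_plane) simp
    finally show ?thesis .
  qed
  have I_ge: "ennreal (pi * (1 - exp (- a * \<rho>\<^sup>2)) / a) \<le> I"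
  proof -
    have "ennreal (pi * (1 - exp (- a * \<rho>\<^sup>2)) / a)
        = (\<integral>\<^sup>+ y. ennreal (exp (- a * (norm (y - y0))\<^sup>2)) * indicator (cball y0 \<rho>) y \<partial>lborel)"
      using \<open>0 < a\<close> \<open>0 < \<rho>\<close> by (intro nn_integral_gaussian_disc[symmetric]) auto
    also have "\<dots> \<le> I"
      unfolding I_def
    proof (rule nn_integral_mono)
      fix y
      show "ennreal (exp (- a * (norm (y - y0))\<^sup>2)) * indicator (cball y0 \<rho>) y \<le> ennreal ((f y)\<^sup>2)"
      proof (cases "y \<in> D")
        case True
        then have "P y \<le> (1 + \<eta>) * (norm (y - y0))\<^sup>2"
          by (intro P_le) (simp add: D_def dist_norm norm_minus_commute)
        then have "(2 * b) * P y \<le> (2 * b) * ((1 + \<eta>) * (norm (y - y0))\<^sup>2)"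
          using \<open>0 < b\<close> by (intro mult_left_mono) auto
        then have "- a * (norm (y - y0))\<^sup>2 \<le> - (2 * b) * P y"
          by (simp add: a_def mult.assoc)
        then show ?thesis using True unfolding f2 by (simp add: D_def ennreal_leI)
      qed (simp add: D_def)
    qed
    finally show ?thesis .
  qed
  obtain F where F: "I = ennreal F" "0 \<le> F"
    using I_le by (cases I) (auto simp: top_unique)
  have e: "0 < 1 - exp (- a * \<rho>\<^sup>2)"
    using \<open>0 < a\<close> \<open>0 < \<rho>\<close> by simp
  then have Fpos0: "0 < pi * (1 - exp (- a * \<rho>\<^sup>2)) / a" using \<open>0 < a\<close> by simp
  then have F_ge: "pi * (1 - exp (- a * \<rho>\<^sup>2)) / a \<le> F"
    using I_ge F by (simp add: F(1))
  with Fpos0 have "0 < F" by simp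
  let ?f = "\<lambda>y. complex_of_real (f y)"
  have norm_f: "(\<integral>\<^sup>+ y. ennreal ((cmod (?f y))\<^sup>2) \<partial>lborel) = ennreal F"
    using F by (simp add: I_def)
  have fL2: "?f \<in> L2" unfolding L2_iff norm_f by simp
  have nonzero: "L2_norm ?f \<noteq> 0"
    using \<open>0 < F\<close> norm_f by (simp add: L2_norm_def ennreal_sqrt_def)
  have lower: "ennreal (F ^ 4 / (pi / (2 * b\<^sup>2))) \<le> (\<integral>\<^sup>+ x. ennreal ((cmod
      (convolution_density (projection_measure \<phi>) ?f x))\<^sup>2) \<partial>lborel)"
    by (rule convolution_density_lower_bound[OF is_convolution_density_convolution_density[OF fL2]
          _ _ _ \<open>0 < F\<close> g_bounded gf A])
       (use F \<open>0 < b\<close> in \<open>auto simp: I_def\<close>)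
  have ratio: "F ^ 4 / (pi / (2 * b\<^sup>2)) = (2 * b\<^sup>2 * F\<^sup>2 / pi) * F\<^sup>2"
    by (simp add: power4_eq_xxxx power2_eq_square)
  have "ennreal (2 * b\<^sup>2 * F\<^sup>2 / pi) \<le> (optimal_constant \<phi>) ^ 4"
    by (rule optimal_ratio_le[OF fL2 nonzero norm_f \<open>0 < F\<close> lower[unfolded ratio]]) simp
  moreover have "pi / 2 * ((1 - exp (- a * \<rho>\<^sup>2)) / (1 + \<eta>))\<^sup>2 \<le> 2 * b\<^sup>2 * F\<^sup>2 / pi"
  proof -
    have "pi / 2 * ((1 - exp (- a * \<rho>\<^sup>2)) / (1 + \<eta>))\<^sup>2
        = 2 * b\<^sup>2 / pi * (pi * (1 - exp (- a * \<rho>\<^sup>2)) / a)\<^sup>2"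
      using assms by (simp add: a_def power_divide power_mult_distrib) (simp add: power2_eq_square)
    also have "\<dots> \<le> 2 * b\<^sup>2 / pi * F\<^sup>2"
      using Fpos0 by (intro mult_left_mono power_mono F_ge) auto
    finally show ?thesis by simp
  qed
  ultimately show ?thesis
    unfolding a_def[symmetric] by (meson ennreal_leI order_trans)
qed

text \<open>The order of the limits matters: an almost flat point fixes \<eta> and the radius, and
  only afterwards \<open>b\<close> tends to infinity, so that the profile shrinks into the disc and
  the truncation error vanishes.\<close>

lemma optimal_constant_ge:
  assumes flat: "\<And>\<epsilon>. 0 < \<epsilon> \<Longrightarrow> \<exists>y0. \<forall>i j. \<bar>hessian \<phi> y0 $ i $ j\<bar> \<le> \<epsilon>"
    and "c < pi / 2"
  shows "ennreal c \<le> (optimal_constant \<phi>) ^ 4"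
proof -
  have "((\<lambda>\<eta>::real. pi / 2 * ((1 - 0) / (1 + 6 * \<eta>))\<^sup>2) \<longlongrightarrow> pi / 2 * ((1 - 0) / (1 + 6 * 0))\<^sup>2) (at_right 0)"
    by (intro tendsto_intros) auto
  then have "\<forall>\<^sub>F \<eta> in at_right (0::real). c < pi / 2 * ((1 - 0) / (1 + 6 * \<eta>))\<^sup>2"
    using \<open>c < pi / 2\<close> by (intro order_tendstoD(1)) auto
  then have "\<forall>\<^sub>F \<eta> in at_right (0::real). 0 < \<eta> \<and> c < pi / 2 * ((1 - 0) / (1 + 6 * \<eta>))\<^sup>2"
    using eventually_at_right_less[of 0] by eventually_elim auto
  then obtain \<eta> where \<eta>: "0 < \<eta>" "c < pi / 2 * ((1 - 0) / (1 + 6 * \<eta>))\<^sup>2"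
    by (auto dest: eventually_happens simp: trivial_limit_at_right_real)
  obtain y0 where "\<And>i j. \<bar>hessian \<phi> y0 $ i $ j\<bar> \<le> \<eta>"
    using flat[OF \<eta>(1)] by blast
  then obtain \<rho>' where "0 < \<rho>'" and \<rho>': "\<And>y. norm (y - y0) < \<rho>' \<Longrightarrow>
      \<phi> y - \<phi> y0 - grad \<phi> y0 \<bullet> (y - y0) \<le> 6 * \<eta> * (norm (y - y0))\<^sup>2"
    using flat_tangent[OF \<eta>(1), of y0] by blast
  define \<rho> where "\<rho> = \<rho>' / 2"
  have \<rho>: "0 < \<rho>" "\<rho> < \<rho>'" using \<open>0 < \<rho>'\<close> by (simp_all add: \<rho>_def)
  have "filterlim (\<lambda>b::real. (2 * (1 + 6 * \<eta>) * \<rho>\<^sup>2) * b) at_top at_top"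
    using \<eta> \<rho> by (intro filterlim_tendsto_pos_mult_at_top[OF tendsto_const _ filterlim_ident]) auto
  then have "((\<lambda>b. exp (- ((2 * (1 + 6 * \<eta>) * \<rho>\<^sup>2) * b))) \<longlongrightarrow> 0) at_top"
    by (intro filterlim_compose[OF exp_at_bot] filterlim_uminus_at_bot[THEN iffD2]) simp
  then have "((\<lambda>b. pi / 2 * ((1 - exp (- ((2 * (1 + 6 * \<eta>) * \<rho>\<^sup>2) * b))) / (1 + 6 * \<eta>))\<^sup>2)
      \<longlongrightarrow> pi / 2 * ((1 - 0) / (1 + 6 * \<eta>))\<^sup>2) at_top"
    using \<eta> by (intro tendsto_intros) auto
  then have "\<forall>\<^sub>F b in at_top. c < pi / 2 * ((1 - exp (- ((2 * (1 + 6 * \<eta>) * \<rho>\<^sup>2) * b))) / (1 + 6 * \<eta>))\<^sup>2"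
    using \<eta>(2) by (rule order_tendstoD(1))
  then have "\<forall>\<^sub>F b in at_top. 0 < b \<and> c < pi / 2 * ((1 - exp (- ((2 * (1 + 6 * \<eta>) * \<rho>\<^sup>2) * b))) / (1 + 6 * \<eta>))\<^sup>2"
    using eventually_gt_at_top[of 0] by eventually_elim auto
  then obtain b where b: "0 < b" "c < pi / 2 * ((1 - exp (- ((2 * (1 + 6 * \<eta>) * \<rho>\<^sup>2) * b))) / (1 + 6 * \<eta>))\<^sup>2"
    by (auto dest: eventually_happens simp: trivial_limit_at_top_linorder)
  have "- ((2 * (1 + 6 * \<eta>) * \<rho>\<^sup>2) * b) = - (2 * b * (1 + 6 * \<eta>)) * \<rho>\<^sup>2"
    by (simp add: mult_ac)
  then have "ennreal c \<le> ennreal (pi / 2 * ((1 - exp (- (2 * b * (1 + 6 * \<eta>)) * \<rho>\<^sup>2)) / (1 + 6 * \<eta>))\<^sup>2)"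
    using b(2) by (intro ennreal_leI less_imp_le) (simp only:)
  also have "\<dots> \<le> (optimal_constant \<phi>) ^ 4"
    by (rule trial_function[of "6 * \<eta>" \<rho> b y0]) (use \<eta> \<rho> b \<rho>' in auto)
  finally show ?thesis .
qed

end

subsection \<open>Concentration of extremizing sequences\<close>

text \<open>Adding all thresholds up to \<open>k\<close> keeps \<open>r k\<close> beyond
  \<open>N k\<close>, and the summand \<open>k\<close> makes the sequence strictly
  increasing.\<close>

lemma strict_mono_diagonal:
  assumes "\<And>k. \<forall>\<^sub>F j in sequentially. P k j"
  shows "\<exists>r :: nat \<Rightarrow> nat. strict_mono r \<and> (\<forall>k. P k (r k))"
proof -
  obtain N where N: "\<And>k j. N k \<le> j \<Longrightarrow> P k j"
    using assms unfolding eventually_sequentially by metis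
  define r where "r k = k + (\<Sum>i\<le>k. N i)" for k
  have "strict_mono r"
    by (simp add: strict_mono_Suc_iff r_def)
  moreover have "N k \<le> r k" for k
    using member_le_sum[of k "{..k}" N] by (simp add: r_def)
  ultimately show ?thesis using N by blast
qed

text \<open>If some disc keeps mass at least \<epsilon> along a subsequence, the product bounds
  become bounds on the mass outside, so the subsequence is tight. Small off-diagonal product mass
  then confines almost everything to shrinking neighbourhoods of points in a fixed ball, and
  compactness yields a limit point, which \<open>curved\<close> forces into
  \<open>Z\<close>.\<close>

lemma concentration_dichotomy:
  fixes M :: "nat \<Rightarrow> 'a::euclidean_space measure" and Z :: "'a set"
  assumes sets: "\<And>n. sets (M n) = sets borel" and fin: "\<And>n. finite_measure (M n)"
    and total: "\<And>\<eta>. 0 < \<eta> \<Longrightarrow> \<forall>\<^sub>F n in sequentially. 1 - \<eta> \<le> measure (M n) UNIV"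
    and annulus: "\<And>\<rho> R \<eta>. 0 < \<eta> \<Longrightarrow> \<forall>\<^sub>F n in sequentially.
      measure (M n) (cball 0 \<rho>) * measure (M n) {z. \<rho> + 1 \<le> norm z \<and> norm z \<le> R} \<le> \<eta>"
    and far: "\<And>\<rho> \<eta>. 0 \<le> \<rho> \<Longrightarrow> 0 < \<eta> \<Longrightarrow> \<exists>R. \<forall>\<^sub>F n in sequentially.
      measure (M n) (cball 0 \<rho>) * measure (M n) {z. R \<le> norm z} \<le> \<eta>"
    and diagonal: "\<And>a R \<eta>. 0 < a \<Longrightarrow> 0 < \<eta> \<Longrightarrow> \<forall>\<^sub>F n in sequentially.
      1 / 2 \<le> measure (M n) (cball 0 R) \<longrightarrow>
      (\<exists>x\<in>cball 0 R. measure (M n) {z. norm z \<le> R \<and> a \<le> norm (x - z)} \<le> \<eta>)"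
    and curved: "\<And>y. y \<notin> Z \<Longrightarrow> \<exists>\<rho>>0. \<forall>\<eta>>0. \<forall>\<^sub>F n in sequentially. measure (M n) (ball y \<rho>) \<le> \<eta>"
  shows "\<exists>r :: nat \<Rightarrow> nat. strict_mono r \<and>
    ((\<exists>y\<in>Z. \<forall>\<epsilon>>0. \<forall>\<rho>>0. \<forall>\<^sub>F n in sequentially. measure (M (r n)) {x. \<rho> \<le> norm (x - y)} < \<epsilon>) \<or>
     (\<forall>\<epsilon>>0. \<forall>\<rho>>0. \<forall>\<^sub>F n in sequentially. measure (M (r n)) (cball 0 \<rho>) < \<epsilon>))"
proof (cases "\<forall>\<epsilon>>0. \<forall>\<rho>>0. \<forall>\<^sub>F n in sequentially. measure (M n) (cball 0 \<rho>) < \<epsilon>")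
  case True
  then show ?thesis by (intro exI[of _ id]) (simp add: strict_mono_id)
next
  case False
  have meas: "A \<in> sets (M n)" if "A \<in> sets borel" for A n
    using that sets by simp
  have sub: "measure (M n) A \<le> measure (M n) B + measure (M n) C"
    if "A \<subseteq> B \<union> C" "B \<in> sets borel" "C \<in> sets borel" for A B C n
  proof -
    interpret finite_measure "M n" by (rule fin)
    have "measure (M n) A \<le> measure (M n) (B \<union> C)"
      using that meas by (intro finite_measure_mono) auto
    also have "\<dots> \<le> measure (M n) B + measure (M n) C"
      using that meas by (intro measure_Un_le) auto
    finally show ?thesis .
  qed
  have mono: "measure (M n) A \<le> measure (M n) B" if "A \<subseteq> B" "B \<in> sets borel" for A B n
    using sub[of A B "{}" n] that by simp
  have borel: "{z :: 'a. \<rho> + 1 \<le> norm z \<and> norm z \<le> R} \<in> sets borel" "{z :: 'a. R \<le> norm z} \<in> sets borel"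
    "{z :: 'a. norm z \<le> R \<and> a \<le> norm (x - z)} \<in> sets borel" "{z :: 'a. a \<le> norm (x - z)} \<in> sets borel"
    "{z :: 'a. a \<le> norm (z - x)} \<in> sets borel" for \<rho> R a x
    by (intro borel_closed closed_Collect_conj closed_Collect_le continuous_intros)+
  obtain \<epsilon> \<rho> where "0 < \<epsilon>" "0 < \<rho>"
    and "\<not> (\<forall>\<^sub>F n in sequentially. measure (M n) (cball 0 \<rho>) < \<epsilon>)"
    using False by blast
  then have "infinite {n. \<epsilon> \<le> measure (M n) (cball 0 \<rho>)}"
    unfolding cofinite_eq_sequentially[symmetric] eventually_cofinite by (simp add: not_less)
  then obtain r0 :: "nat \<Rightarrow> nat" where r0: "strict_mono r0"
    and mass: "\<And>k. \<epsilon> \<le> measure (M (r0 k)) (cball 0 \<rho>)"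
    using infinite_enumerate[of "{n. \<epsilon> \<le> measure (M n) (cball 0 \<rho>)}"] by blast
  \<comment> \<open>The mass of the disc, at least \<epsilon>, is divided out of both product
    bounds; \<open>R\<close> is chosen by \<open>far\<close>, and the gap of 1 in radius keeps the
    annulus at a distance from the disc.\<close>
  have tight: "\<forall>\<^sub>F k in sequentially. measure (M (r0 k)) {z. \<rho> + 1 \<le> norm z} \<le> \<eta>" if "0 < \<eta>" for \<eta>
  proof -
    have "0 < \<epsilon> * (\<eta> / 2)" using that \<open>0 < \<epsilon>\<close> by simp
    then obtain R where R: "\<forall>\<^sub>F n in sequentially.
        measure (M n) (cball 0 \<rho>) * measure (M n) {z. R \<le> norm z} \<le> \<epsilon> * (\<eta> / 2)"
      using far[of \<rho> "\<epsilon> * (\<eta> / 2)"] \<open>0 < \<rho>\<close> by auto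
    have A: "\<forall>\<^sub>F n in sequentially. measure (M n) (cball 0 \<rho>)
        * measure (M n) {z. \<rho> + 1 \<le> norm z \<and> norm z \<le> R} \<le> \<epsilon> * (\<eta> / 2)"
      by (rule annulus) fact
    show ?thesis
      using eventually_subseq[OF r0 R] eventually_subseq[OF r0 A]
    proof eventually_elim
      case (elim k)
      have div: "t \<le> \<eta> / 2" if "measure (M (r0 k)) (cball 0 \<rho>) * t \<le> \<epsilon> * (\<eta> / 2)" "0 \<le> t" for t
      proof -
        have "\<epsilon> * t \<le> \<epsilon> * (\<eta> / 2)"
          using mult_right_mono[OF mass[of k] that(2)] that(1) by linarith
        then show ?thesis using \<open>0 < \<epsilon>\<close> by (rule mult_left_le_imp_le)
      qed
      have "measure (M (r0 k)) {z. \<rho> + 1 \<le> norm z}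
          \<le> measure (M (r0 k)) {z. \<rho> + 1 \<le> norm z \<and> norm z \<le> R} + measure (M (r0 k)) {z. R \<le> norm z}"
        by (rule sub) (use borel in auto)
      also have "\<dots> \<le> \<eta> / 2 + \<eta> / 2"
        using elim by (intro add_mono div) auto
      finally show ?case by simp
    qed
  qed
  define P where "P k j \<longleftrightarrow> (\<exists>x\<in>cball 0 (\<rho> + 1). measure (M (r0 j)) {z. 1 / real (Suc k) \<le> norm (x - z)}
    \<le> 1 / real (Suc k))" for k j
  have "\<forall>\<^sub>F j in sequentially. P k j" for k
  proof -
    \<comment> \<open>At most 1/4, so that the ball retains mass 1 - 1/4 - 1/4 = 1/2 as
      \<open>diagonal\<close> asks; two such errors also stay below
      \<open>1 / real (Suc k)\<close>.\<close>
    define \<eta> where "\<eta> = 1 / real (Suc k) / 4"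
    have \<eta>: "0 < \<eta>" "\<eta> \<le> 1 / 4" by (simp_all add: \<eta>_def)
    have "\<forall>\<^sub>F j in sequentially. 1 - 1 / 4 \<le> measure (M (r0 j)) UNIV"
      by (rule eventually_subseq[OF r0 total]) simp
    moreover have "\<forall>\<^sub>F j in sequentially. 1 / 2 \<le> measure (M (r0 j)) (cball 0 (\<rho> + 1)) \<longrightarrow>
        (\<exists>x\<in>cball 0 (\<rho> + 1). measure (M (r0 j)) {z. norm z \<le> \<rho> + 1 \<and> 1 / real (Suc k) \<le> norm (x - z)} \<le> \<eta>)"
      by (rule eventually_subseq[OF r0 diagonal]) (use \<eta> in auto)
    ultimately show ?thesis using tight[OF \<eta>(1)]
    proof eventually_elim
      case (elim j)
      have "measure (M (r0 j)) UNIV \<le> measure (M (r0 j)) (cball 0 (\<rho> + 1)) + measure (M (r0 j)) {z. \<rho> + 1 \<le> norm z}"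
        by (rule sub) (use borel in auto)
      with elim \<eta> have "1 / 2 \<le> measure (M (r0 j)) (cball 0 (\<rho> + 1))" by simp
      then obtain x where x: "x \<in> cball 0 (\<rho> + 1)"
        "measure (M (r0 j)) {z. norm z \<le> \<rho> + 1 \<and> 1 / real (Suc k) \<le> norm (x - z)} \<le> \<eta>"
        using elim by auto
      have "measure (M (r0 j)) {z. 1 / real (Suc k) \<le> norm (x - z)}
          \<le> measure (M (r0 j)) {z. norm z \<le> \<rho> + 1 \<and> 1 / real (Suc k) \<le> norm (x - z)}
            + measure (M (r0 j)) {z. \<rho> + 1 \<le> norm z}"
        by (rule sub) (use borel in auto)
      also have "\<dots> \<le> \<eta> + \<eta>" using x elim by (intro add_mono) auto
      also have "\<dots> \<le> 1 / real (Suc k)" by (simp add: \<eta>_def divide_simps)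
      finally show ?case using x unfolding P_def by blast
    qed
  qed
  then obtain r1 :: "nat \<Rightarrow> nat" where r1: "strict_mono r1" and "\<And>k. P k (r1 k)"
    using strict_mono_diagonal[of P] by blast
  then obtain x where x: "\<And>k. x k \<in> cball 0 (\<rho> + 1)"
    "\<And>k. measure (M (r0 (r1 k))) {z. 1 / real (Suc k) \<le> norm (x k - z)} \<le> 1 / real (Suc k)"
    unfolding P_def by metis
  obtain l r2 where r2: "strict_mono r2" and lim: "(x \<circ> r2) \<longlonglongrightarrow> l"
    using compact_cball[of "0::'a" "\<rho> + 1"] x(1) unfolding compact_def by blast
  define r where "r = r0 \<circ> (r1 \<circ> r2)"
  have r: "strict_mono r"
    unfolding r_def using r0 r1 r2 by (intro strict_mono_o)
  have conc: "\<forall>\<^sub>F n in sequentially. measure (M (r n)) {z. s \<le> norm (z - l)} < e"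
    if "0 < e" "0 < s" for e s
  proof -
    have inv: "(\<lambda>k. 1 / real (Suc k)) \<longlonglongrightarrow> 0"
      by (rule lim_1_over_n[THEN LIMSEQ_Suc])
    have "\<forall>\<^sub>F k in sequentially. 1 / real (Suc k) < min e (s / 2)"
      using that by (intro order_tendstoD(2)[OF inv]) auto
    from eventually_subseq[OF r2 this] tendstoD[OF lim, of "s / 2"]
    have "\<forall>\<^sub>F k in sequentially. 1 / real (Suc (r2 k)) < min e (s / 2) \<and> dist (x (r2 k)) l < s / 2"
      using that by (simp add: eventually_conj_iff)
    then show ?thesis
    proof eventually_elim
      case (elim k)
      have "{z. s \<le> norm (z - l)} \<subseteq> {z. 1 / real (Suc (r2 k)) \<le> norm (x (r2 k) - z)}"
      proof
        fix z assume "z \<in> {z. s \<le> norm (z - l)}"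
        then show "z \<in> {z. 1 / real (Suc (r2 k)) \<le> norm (x (r2 k) - z)}"
          using elim dist_triangle[of z l "x (r2 k)"] by (simp add: dist_norm norm_minus_commute)
      qed
      then have "measure (M (r k)) {z. s \<le> norm (z - l)} \<le> 1 / real (Suc (r2 k))"
        using mono[of _ _ "r k"] x(2)[of "r2 k"] borel unfolding r_def o_def by (meson order_trans)
      then show ?case using elim by simp
    qed
  qed
  have "l \<in> Z"
  \<comment> \<open>Otherwise the mass near \<open>l\<close> and the mass away from \<open>l\<close>
    would be at most 1/4 each, against a total of at least 3/4.\<close>
  proof (rule ccontr)
    assume "l \<notin> Z"
    then obtain s where "0 < s" and s: "\<And>\<eta>. 0 < \<eta> \<Longrightarrow> \<forall>\<^sub>F n in sequentially. measure (M n) (ball l s) \<le> \<eta>"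
      using curved by blast
    have "\<forall>\<^sub>F n in sequentially. measure (M (r n)) (ball l s) \<le> 1 / 4"
      by (rule eventually_subseq[OF r s]) simp
    moreover have "\<forall>\<^sub>F n in sequentially. 1 - 1 / 4 \<le> measure (M (r n)) UNIV"
      by (rule eventually_subseq[OF r total]) simp
    moreover have "\<forall>\<^sub>F n in sequentially. measure (M (r n)) {z. s \<le> norm (z - l)} < 1 / 4"
      using \<open>0 < s\<close> by (intro conc) auto
    ultimately have "\<forall>\<^sub>F n in sequentially. False"
    proof eventually_elim
      case (elim n)
      have "measure (M (r n)) UNIV \<le> measure (M (r n)) (ball l s) + measure (M (r n)) {z. s \<le> norm (z - l)}"
        by (rule sub) (use borel in \<open>auto simp: dist_norm norm_minus_commute\<close>)
      then show False using elim by simp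
    qed
    then show False by simp
  qed
  then show ?thesis using r conc by blast
qed

section \<open>From weights to concentration of the extremizing sequence\<close>

context convex_perturbation
begin

text \<open>\<open>M n\<close> is the measure with density |f_n|^2, \<open>Q n\<close> its product
  with itself on the plane of pairs, \<open>E n\<close> the squared norm of the convolution density.
  The hypotheses of \<open>concentration_dichotomy\<close> on products, on the diagonal and on
  curved points are all smallness of \<open>Q n\<close> on some set, and each comes from a weight
  through \<open>gain\<close>.\<close>

lemma extremizing_sequence_concentrates:
  fixes f :: "nat \<Rightarrow> plane \<Rightarrow> complex"
  assumes flat: "\<And>\<epsilon>. 0 < \<epsilon> \<Longrightarrow> \<exists>y0. \<forall>i j. \<bar>hessian \<phi> y0 $ i $ j\<bar> \<le> \<epsilon>"
    and ext: "extremizing_sequence \<phi> f"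
  shows "\<exists>r :: nat \<Rightarrow> nat. strict_mono r \<and>
    ((\<exists>y0. hessian \<phi> y0 = 0 \<and> concentrates_at (f \<circ> r) y0) \<or> concentrates_at_infinity (f \<circ> r))"
proof -
  define h where "h n = convolution_density (projection_measure \<phi>) (f n)" for n
  define I where "I n = (\<integral>\<^sup>+ y. ennreal ((cmod (f n y))\<^sup>2) \<partial>lborel)" for n
  define E where "E n = (\<integral>\<^sup>+ x. ennreal ((cmod (h n x))\<^sup>2) \<partial>lborel)" for n
  have fL2: "f n \<in> L2" and norm_le: "L2_norm (f n) \<le> 1" for n
    using ext by (auto simp: extremizing_sequence_def)
  have [measurable]: "f n \<in> borel_measurable borel" for n
    using fL2 by (simp add: L2_iff)
  have I_eq: "I n = (L2_norm (f n))\<^sup>2" for n by (simp add: I_def L2_norm_power2)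
  have I_le: "I n \<le> 1" for n
    unfolding I_eq using power_mono[OF norm_le, of n 2] by simp
  have h: "is_convolution_density (projection_measure \<phi>) (f n) (h n)" for n
    unfolding h_def by (rule is_convolution_density_convolution_density[OF fL2])
  define w where "w n p = (cmod (f n (fst p)))\<^sup>2 * (cmod (f n (snd p)))\<^sup>2" for n and p :: "plane \<times> plane"
  have w [measurable]: "w n \<in> borel_measurable borel" for n
    unfolding w_def by measurable
  have w_nonneg: "0 \<le> w n p" for n p by (simp add: w_def)
  define Q where "Q n S = (\<integral>\<^sup>+ p. ennreal (w n p) * indicator S p \<partial>lborel)" for n S
  define M where "M n = density lborel (\<lambda>y. ennreal ((cmod (f n y))\<^sup>2))" for n
  have M_sets: "sets (M n) = sets borel" for n by (simp add: M_def)
  have M_eq: "emeasure (M n) A = (\<integral>\<^sup>+ y. ennreal ((cmod (f n y))\<^sup>2) * indicator A y \<partial>lborel)"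
    if "A \<in> sets borel" for n A
    using that unfolding M_def by (subst emeasure_density) auto
  have M_UNIV: "emeasure (M n) UNIV = I n" for n by (simp add: M_eq I_def)
  have M_fin: "finite_measure (M n)" for n
  proof (rule finite_measureI)
    have "space (M n) = UNIV" by (simp add: M_def)
    then show "emeasure (M n) (space (M n)) \<noteq> \<infinity>"
      using I_le[of n] M_UNIV[of n] by (auto simp: top_unique)
  qed
  have M_real: "emeasure (M n) A = ennreal (measure (M n) A)" for n A
    by (rule finite_measure.emeasure_eq_measure[OF M_fin])
  have Q_times: "Q n (A \<times> B) = emeasure (M n) A * emeasure (M n) B"
    if [measurable]: "A \<in> sets borel" "B \<in> sets borel" for n A B
  proof -
    have "A \<times> B \<in> sets borel" using that by (simp add: borel_prod[symmetric])
    then have "Q n (A \<times> B) = (\<integral>\<^sup>+ y. \<integral>\<^sup>+ z. (ennreal ((cmod (f n y))\<^sup>2) * indicator A y)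
        * (ennreal ((cmod (f n z))\<^sup>2) * indicator B z) \<partial>lborel \<partial>lborel)"
    proof -
      have [measurable]: "A \<times> B \<in> sets borel" by fact
      have "ennreal (w n (y, z)) * indicator (A \<times> B) (y, z) = (ennreal ((cmod (f n y))\<^sup>2) * indicator A y)
          * (ennreal ((cmod (f n z))\<^sup>2) * indicator B z)" for y z
        by (cases "y \<in> A"; cases "z \<in> B") (simp_all add: w_def ennreal_mult)
      then show ?thesis
        unfolding Q_def by (subst nn_integral_lborel_pair) simp_all
    qed
    also have "\<dots> = emeasure (M n) A * emeasure (M n) B"
      by (simp add: M_eq nn_integral_cmult nn_integral_multc)
    finally show ?thesis .
  qed
  have Q_UNIV: "(\<integral>\<^sup>+ p. ennreal (w n p) \<partial>lborel) = I n * I n" for n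
    using Q_times[of UNIV UNIV n] by (simp add: Q_def M_UNIV)
  have E_lower: "\<forall>\<^sub>F n in sequentially. ennreal (pi / 2 - \<eta>) \<le> E n" if "0 < \<eta>" for \<eta>
  proof -
    \<comment> \<open>The maximum with 0 allows square roots; \<open>c'\<close>, halfway to \<pi>/2,
      supplies the strict inequality that convergence of the norms requires.\<close>
    define c where "c = max 0 (pi / 2 - \<eta>)"
    define c' where "c' = (c + pi / 2) / 2"
    have "c < pi / 2"
      unfolding c_def max_less_iff_conj using that by simp
    then have c: "0 \<le> c" "c < c'" "c' < pi / 2"
      by (simp_all add: c_def c'_def)
    have lower: "ennreal c' \<le> ((optimal_constant \<phi>)\<^sup>2)\<^sup>2"
      using optimal_constant_ge[OF flat c(3)] by (simp add: power_mult[symmetric])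
    have "ennreal (sqrt c) < (optimal_constant \<phi>)\<^sup>2"
    proof (rule ccontr)
      assume "\<not> ?thesis"
      then have "((optimal_constant \<phi>)\<^sup>2)\<^sup>2 \<le> (ennreal (sqrt c))\<^sup>2" by (intro power_mono) auto
      also have "\<dots> = ennreal c" using c by (simp add: ennreal_power)
      finally have "ennreal c' \<le> ennreal c" using lower by (rule order_trans[rotated])
      then show False using c by simp
    qed
    then have "\<forall>\<^sub>F n in sequentially. ennreal (sqrt c) < L2_norm (h n)"
      using ext unfolding extremizing_sequence_def h_def by (intro order_tendstoD(1)) auto
    then show ?thesis
    proof eventually_elim
      case (elim n)
      then have "(ennreal (sqrt c))\<^sup>2 \<le> (L2_norm (h n))\<^sup>2" by (intro power_mono) auto
      then have "ennreal c \<le> E n" using c by (simp add: ennreal_power E_def L2_norm_power2)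
      moreover have "ennreal (pi / 2 - \<eta>) \<le> ennreal c" by (intro ennreal_leI) (simp add: c_def)
      ultimately show ?case by (rule order_trans[rotated])
    qed
  qed
  have E_upper: "E n \<le> (\<integral>\<^sup>+ p. ennreal (W p * w n p) \<partial>lborel)" if "admissible W" for W n
    unfolding E_def w_def by (rule convolution_density_bound[OF h _ that]) measurable
  \<comment> \<open>The weight bounds \<open>E n + \<delta> * Q n S\<close> by
    \<open>pi / 2 + \<eta>\<close>, the total masses being at most 1, while \<open>E n\<close> is
    eventually almost \<pi>/2; the difference bounds \<open>Q n S\<close>.\<close>
  have gain: "\<forall>\<^sub>F n in sequentially. Q n S \<le> ennreal ((\<eta> + \<eta>') / \<delta>)"
    if W: "admissible W" and [measurable]: "S \<in> sets borel" and pos: "0 < \<delta>" "0 \<le> \<eta>" "0 < \<eta>'"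
      and le: "\<And>p. W p + \<delta> * indicator S p \<le> pi / 2 + \<eta>" for W S \<delta> \<eta> \<eta>'
  proof -
    \<comment> \<open>The cap 1 keeps \<open>pi / 2 - e\<close> nonnegative, so that
      \<open>ennreal\<close> does not truncate it.\<close>
    define e where "e = min \<eta>' 1"
    have e: "0 < e" "e \<le> \<eta>'" "e \<le> 1" using pos by (auto simp: e_def)
    have [measurable]: "W \<in> borel_measurable borel" and W_pos: "\<And>p. 0 < W p"
      using W by (auto simp: admissible_def)
    have sum_le: "E n + ennreal \<delta> * Q n S \<le> ennreal (pi / 2 + \<eta>)" for n
    proof -
      have "E n + ennreal \<delta> * Q n S
          \<le> (\<integral>\<^sup>+ p. ennreal (W p * w n p) \<partial>lborel) + (\<integral>\<^sup>+ p. ennreal \<delta> * (ennreal (w n p) * indicator S p) \<partial>lborel)"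
        unfolding Q_def using E_upper[OF W] by (intro add_mono) (auto simp: nn_integral_cmult)
      also have "\<dots> = (\<integral>\<^sup>+ p. ennreal (W p * w n p) + ennreal \<delta> * (ennreal (w n p) * indicator S p) \<partial>lborel)"
        by (rule nn_integral_add[symmetric]) measurable
      also have "\<dots> \<le> (\<integral>\<^sup>+ p. ennreal (pi / 2 + \<eta>) * ennreal (w n p) \<partial>lborel)"
      proof (rule nn_integral_mono)
        fix p
        have "ennreal (W p * w n p) + ennreal \<delta> * (ennreal (w n p) * indicator S p)
            = ennreal (W p * w n p) + ennreal (\<delta> * indicator S p * w n p)"
          using pos w_nonneg[of n p] by (auto simp: ennreal_mult split: split_indicator)
        also have "\<dots> = ennreal ((W p + \<delta> * indicator S p) * w n p)"
          using pos w_nonneg[of n p] less_imp_le[OF W_pos[of p]]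
          by (subst ennreal_plus[symmetric]) (auto simp: distrib_right)
        also have "\<dots> \<le> ennreal ((pi / 2 + \<eta>) * w n p)"
          by (intro ennreal_leI mult_right_mono le w_nonneg)
        also have "\<dots> = ennreal (pi / 2 + \<eta>) * ennreal (w n p)"
          using pos w_nonneg[of n p] by (intro ennreal_mult) auto
        finally show "ennreal (W p * w n p) + ennreal \<delta> * (ennreal (w n p) * indicator S p)
            \<le> ennreal (pi / 2 + \<eta>) * ennreal (w n p)" .
      qed
      also have "\<dots> = ennreal (pi / 2 + \<eta>) * (I n * I n)"
        by (subst nn_integral_cmult) (auto simp: Q_UNIV)
      also have "\<dots> \<le> ennreal (pi / 2 + \<eta>) * (1 * 1)"
        by (intro mult_left_mono mult_mono I_le) auto
      finally show ?thesis by simp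
    qed
    show ?thesis
      using E_lower[OF e(1)]
    proof eventually_elim
      case (elim n)
      have total: "ennreal (pi / 2 - e) + ennreal \<delta> * Q n S \<le> ennreal (pi / 2 + \<eta>)"
        using elim sum_le[of n] by (meson add_right_mono order_trans)
      have "Q n S \<noteq> top"
        using total pos by (auto simp: ennreal_mult_top top_unique)
      then obtain t where t: "Q n S = ennreal t" "0 \<le> t" by (cases "Q n S") auto
      have nonneg: "0 \<le> pi / 2 - e" using e pi_gt3 by simp
      have "ennreal (pi / 2 - e) + ennreal \<delta> * Q n S = ennreal (pi / 2 - e + \<delta> * t)"
        using nonneg pos t by (simp add: ennreal_mult[symmetric] ennreal_plus[symmetric] del: ennreal_plus)
      with total have "ennreal (pi / 2 - e + \<delta> * t) \<le> ennreal (pi / 2 + \<eta>)" by simp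
      then have "pi / 2 - e + \<delta> * t \<le> pi / 2 + \<eta>"
        using pos by (subst (asm) ennreal_le_iff) (auto intro: add_nonneg_nonneg)
      then have "t * \<delta> \<le> \<eta> + \<eta>'" using e by (simp add: mult.commute)
      then have "t \<le> (\<eta> + \<eta>') / \<delta>" using pos by (simp add: pos_le_divide_eq)
      then show ?case unfolding t(1) by (rule ennreal_leI)
    qed
  qed
  have Q_mono: "Q n A \<le> Q n B" if "A \<subseteq> B" for A B n
    unfolding Q_def using that by (intro nn_integral_mono mult_left_mono) (auto split: split_indicator)
  have product_le: "measure (M n) A * measure (M n) B \<le> \<eta>"
    if "Q n S \<le> ennreal \<eta>" "A \<times> B \<subseteq> S" "A \<in> sets borel" "B \<in> sets borel" "0 \<le> \<eta>" for n A B S \<eta>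
  proof -
    have "ennreal (measure (M n) A * measure (M n) B) = Q n (A \<times> B)"
      using that by (simp add: Q_times M_real ennreal_mult)
    also have "\<dots> \<le> ennreal \<eta>" using Q_mono[OF that(2)] that(1) by (rule order_trans)
    finally show ?thesis using that(5) by simp
  qed
  define off where "off a R = {p :: plane \<times> plane. norm (fst p) \<le> R \<and> norm (snd p) \<le> R \<and> a \<le> norm (fst p - snd p)}" for a R
  have off_borel: "off a R \<in> sets borel" for a R
    unfolding off_def by (intro borel_closed closed_Collect_conj closed_Collect_le continuous_intros)
  have off_small: "\<forall>\<^sub>F n in sequentially. Q n (off a R) \<le> ennreal \<eta>" if pos: "0 < a" "0 < \<eta>" for a R \<eta>
  proof -
    obtain \<delta> W where "0 < \<delta>" "admissible W" "\<And>p. W p + \<delta> * indicator (off a R) p \<le> pi / 2"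
      by (rule weight_off_diagonal[OF pos(1), where R = R, folded off_def], rule that)
    then have "\<forall>\<^sub>F n in sequentially. Q n (off a R) \<le> ennreal ((0 + \<delta> * \<eta>) / \<delta>)"
      using pos by (intro gain[of W]) (auto simp: off_borel)
    then show ?thesis using \<open>0 < \<delta>\<close> by simp
  qed
  \<comment> \<open>The weight \<pi>/2 bounds \<open>E n\<close> by \<pi>/2 times the square of the
    mass, hence times the mass, as it does not exceed 1; so the masses tend to 1.\<close>
  have total: "\<forall>\<^sub>F n in sequentially. 1 - \<eta> \<le> measure (M n) UNIV" if "0 < \<eta>" for \<eta>
  proof -
    have "0 < pi / 2 * \<eta>" using that by simp
    from E_lower[OF this] show ?thesis
    proof eventually_elim
      case (elim n)
      have "E n \<le> (\<integral>\<^sup>+ p. ennreal (pi / 2 * w n p) \<partial>lborel)"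
        by (rule E_upper[OF admissible_half_pi])
      also have "\<dots> = (\<integral>\<^sup>+ p. ennreal (pi / 2) * ennreal (w n p) \<partial>lborel)"
        by (intro nn_integral_cong ennreal_mult) (auto simp: w_nonneg)
      also have "\<dots> = ennreal (pi / 2) * (I n * I n)"
        by (subst nn_integral_cmult) (auto simp: Q_UNIV)
      also have "\<dots> \<le> ennreal (pi / 2) * (I n * 1)"
        by (intro mult_left_mono I_le) auto
      also have "\<dots> = ennreal (pi / 2 * measure (M n) UNIV)"
        unfolding M_UNIV[symmetric] M_real mult_1_right by (rule ennreal_mult[symmetric]) auto
      finally have "ennreal (pi / 2 - pi / 2 * \<eta>) \<le> ennreal (pi / 2 * measure (M n) UNIV)"
        using elim by (rule order_trans[rotated])
      then have "pi / 2 - pi / 2 * \<eta> \<le> pi / 2 * measure (M n) UNIV"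
        by (subst (asm) ennreal_le_iff) auto
      then have "pi / 2 * (1 - \<eta>) \<le> pi / 2 * measure (M n) UNIV"
        by (simp add: algebra_simps)
      then show ?case by (rule mult_left_le_imp_le) simp
    qed
  qed
  have "\<exists>r :: nat \<Rightarrow> nat. strict_mono r \<and>
    ((\<exists>y\<in>{y. hessian \<phi> y = 0}. \<forall>\<epsilon>>0. \<forall>\<rho>>0. \<forall>\<^sub>F n in sequentially. measure (M (r n)) {x. \<rho> \<le> norm (x - y)} < \<epsilon>) \<or>
     (\<forall>\<epsilon>>0. \<forall>\<rho>>0. \<forall>\<^sub>F n in sequentially. measure (M (r n)) (cball 0 \<rho>) < \<epsilon>))"
  proof (rule concentration_dichotomy)
    show "sets (M n) = sets borel" "finite_measure (M n)" for n
      by (rule M_sets M_fin)+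
    show "\<forall>\<^sub>F n in sequentially. 1 - \<eta> \<le> measure (M n) UNIV" if "0 < \<eta>" for \<eta>
      by (rule total[OF that])
  next
    fix \<rho> R \<eta> :: real assume "0 < \<eta>"
    have "\<forall>\<^sub>F n in sequentially. Q n (off 1 (max \<rho> R)) \<le> ennreal \<eta>"
      by (rule off_small) (use \<open>0 < \<eta>\<close> in auto)
    then show "\<forall>\<^sub>F n in sequentially.
        measure (M n) (cball 0 \<rho>) * measure (M n) {z. \<rho> + 1 \<le> norm z \<and> norm z \<le> R} \<le> \<eta>"
    proof eventually_elim
      case (elim n)
      show ?case
      proof (rule product_le[OF elim])
        show "cball 0 \<rho> \<times> {z. \<rho> + 1 \<le> norm z \<and> norm z \<le> R} \<subseteq> off 1 (max \<rho> R)"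
        proof clarify
          fix y z :: plane assume "y \<in> cball 0 \<rho>" "\<rho> + 1 \<le> norm z" "norm z \<le> R"
          then show "(y, z) \<in> off 1 (max \<rho> R)"
            using norm_triangle_ineq2[of z y] by (simp add: off_def norm_minus_commute)
        qed
        show "{z :: plane. \<rho> + 1 \<le> norm z \<and> norm z \<le> R} \<in> sets borel"
          by (intro borel_closed closed_Collect_conj closed_Collect_le continuous_intros)
      qed (use \<open>0 < \<eta>\<close> in auto)
    qed
  next
    fix \<rho> \<eta> :: real assume "0 \<le> \<rho>" "0 < \<eta>"
    \<comment> \<open>With the gap 1/2 and two errors of \<open>\<eta> / 4\<close>, the bound from
      \<open>gain\<close> is exactly \<eta>.\<close>
    then have "0 < \<eta> / 4" by simp
    obtain R W where W: "admissible W"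
      "\<And>p. W p + 1 / 2 * indicator {p. norm (fst p) \<le> \<rho> \<and> R \<le> norm (snd p)} p \<le> pi / 2 + \<eta> / 4"
      by (rule weight_far[OF \<open>0 \<le> \<rho>\<close> \<open>0 < \<eta> / 4\<close>], rule that)
    let ?S = "{p :: plane \<times> plane. norm (fst p) \<le> \<rho> \<and> R \<le> norm (snd p)}"
    have borel: "?S \<in> sets borel" "{z :: plane. R \<le> norm z} \<in> sets borel"
      by (intro borel_closed closed_Collect_conj closed_Collect_le continuous_intros)+
    have "\<forall>\<^sub>F n in sequentially. Q n ?S \<le> ennreal ((\<eta> / 4 + \<eta> / 4) / (1 / 2))"
      by (rule gain[OF W(1) borel(1) _ _ _ W(2)]) (use \<open>0 < \<eta>\<close> in auto)
    then have "\<forall>\<^sub>F n in sequentially. Q n ?S \<le> ennreal \<eta>" by simp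
    then have "\<forall>\<^sub>F n in sequentially. measure (M n) (cball 0 \<rho>) * measure (M n) {z. R \<le> norm z} \<le> \<eta>"
    proof eventually_elim
      case (elim n)
      show ?case by (rule product_le[OF elim]) (use \<open>0 < \<eta>\<close> borel in auto)
    qed
    then show "\<exists>R. \<forall>\<^sub>F n in sequentially. measure (M n) (cball 0 \<rho>) * measure (M n) {z. R \<le> norm z} \<le> \<eta>"
      by blast
  next
    fix a R \<eta> :: real assume "0 < a" "0 < \<eta>"
    have "\<forall>\<^sub>F n in sequentially. Q n (off a R) \<le> ennreal (\<eta> / 3)"
      by (rule off_small) (use \<open>0 < \<eta>\<close> \<open>0 < a\<close> in auto)
    then show "\<forall>\<^sub>F n in sequentially. 1 / 2 \<le> measure (M n) (cball 0 R) \<longrightarrow>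
      (\<exists>x\<in>cball 0 R. measure (M n) {z. norm z \<le> R \<and> a \<le> norm (x - z)} \<le> \<eta>)"
    proof eventually_elim
      case (elim n)
      \<comment> \<open>If around every point of the ball mass at least \<eta> lay at distance
        \<open>a\<close> or more, integration over the ball, of mass at least 1/2, would give
        off-diagonal product mass at least \<open>\<eta> / 2\<close>, more than
        \<open>\<eta> / 3\<close>.\<close>
      show ?case
      proof (intro impI, rule ccontr)
        assume half: "1 / 2 \<le> measure (M n) (cball 0 R)"
          and "\<not> (\<exists>x\<in>cball 0 R. measure (M n) {z. norm z \<le> R \<and> a \<le> norm (x - z)} \<le> \<eta>)"
        then have large: "\<eta> \<le> measure (M n) {z. norm z \<le> R \<and> a \<le> norm (x - z)}" if "x \<in> cball 0 R" for x
          using that by force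
        have [measurable]: "off a R \<in> sets borel" by (rule off_borel)
        have "ennreal (\<eta> * (1 / 2)) \<le> ennreal \<eta> * emeasure (M n) (cball 0 R)"
          unfolding M_real using half \<open>0 < \<eta>\<close>
          by (subst ennreal_mult[symmetric]) (auto intro!: ennreal_leI)
        also have "\<dots> = (\<integral>\<^sup>+ y. ennreal \<eta> * (ennreal ((cmod (f n y))\<^sup>2) * indicator (cball 0 R) y) \<partial>lborel)"
          by (subst nn_integral_cmult) (auto simp: M_eq)
        also have "\<dots> \<le> (\<integral>\<^sup>+ y. \<integral>\<^sup>+ z. ennreal (w n (y, z)) * indicator (off a R) (y, z) \<partial>lborel \<partial>lborel)"
        proof (rule nn_integral_mono)
          fix y
          have set: "{z :: plane. norm z \<le> R \<and> a \<le> norm (y - z)} \<in> sets borel"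
            by (intro borel_closed closed_Collect_conj closed_Collect_le continuous_intros)
          show "ennreal \<eta> * (ennreal ((cmod (f n y))\<^sup>2) * indicator (cball 0 R) y)
              \<le> (\<integral>\<^sup>+ z. ennreal (w n (y, z)) * indicator (off a R) (y, z) \<partial>lborel)"
          proof (cases "y \<in> cball 0 R")
            case True
            have "(\<integral>\<^sup>+ z. ennreal (w n (y, z)) * indicator (off a R) (y, z) \<partial>lborel)
                = (\<integral>\<^sup>+ z. ennreal ((cmod (f n y))\<^sup>2) * (ennreal ((cmod (f n z))\<^sup>2)
                    * indicator {z. norm z \<le> R \<and> a \<le> norm (y - z)} z) \<partial>lborel)"
              using True by (intro nn_integral_cong) (auto simp: w_def off_def ennreal_mult split: split_indicator)
            also have "\<dots> = ennreal ((cmod (f n y))\<^sup>2) * emeasure (M n) {z. norm z \<le> R \<and> a \<le> norm (y - z)}"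
              using set by (subst nn_integral_cmult) (auto simp: M_eq)
            finally show ?thesis
              using True large[OF True] unfolding M_real
              by (simp add: mult.commute[of "ennreal \<eta>"] mult_left_mono ennreal_leI)
          qed simp
        qed
        also have "\<dots> = Q n (off a R)"
          unfolding Q_def by (rule nn_integral_lborel_pair[symmetric]) measurable
        finally have "ennreal (\<eta> * (1 / 2)) \<le> ennreal (\<eta> / 3)" using elim by (rule order_trans)
        then show False using \<open>0 < \<eta>\<close> by (subst (asm) ennreal_le_iff) auto
      qed
    qed
  next
    fix y :: plane assume "y \<notin> {y. hessian \<phi> y = 0}"
    then have curved: "hessian \<phi> y \<noteq> 0" by simp
    obtain \<delta> \<rho> W where W: "0 < \<delta>" "0 < \<rho>" "admissible W"
      "\<And>p. W p + \<delta> * indicator (ball y \<rho> \<times> ball y \<rho>) p \<le> pi / 2"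
      by (rule weight_curved_point[OF curved], rule that)
    have borel: "ball y \<rho> \<times> ball y \<rho> \<in> sets borel" by (simp add: open_Times)
    have "\<forall>\<^sub>F n in sequentially. measure (M n) (ball y \<rho>) \<le> \<eta>" if "0 < \<eta>" for \<eta>
    proof -
      have "\<forall>\<^sub>F n in sequentially. Q n (ball y \<rho> \<times> ball y \<rho>) \<le> ennreal ((0 + \<delta> * \<eta>\<^sup>2) / \<delta>)"
        by (rule gain[OF W(3) borel W(1)]) (use W that in auto)
      then show ?thesis
      proof eventually_elim
        case (elim n)
        \<comment> \<open>The tolerance is \<open>\<delta> * \<eta>\<^sup>2\<close> because the
          product mass of the ball with itself is the square of its mass.\<close>
        then have "Q n (ball y \<rho> \<times> ball y \<rho>) \<le> ennreal (\<eta>\<^sup>2)" using W(1) by simp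
        then have "measure (M n) (ball y \<rho>) * measure (M n) (ball y \<rho>) \<le> \<eta>\<^sup>2"
          by (rule product_le) auto
        then show ?case
          using that power2_le_imp_le[of "measure (M n) (ball y \<rho>)" \<eta>] by (simp add: power2_eq_square)
      qed
    qed
    then show "\<exists>\<rho>>0. \<forall>\<eta>>0. \<forall>\<^sub>F n in sequentially. measure (M n) (ball y \<rho>) \<le> \<eta>"
      using W(2) by blast
  qed
  then obtain r :: "nat \<Rightarrow> nat" where r: "strict_mono r" and alt:
    "(\<exists>y\<in>{y. hessian \<phi> y = 0}. \<forall>\<epsilon>>0. \<forall>\<rho>>0. \<forall>\<^sub>F n in sequentially. measure (M (r n)) {x. \<rho> \<le> norm (x - y)} < \<epsilon>) \<or>
     (\<forall>\<epsilon>>0. \<forall>\<rho>>0. \<forall>\<^sub>F n in sequentially. measure (M (r n)) (cball 0 \<rho>) < \<epsilon>)"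
    by blast
  \<comment> \<open>Concentration is measured relative to the norm of the function; a squared norm
    of at least 1/2 makes the absolute bound \<open>\<epsilon> / 2\<close> sufficient.\<close>
  have I_half: "\<forall>\<^sub>F n in sequentially. ennreal (1 / 2) \<le> I (r n)"
    using eventually_subseq[OF r total[of "1 / 2", simplified]]
    by eventually_elim (simp add: M_UNIV[symmetric] M_real ennreal_leI del: ennreal_half)
  have small: "\<exists>N. \<forall>n\<ge>N. (\<integral>\<^sup>+ y \<in> A. ennreal ((cmod ((f \<circ> r) n y))\<^sup>2) \<partial>lborel)
      < ennreal \<epsilon> * (L2_norm ((f \<circ> r) n))\<^sup>2"
    if "0 < \<epsilon>" "A \<in> sets borel" "\<forall>\<^sub>F n in sequentially. measure (M (r n)) A < \<epsilon> / 2" for A \<epsilon>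
  proof -
    have "\<forall>\<^sub>F n in sequentially. (\<integral>\<^sup>+ y \<in> A. ennreal ((cmod ((f \<circ> r) n y))\<^sup>2) \<partial>lborel)
      < ennreal \<epsilon> * (L2_norm ((f \<circ> r) n))\<^sup>2"
      using that(3) I_half
    proof eventually_elim
      case (elim n)
      have "(\<integral>\<^sup>+ y \<in> A. ennreal ((cmod ((f \<circ> r) n y))\<^sup>2) \<partial>lborel) = ennreal (measure (M (r n)) A)"
        using that(2) by (simp add: M_eq[symmetric] M_real)
      also have "\<dots> < ennreal (\<epsilon> * (1 / 2))"
        using elim(1) that(1) by (intro ennreal_lessI) auto
      also have "\<dots> = ennreal \<epsilon> * ennreal (1 / 2)" using that(1) by (intro ennreal_mult) auto
      also have "\<dots> \<le> ennreal \<epsilon> * I (r n)" by (intro mult_left_mono elim(2)) simp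
      finally show ?case by (simp add: I_eq)
    qed
    then show ?thesis by (simp add: eventually_sequentially)
  qed
  show ?thesis
  proof (intro exI[of _ r] conjI r)
    show "(\<exists>y0. hessian \<phi> y0 = 0 \<and> concentrates_at (f \<circ> r) y0) \<or> concentrates_at_infinity (f \<circ> r)"
      using alt
    proof (elim disjE bexE)
      fix y assume y: "y \<in> {y. hessian \<phi> y = 0}" and conc: "\<forall>\<epsilon>>0. \<forall>\<rho>>0. \<forall>\<^sub>F n in sequentially.
        measure (M (r n)) {x. \<rho> \<le> norm (x - y)} < \<epsilon>"
      have "concentrates_at (f \<circ> r) y"
        unfolding concentrates_at_def
      proof (intro allI impI)
        fix \<epsilon> \<rho> :: real assume pos: "0 < \<epsilon>" "0 < \<rho>"
        show "\<exists>N. \<forall>n\<ge>N. (\<integral>\<^sup>+ y \<in> {z. norm (z - y) \<ge> \<rho>}. ennreal ((cmod ((f \<circ> r) n y))\<^sup>2) \<partial>lborel)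
          < ennreal \<epsilon> * (L2_norm ((f \<circ> r) n))\<^sup>2"
        proof (rule small[OF pos(1)])
          show "{z. norm (z - y) \<ge> \<rho>} \<in> sets borel"
            by (intro borel_closed closed_Collect_le continuous_intros)
          show "\<forall>\<^sub>F n in sequentially. measure (M (r n)) {z. norm (z - y) \<ge> \<rho>} < \<epsilon> / 2"
            by (rule conc[rule_format]) (use pos in auto)
        qed
      qed
      with y show ?thesis by blast
    next
      assume conc: "\<forall>\<epsilon>>0. \<forall>\<rho>>0. \<forall>\<^sub>F n in sequentially. measure (M (r n)) (cball 0 \<rho>) < \<epsilon>"
      have "concentrates_at_infinity (f \<circ> r)"
        unfolding concentrates_at_infinity_def
      proof (intro allI impI)
        fix \<epsilon> \<rho> :: real assume pos: "0 < \<epsilon>" "0 < \<rho>"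
        have ball: "{y :: plane. norm y \<le> \<rho>} = cball 0 \<rho>" by auto
        show "\<exists>N. \<forall>n\<ge>N. (\<integral>\<^sup>+ y \<in> {y. norm y \<le> \<rho>}. ennreal ((cmod ((f \<circ> r) n y))\<^sup>2) \<partial>lborel)
          < ennreal \<epsilon> * (L2_norm ((f \<circ> r) n))\<^sup>2"
          unfolding ball
        proof (rule small[OF pos(1)])
          show "\<forall>\<^sub>F n in sequentially. measure (M (r n)) (cball 0 \<rho>) < \<epsilon> / 2"
            by (rule conc[rule_format]) (use pos in auto)
        qed simp
      qed
      then show ?thesis by blast
    qed
  qed
qed

end

theorem theorem1p5:
  fixes \<phi> :: "real ^ 2 \<Rightarrow> real"
    and f :: "nat \<Rightarrow> real ^ 2 \<Rightarrow> complex"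
  assumes "\<And>y. 0 \<le> \<phi> y"
    and "twice_continuously_differentiable \<phi>"
    and "strictly_convex \<phi>"
    and "(\<exists>y0. hessian \<phi> y0 = 0) \<or>
         (\<exists>y :: nat \<Rightarrow> real ^ 2.
            filterlim (\<lambda>n. norm (y n)) at_top sequentially \<and>
            (\<lambda>n. hessian \<phi> (y n)) \<longlonglongrightarrow> 0)"
    and "extremizing_sequence \<phi> f"
  shows "\<exists>r :: nat \<Rightarrow> nat. strict_mono r \<and>
           ((\<exists>y0. hessian \<phi> y0 = 0 \<and> concentrates_at (f \<circ> r) y0) \<or>
            concentrates_at_infinity (f \<circ> r))"
proof -
  interpret convex_perturbation \<phi>
    using assms(1-3) by unfold_locales
  \<comment> \<open>Either alternative yields points at which all Hessian entries are arbitrarily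
    small, the form in which flatness enters the lower bound for the optimal constant.\<close>
  have "\<exists>y0. \<forall>i j. \<bar>hessian \<phi> y0 $ i $ j\<bar> \<le> \<epsilon>" if "0 < \<epsilon>" for \<epsilon> :: real
  proof -
    have "\<exists>y0. norm (hessian \<phi> y0) < \<epsilon>"
      using assms(4)
    proof (elim disjE exE conjE)
      fix y0 assume "hessian \<phi> y0 = 0"
      then show ?thesis using that by (intro exI[of _ y0]) simp
    next
      fix y :: "nat \<Rightarrow> real ^ 2" assume "(\<lambda>n. hessian \<phi> (y n)) \<longlonglongrightarrow> 0"
      then have "\<forall>\<^sub>F n in sequentially. norm (hessian \<phi> (y n)) < \<epsilon>"
        using tendstoD[OF _ that] by fastforce
      then show ?thesis by (auto simp: eventually_sequentially)
    qed
    then obtain y0 where y0: "norm (hessian \<phi> y0) < \<epsilon>" by blast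
    have "\<bar>hessian \<phi> y0 $ i $ j\<bar> \<le> \<epsilon>" for i j
      using component_le_norm_cart[of "hessian \<phi> y0 $ i" j] Finite_Cartesian_Product.norm_nth_le[of "hessian \<phi> y0" i] y0
      by linarith
    then show ?thesis by blast
  qed
  then show ?thesis
    using assms(5) by (rule extremizing_sequence_concentrates)
qed

end
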